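(* Let $\theta\in\mathbb R$, $d=\{te^{\mathrm i\theta}\mid t\ge0\}$, let $\Omega$ be a non-empty closed discrete subset of $\mathbb C$ and $I$ an open interval of length $<\pi$ containing $\theta$ such that $$\Omega\cap\{\xi e^{\mathrm i\theta'}\mid\xi\ge0,\ \theta'\in I\}=\{\omega_m\}_{m\in\mathbb N}\subset d,\qquad\omega_0=0\prec\omega_1\prec\omega_2\prec\cdots$$ ($\prec$ being the order induced by $t\mapsto te^{\mathrm i\theta}$). Let $I^+=\{\theta^+\in I\mid\theta^+<\theta\}$, $I^-=\{\theta^-\in I\mid\theta^->\theta\}$, and let $\gamma:I^+\cup I^-\to\mathbb R$ be locally bounded. Consider $m\in\mathbb N$ and real numbers $\rho$ and $\epsilon$ such that $|\omega_m|<\rho<|\omega_{m+1}|$ and $0<\epsilon<\min\{\frac\pi2,\mathrm{dist}(\theta,\partial I)\}$. Then, for any $\Phi\in E^{I,\gamma}(\Omega,d,m)$ such that $[\mathbf\Delta^+_d\Phi]_m\in E^{I,\gamma}(\Omega,d,m)$, one has $$\mathcal L^+\Phi(z)=\mathcal L^-[\mathbf\Delta^+_d\Phi]_m(z)+O\bigl(e^{-\rho\,\mathrm{Re}(e^{\mathrm i\theta}z)}\bigr)$$ uniformly for $z\in\mathcal D(I^+_\epsilon,\gamma+\epsilon)\cap\mathcal D(I^-_\epsilon,\gamma+\epsilon)$, where $I^+_\epsilon=\{\theta^+\in I\mid\theta^+<\theta-\epsilon\}$ and $I^-_\epsilon=\{\theta^-\in I\mid\theta^->\theta+\epsilon\}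$.
   Context: Laplace transforms. For an open interval $J$ and locally bounded $\gamma:J\to\mathbb R$, $\mathcal N(J,\gamma)$ is the set of $\hat\varphi\in\mathbb C\{\zeta\}$ extending analytically to $\{\xi e^{\mathrm i\theta'}\mid\xi>0,\theta'\in J\}$ with $|\hat\varphi(\xi e^{\mathrm i\theta'})|\le\alpha(\theta')e^{\gamma(\theta')\xi}$ for some locally bounded $\alpha:J\to\mathbb R^+$. $\mathcal D(J,\gamma)=\bigcup_{\theta'\in J}\{\mathrm{Re}(ze^{\mathrm i\theta'})>\gamma(\theta')\}$ and, for $a\delta+\hat\varphi\in\mathbb C\delta\oplus\mathcal N(J,\gamma)$ ($|J|\le\pi$), $\mathcal L^J(a\delta+\hat\varphi)(z)=a+\int_0^{+\infty}e^{-z\xi e^{\mathrm i\theta'}}\hat\varphi(\xi e^{\mathrm i\theta'})e^{\mathrm i\theta'}d\xi$ for any $\theta'\in J$ with $\mathrm{Re}(ze^{\mathrm i\theta'})>\gamma(\theta')$; this is well defined and holomorphic on $\mathcal D(J,\gamma)$. Here $\delta$ is a symbol (convolution unit). Simple resurgent functions. For $\Omega$ non-empty closed discrete, $\rho(\Omega)=\min\{|\omega|:\omega\in\Omega\setminus\{0\}\}$ and $\mathbb D^*_R=\{0<|\zeta|<R\}$. A germ $\hat\varphi\in\mathbb C\{\zeta\}$ is $\Omega$-continuable if there is $R>0$ not larger than its radius of convergence with $\mathbb D_R^*\cap\Omega=\emptyset$ such that $\hat\varphi$ has analytic continuation along every path of $\mathbb C\setminus\Omega$ starting in $\mathbb D^*_R$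 (one can take $R=\rho(\Omega)$); $\mathrm{cont}_\gamma\hat\varphi$ is the germ at the endpoint of the path $\gamma$. A function $f$ holomorphic in an open disc $D\subset\mathbb C^*$ with $0\in\partial D$ has a simple singularity at $0$ if $f(\zeta)=\frac{a}{2\pi\mathrm i\zeta}+\hat\psi(\zeta)\frac{\log\zeta}{2\pi\mathrm i}+R(\zeta)$ for $\zeta\in D$ close to $0$, with $a\in\mathbb C$, $\hat\psi,R\in\mathbb C\{\zeta\}$; $\mathrm{sing}_0f=a\delta+\hat\psi$. $a\delta+\hat\varphi$, with $\hat\varphi$ $\Omega$-continuable, is simple $\Omega$-resurgent if for every $\omega\in\Omega$ and every path $\gamma$ of $\mathbb C\setminus\Omega$ starting in $\mathbb D^*_{\rho(\Omega)}$ and ending at the centre of an open disc $D\subset\mathbb C\setminus\Omega$ with $\omega\in\partial D$, $\zeta\mapsto(\mathrm{cont}_\gamma\hat\varphi)(\omega+\zeta)$ on $-\omega+D$ has a simple singularity at $0$, denoted $\mathcal A^\gamma_\omega(a\delta+\hat\varphi)$. The set of simple $\Omega$-resurgent functions is $\mathbb C\delta\oplus\hat{\mathscr R}^{\mathrm{simp}}_\Omega$. For $\omega\in\Omega\setminus\{0\}$, $\Delta^+_\omega:=\mathcal A^\gamma_\omega:\mathbb C\delta\oplus\hat{\mathscr R}^{\mathrm{simp}}_\Omega\to\mathbb C\delta\oplus\hat{\mathscr R}^{\mathrm{simp}}_{-\omega+\Omega}$ for $\gamma$ starting on $]0,\omega[$ near $0$, ending on $]0,\omega[$ near $\omega$,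 and following $]0,\omega[$ except that every point of $\Omega\cap{]0,\omega[}$ is circumvented to the right (for an observer going from $0$ to $\omega$) by a small half-circle. Resurgent symbols. For $\omega\in\Omega\cap d$, $E_\omega(\Omega)$ is the space of formal sums $a\delta_\omega+\hat\varphi^\omega$ with $a\delta+\hat\varphi\in\mathbb C\delta\oplus\hat{\mathscr R}^{\mathrm{simp}}_{-\omega+\Omega}$, where $\delta_\omega$ is a symbol and $\hat\varphi^\omega(\zeta)=\hat\varphi(\zeta-\omega)$; $\tau_\omega:a\delta+\hat\varphi\mapsto a\delta_\omega+\hat\varphi^\omega$ is the corresponding isomorphism. $E(\Omega,d)=\prod_{\omega\in\Omega\cap d}E_\omega(\Omega)$, elements being written as possibly infinite sums $\sum\Phi^\omega$. The symbolic Stokes automorphism $\mathbf\Delta^+_d:E(\Omega,d)\to E(\Omega,d)$ is the linear operator (compatible with infinite sums) such that $\mathbf\Delta^+_d\Phi=\Phi+\sum_{r\ge1}\tau_{\omega_{m+r}}\Delta^+_{\omega_{m+r}-\omega_m}\tau_{\omega_m}^{-1}\Phi$ for $\Phi\in E_{\omega_m}(\Omega)$. For $m\in\mathbb N$, $[\sum_{\omega}\Phi^\omega]_m=\sum_{j=0}^m\Phi^{\omega_j}$. $E^{I,\gamma}_\omega(\Omega)=\tau_\omega\bigl(\mathbb C\delta\oplus(\hat{\mathscr R}^{\mathrm{simp}}_{-\omega+\Omega}\cap\mathcal N(I^+,\gamma)\cap\mathcal N(I^-,\gamma))\bigr)$ and $E^{I,\gamma}(\Omega,d,m)=\bigoplus_{j=0}^mE^{I,\gamma}_{\omega_j}(\Omega)$.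 For $\Phi=\sum_{j=0}^m\Phi^{\omega_j}\in E^{I,\gamma}(\Omega,d,m)$, $\mathcal L^\pm\Phi(z)=\sum_{j=0}^me^{-\omega_jz}\,\mathcal L^{I^\pm}(\tau_{\omega_j}^{-1}\Phi^{\omega_j})(z)$, holomorphic in $\mathcal D(I^\pm,\gamma)$.
   Formalization: The formal statement adds that γ is bounded below on I^+_ε ∪ I^-_ε; if γ tends to −∞ at the end points of I, the domains can be all of ℂ and the uniform estimate fails (Ω=ℤ, φ=e^{−ζ²}(π cot πζ − 1/ζ), z→−∞). *)

theory Defs
  imports "HOL-Complex_Analysis.Complex_Analysis"
begin

(* An element a delta + phi of C delta (+) C{zeta} is a pair (a, phi), where the convergent germ
   phi at the origin is given by its Taylor series, with fps_conv_radius phi > 0.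
   More generally a germ at a point p is given by its Taylor series at p. *)

type_synonym delta_germ = "complex \<times> complex fps"

section \<open>Laplace transforms\<close>

definition locally_bounded_on :: "real set \<Rightarrow> (real \<Rightarrow> real) \<Rightarrow> bool" where
  "locally_bounded_on J f \<longleftrightarrow> (\<forall>t\<in>J. \<exists>U. open U \<and> t \<in> U \<and> bounded (f ` (J \<inter> U)))"

definition open_sector :: "real set \<Rightarrow> complex set" where
  "open_sector J = {of_real \<xi> * cis t | \<xi> t. 0 < \<xi> \<and> t \<in> J}"

(* F is the analytic extension of the germ phi to the sector.  It is unique when J is an interval
   of length at most pi, the only case used. *)
definition sector_extension :: "real set \<Rightarrow> complex fps \<Rightarrow> (complex \<Rightarrow> complex) \<Rightarrow> bool" where
  "sector_extension J \<phi> F \<longleftrightarrow>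
     F holomorphic_on open_sector J \<and>
     (\<forall>\<^sub>F \<zeta> in at 0 within open_sector J. F \<zeta> = eval_fps \<phi> \<zeta>)"

definition exp_growth_germs :: "real set \<Rightarrow> (real \<Rightarrow> real) \<Rightarrow> complex fps set" where
  "exp_growth_germs J \<gamma> =
     {\<phi>. 0 < fps_conv_radius \<phi> \<and>
         (\<exists>F A. sector_extension J \<phi> F \<and> locally_bounded_on J A \<and>
           (\<forall>t\<in>J. 0 \<le> A t \<and>
             (\<forall>\<xi>>0. cmod (F (of_real \<xi> * cis t)) \<le> A t * exp (\<gamma> t * \<xi>))))}"

definition laplace_domain :: "real set \<Rightarrow> (real \<Rightarrow> real) \<Rightarrow> complex set" where
  "laplace_domain J \<gamma> = (\<Union>t\<in>J. {z. \<gamma> t < Re (z * cis t)})"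

(* The value at z is the common value of the integrals along all directions t in J that are
   admissible for z; there is at least one such direction exactly when z is in the domain. *)
definition laplace :: "real set \<Rightarrow> (real \<Rightarrow> real) \<Rightarrow> delta_germ \<Rightarrow> complex \<Rightarrow> complex" where
  "laplace J \<gamma> S z =
     (let F = (SOME F. sector_extension J (snd S) F) in
      THE v. \<forall>t\<in>J. \<gamma> t < Re (z * cis t) \<longrightarrow>
        v = fst S + (LBINT \<xi>:{0<..}. exp (- (z * of_real \<xi> * cis t)) * F (of_real \<xi> * cis t) * cis t))"

section \<open>Simple resurgent functions\<close>

(* G t is the Taylor series at g t of the continuation of phi along g restricted to [0,t].
   Equality of two power series near g s is meaningful for s close to t, since then g s lies in
   the disc of convergence of G t centred at g t. *)
definition continuation_along :: "complex fps \<Rightarrow> (real \<Rightarrow> complex) \<Rightarrow> (real \<Rightarrow> complex fps) \<Rightarrow> bool" where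
  "continuation_along \<phi> g G \<longleftrightarrow>
     ereal (cmod (g 0)) < fps_conv_radius \<phi> \<and>
     (\<forall>\<^sub>F \<zeta> in nhds (g 0). eval_fps (G 0) (\<zeta> - g 0) = eval_fps \<phi> \<zeta>) \<and>
     (\<forall>t\<in>{0..1}. 0 < fps_conv_radius (G t) \<and>
        (\<forall>\<^sub>F s in at t within {0..1}. \<forall>\<^sub>F \<zeta> in nhds (g s).
            eval_fps (G s) (\<zeta> - g s) = eval_fps (G t) (\<zeta> - g t)))"

definition cont :: "(real \<Rightarrow> complex) \<Rightarrow> complex fps \<Rightarrow> complex fps" where
  "cont g \<phi> = (THE \<psi>. \<exists>G. continuation_along \<phi> g G \<and> \<psi> = G 1)"

definition punctured_disc :: "ereal \<Rightarrow> complex set" where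
  "punctured_disc R = {\<zeta>. \<zeta> \<noteq> 0 \<and> ereal (cmod \<zeta>) < R}"

definition continuable :: "complex set \<Rightarrow> complex fps \<Rightarrow> bool" where
  "continuable \<Omega> \<phi> \<longleftrightarrow>
     (\<exists>R::real. 0 < R \<and> ereal R \<le> fps_conv_radius \<phi> \<and> punctured_disc R \<inter> \<Omega> = {} \<and>
        (\<forall>g. path g \<and> path_image g \<subseteq> - \<Omega> \<and> pathstart g \<in> punctured_disc R \<longrightarrow>
           (\<exists>G. continuation_along \<phi> g G)))"

(* A minimum whenever \<Omega> is closed and contains a non-zero point; infinite if it contains none. *)
definition rho :: "complex set \<Rightarrow> ereal" where
  "rho \<Omega> = (INF \<omega>\<in>\<Omega> - {0}. ereal (cmod \<omega>))"

(* D is meant to be an open disc with 0 on its boundary, and l is a branch of the logarithm on D.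
   Another branch only changes r, so that (a, psi) does not depend on the choice of l. *)
definition has_simple_singularity :: "(complex \<Rightarrow> complex) \<Rightarrow> complex set \<Rightarrow> delta_germ \<Rightarrow> bool" where
  "has_simple_singularity f D S \<longleftrightarrow>
     f holomorphic_on D \<and> 0 < fps_conv_radius (snd S) \<and>
     (\<exists>r l. 0 < fps_conv_radius r \<and> l holomorphic_on D \<and> (\<forall>\<zeta>\<in>D. exp (l \<zeta>) = \<zeta>) \<and>
        (\<forall>\<^sub>F \<zeta> in at 0 within D.
           f \<zeta> = fst S / (2 * of_real pi * \<i> * \<zeta>)
               + eval_fps (snd S) \<zeta> * l \<zeta> / (2 * of_real pi * \<i>) + eval_fps r \<zeta>))"

definition sing0 :: "(complex \<Rightarrow> complex) \<Rightarrow> complex set \<Rightarrow> delta_germ" where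
  "sing0 f D = (THE S. has_simple_singularity f D S)"

(* The disc D centred at the endpoint of g with \<omega> on its boundary, translated by - \<omega>, and the
   function \<zeta> \<mapsto> (cont g phi)(\<omega> + \<zeta>) on it. When D avoids \<Omega> and phi is continuable, the Taylor
   series of cont g phi at the centre of D converges on the whole of D. *)
definition disc_at :: "complex \<Rightarrow> (real \<Rightarrow> complex) \<Rightarrow> complex set" where
  "disc_at \<omega> g = ball (pathfinish g - \<omega>) (dist \<omega> (pathfinish g))"

definition cont_at :: "complex \<Rightarrow> (real \<Rightarrow> complex) \<Rightarrow> complex fps \<Rightarrow> complex \<Rightarrow> complex" where
  "cont_at \<omega> g \<phi> \<zeta> = eval_fps (cont g \<phi>) (\<omega> + \<zeta> - pathfinish g)"

definition simple_resurgent :: "complex set \<Rightarrow> delta_germ set" where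
  "simple_resurgent \<Omega> =
     {S. continuable \<Omega> (snd S) \<and>
         (\<forall>\<omega>\<in>\<Omega>. \<forall>g. path g \<and> path_image g \<subseteq> - \<Omega> \<and> pathstart g \<in> punctured_disc (rho \<Omega>) \<and>
             ball (pathfinish g) (dist \<omega> (pathfinish g)) \<subseteq> - \<Omega> \<longrightarrow>
           (\<exists>T. has_simple_singularity (cont_at \<omega> g (snd S)) (disc_at \<omega> g) T))}"

definition alien :: "complex \<Rightarrow> (real \<Rightarrow> complex) \<Rightarrow> delta_germ \<Rightarrow> delta_germ" where
  "alien \<omega> g S = sing0 (cont_at \<omega> g (snd S)) (disc_at \<omega> g)"

(* For small e > 0 this follows ]0,\<omega>[ from modulus e to modulus |\<omega>| - e, except that each point
   of \<Omega> on ]0,\<omega>[ is avoided along a half-circle of radius e; the half-circles are disjoint, so at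
   most one term of the sum is non-zero. The right-hand side, for an observer moving in the
   direction sgn \<omega>, is the side of - \<i> * sgn \<omega>. *)
definition right_path :: "complex set \<Rightarrow> complex \<Rightarrow> real \<Rightarrow> real \<Rightarrow> complex" where
  "right_path \<Omega> \<omega> e t =
     (let x = e + t * (cmod \<omega> - 2 * e) in
      sgn \<omega> * Complex x
        (- (\<Sum>s | 0 < s \<and> s < cmod \<omega> \<and> of_real s * sgn \<omega> \<in> \<Omega>. sqrt (max 0 (e\<^sup>2 - (x - s)\<^sup>2)))))"

(* The common value for all sufficiently small radii. *)
definition Delta_plus :: "complex set \<Rightarrow> complex \<Rightarrow> delta_germ \<Rightarrow> delta_germ" where
  "Delta_plus \<Omega> \<omega> S = (THE T. \<forall>\<^sub>F e in at_right 0. T = alien \<omega> (right_path \<Omega> \<omega> e) S)"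

section \<open>Resurgent symbols\<close>

(* An element of E_\<omega>(\<Omega>) is a delta_\<omega> + phi^\<omega> with phi^\<omega> a germ at \<omega>.  Since germs are given by
   Taylor series at their base point, tau_\<omega> leaves the pair (a, phi) unchanged and the base point is
   carried by the index: \<Phi> \<omega> is the component of \<Phi> in E_\<omega>(\<Omega>). *)

type_synonym symbols = "complex \<Rightarrow> delta_germ"

definition half_line :: "real \<Rightarrow> complex set" where
  "half_line \<theta> = {of_real t * cis \<theta> | t. 0 \<le> t}"

definition translated :: "complex set \<Rightarrow> complex \<Rightarrow> complex set" where
  "translated \<Omega> \<omega> = (\<lambda>\<zeta>. - \<omega> + \<zeta>) ` \<Omega>"

definition resurgent_symbols :: "complex set \<Rightarrow> complex set \<Rightarrow> symbols set" where
  "resurgent_symbols \<Omega> d =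
     {\<Phi>. (\<forall>\<omega>\<in>\<Omega> \<inter> d. \<Phi> \<omega> \<in> simple_resurgent (translated \<Omega> \<omega>)) \<and> (\<forall>\<omega>. \<omega> \<notin> \<Omega> \<inter> d \<longrightarrow> \<Phi> \<omega> = 0)}"

(* On a half-line from the origin the order of the points is the order of their moduli. *)
definition Stokes_single :: "complex set \<Rightarrow> complex set \<Rightarrow> complex \<Rightarrow> delta_germ \<Rightarrow> symbols" where
  "Stokes_single \<Omega> d \<omega> S \<omega>' =
     (if \<omega>' = \<omega> then S
      else if \<omega>' \<in> \<Omega> \<inter> d \<and> cmod \<omega> < cmod \<omega>' then Delta_plus (translated \<Omega> \<omega>) (\<omega>' - \<omega>) S
      else 0)"

(* The infinite sum of the images of the homogeneous components: each component of it is a finite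
   sum, since the image of E_\<omega>(\<Omega>) has zero components before \<omega>. *)
definition Stokes :: "complex set \<Rightarrow> complex set \<Rightarrow> symbols \<Rightarrow> symbols" where
  "Stokes \<Omega> d \<Phi> \<omega>' = (\<Sum>\<omega> | \<omega> \<in> \<Omega> \<inter> d \<and> cmod \<omega> \<le> cmod \<omega>'. Stokes_single \<Omega> d \<omega> (\<Phi> \<omega>) \<omega>')"

definition trunc :: "(nat \<Rightarrow> complex) \<Rightarrow> nat \<Rightarrow> symbols \<Rightarrow> symbols" where
  "trunc w m \<Phi> \<omega> = (if \<omega> \<in> w ` {..m} then \<Phi> \<omega> else 0)"

definition right_of :: "real set \<Rightarrow> real \<Rightarrow> real set" where
  "right_of I \<theta> = {t \<in> I. t < \<theta>}"

definition left_of :: "real set \<Rightarrow> real \<Rightarrow> real set" where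
  "left_of I \<theta> = {t \<in> I. t > \<theta>}"

(* I^+ is right_of I \<theta> and I^- is left_of I \<theta>. *)
definition summable_symbols ::
    "real set \<Rightarrow> real \<Rightarrow> (real \<Rightarrow> real) \<Rightarrow> complex set \<Rightarrow> (nat \<Rightarrow> complex) \<Rightarrow> nat \<Rightarrow> symbols set" where
  "summable_symbols I \<theta> \<gamma> \<Omega> w m =
     {\<Phi> \<in> resurgent_symbols \<Omega> (half_line \<theta>).
        (\<forall>j\<le>m. snd (\<Phi> (w j)) \<in> exp_growth_germs (right_of I \<theta>) \<gamma> \<inter> exp_growth_germs (left_of I \<theta>) \<gamma>) \<and>
        (\<forall>\<omega>. \<omega> \<notin> w ` {..m} \<longrightarrow> \<Phi> \<omega> = 0)}"

definition laplace_symbols ::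
    "real set \<Rightarrow> (real \<Rightarrow> real) \<Rightarrow> (nat \<Rightarrow> complex) \<Rightarrow> nat \<Rightarrow> symbols \<Rightarrow> complex \<Rightarrow> complex" where
  "laplace_symbols J \<gamma> w m \<Phi> z = (\<Sum>j\<le>m. exp (- (w j * z)) * laplace J \<gamma> (\<Phi> (w j)) z)"

end

theory Submission
  imports Defs
begin

text \<open>Let $F_j$ be the continuation of the germ of $\Phi^{\omega_j}$ to the sector on the right of
  the ray $d$. It continues analytically across each gap of the singularities on $d$ into the left
  sector, and by the shape of a simple singularity $a/(2\pi i\zeta) + \hat\psi\log\zeta/(2\pi i) + R$
  the branches obtained by crossing two consecutive gaps differ by the minor $\hat\psi$ of
  $\Delta^+\Phi^{\omega_j}$ at the singularity between them. Likewise, primitives of the branches times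
  $e^{-z\zeta}$ that coincide on the right differ on the left by a primitive of $\hat\psi e^{-z\zeta}$
  whose value at the singularity is $a$ times the exponential there. Summing over all components,
  the contributions telescope: up to the integrals beyond $\rho e^{i\theta}$, both Laplace
  transforms are the same combination of boundary values of primitives at $\rho e^{i\theta}$. Only
  the total $[\Delta^+_d\Phi]_m$ has a controlled growth on the left, so the individual jumps are
  never integrated to infinity.

  For the uniform bound, when $|z|$ is large the directions $\theta \pm \epsilon/2$ are admissible
  with a large margin, and both remainders are bounded by $e^{-\rho Re(e^{i\theta}z)}$. When
  $|z|$ is bounded this factor is bounded below, and the margin $\epsilon$ makes it possible to
  choose the directions of integration in compact parts of $I^+$ and $I^-$.\<close>

section \<open>Sectors\<close>

text \<open>The point \<open>of_real \<rho> * cis \<theta>\<close> lies on the common boundary of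
  the two sectors, and the growth bounds are only locally uniform in directions of the two open
  intervals, so they say nothing there. From that point the contours leave the ray along unit
  segments into either sector, where only the continuity of one branch on a compact set is used, and
  then run to infinity. Integrals are replaced by differences of primitives normalised at the
  vertex. These are chosen anew for each \<open>z\<close>, so the estimates are stated for all
  \<open>z\<close> and all primitives at once, with constants independent of both. The directions
  admissible for a given \<open>z\<close> need not include \<open>\<theta> - \<epsilon> / 2\<close>
  or \<open>\<theta> + \<epsilon> / 2\<close>, and \<open>\<gamma>\<close> is not controlled from
  above towards the ends of the interval. The lower bound \<open>gamma_below\<close> enters at both
  places where this matters: for large \<open>z\<close> it forces the real parts in these two
  directions to be large, and for bounded \<open>z\<close> it allows a nearly minimal value of
  \<open>\<gamma>\<close> to be picked near each end.\<close>

lemma polar_cis: "z = of_real (cmod z) * cis (Arg z)"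
  using rcis_cmod_Arg[of z] by (simp add: rcis_def)

lemma Im_of_real_cis_mult: "Im (of_real x * cis t * cis (- s)) = x * sin (t - s)"
  by (simp add: cis_mult mult.assoc)

lemma Re_mult_cis_add: "Re (z * cis (s + t)) = Re (z * cis s) * cos t - Im (z * cis s) * sin t"
  by (simp add: cis_mult[symmetric] mult.assoc[symmetric])

lemma cis_mem_open_sector: "t \<in> J \<Longrightarrow> 0 < r \<Longrightarrow> of_real r * cis t \<in> open_sector J"
  by (auto simp: open_sector_def)

text \<open>A width below \<open>pi\<close> makes the sector an intersection of two open
  half-planes: after rotation by \<open>- \<alpha>\<close> a point at angle \<open>t\<close> has
  imaginary part proportional to \<open>sin (t - \<alpha>)\<close>. Openness, convexity and closure
  under addition are read off from this form.\<close>

lemma mem_open_sector_iff: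
  assumes "\<alpha> < \<beta>" "\<beta> - \<alpha> < pi"
  shows "z \<in> open_sector {\<alpha><..<\<beta>} \<longleftrightarrow> 0 < Im (z * cis (- \<alpha>)) \<and> Im (z * cis (- \<beta>)) < 0"
proof
  assume "z \<in> open_sector {\<alpha><..<\<beta>}"
  then obtain x t where z: "z = of_real x * cis t" "0 < x" "\<alpha> < t" "t < \<beta>"
    by (auto simp: open_sector_def)
  have "sin (t - \<alpha>) > 0" "sin (\<beta> - t) > 0"
    using z assms by (auto intro!: sin_gt_zero)
  moreover have "sin (t - \<beta>) = - sin (\<beta> - t)"
    by (metis minus_diff_eq sin_minus)
  ultimately show "0 < Im (z * cis (- \<alpha>)) \<and> Im (z * cis (- \<beta>)) < 0"
    unfolding z Im_of_real_cis_mult using z(2) by simp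
next
  assume R: "0 < Im (z * cis (- \<alpha>)) \<and> Im (z * cis (- \<beta>)) < 0"
  define p where "p = Arg (z * cis (- \<alpha>))"
  have z0: "z \<noteq> 0" using R by auto
  have p: "0 < p" "p < pi"
    using R Arg_lt_pi unfolding p_def by blast+
  have "z * cis (- \<alpha>) = of_real (cmod z) * cis p"
    using polar_cis[of "z * cis (- \<alpha>)"] by (simp add: p_def norm_mult)
  then have z: "z = of_real (cmod z) * cis (\<alpha> + p)"
    by (metis (no_types, lifting) add.commute cis_mult cis_neq_zero cis_inverse
        divide_inverse mult.assoc nonzero_mult_div_cancel_right)
  have "Im (z * cis (- \<beta>)) = cmod z * sin (\<alpha> + p - \<beta>)"
    by (subst z) (rule Im_of_real_cis_mult)
  then have "sin (\<alpha> + p - \<beta>) < 0"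
    using R by (simp add: mult_less_0_iff)
  \<comment> \<open>Otherwise \<open>\<alpha> + p - \<beta>\<close> would lie in
    \<open>[0, pi)\<close>, where the sine is non-negative.\<close>
  then have "\<alpha> + p < \<beta>"
    using sin_ge_zero[of "\<alpha> + p - \<beta>"] p assms by (force simp: not_less)
  then show "z \<in> open_sector {\<alpha><..<\<beta>}"
    using z0 p by (subst z, intro cis_mem_open_sector) auto
qed

lemma open_sector_eq:
  assumes "\<alpha> < \<beta>" "\<beta> - \<alpha> < pi"
  shows "open_sector {\<alpha><..<\<beta>} = {z. 0 < Im (z * cis (- \<alpha>))} \<inter> {z. Im (z * cis (- \<beta>)) < 0}"
  using mem_open_sector_iff[OF assms] by blast

lemma open_open_sector:
  assumes "\<alpha> < \<beta>" "\<beta> - \<alpha> < pi"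
  shows "open (open_sector {\<alpha><..<\<beta>})"
  unfolding open_sector_eq[OF assms]
  by (intro open_Int open_Collect_less continuous_intros)

lemma convex_open_sector:
  assumes "\<alpha> < \<beta>" "\<beta> - \<alpha> < pi"
  shows "convex (open_sector {\<alpha><..<\<beta>})"
proof -
  have "convex {z. 0 < Im (z * c)}" "convex {z. Im (z * c) < 0}" for c
  proof -
    have lin: "linear (\<lambda>z. Im (z * c))"
      by (intro linearI) (auto simp: algebra_simps)
    have eq: "{z. 0 < Im (z * c)} = (\<lambda>z. Im (z * c)) -` {0<..}"
       "{z. Im (z * c) < 0} = (\<lambda>z. Im (z * c)) -` {..<0}" by auto
    show "convex {z. 0 < Im (z * c)}" "convex {z. Im (z * c) < 0}"
      unfolding eq by (intro convex_linear_vimage lin; simp)+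
  qed
  then show ?thesis
    unfolding open_sector_eq[OF assms] by (intro convex_Int)
qed

lemma open_sector_add:
  assumes "\<alpha> < \<beta>" "\<beta> - \<alpha> < pi" "x \<in> open_sector {\<alpha><..<\<beta>}" "y \<in> open_sector {\<alpha><..<\<beta>}"
  shows "x + y \<in> open_sector {\<alpha><..<\<beta>}"
  using assms(3,4) unfolding mem_open_sector_iff[OF assms(1,2)] by (simp add: algebra_simps)

lemma open_sector_mono: "J \<subseteq> J' \<Longrightarrow> open_sector J \<subseteq> open_sector J'"
  by (auto simp: open_sector_def)

lemma zero_islimpt_open_sector:
  assumes "t \<in> J"
  shows "0 islimpt open_sector J"
  unfolding islimpt_approachable
proof (intro allI impI)
  fix e :: real assume "0 < e"
  then show "\<exists>x'\<in>open_sector J. x' \<noteq> 0 \<and> dist x' 0 < e"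
    using assms by (intro bexI[of _ "of_real (e/2) * cis t"] cis_mem_open_sector) (auto simp: norm_mult)
qed

text \<open>Identity theorem for functions compared only near a point \<open>a\<close> that may lie
  on the boundary: the agreement set contains a non-empty open piece of \<open>S\<close> because
  \<open>a\<close> is a limit point. It is applied at the vertex of a sector, where germs and
  extensions are matched.\<close>

lemma eventually_eq_at_boundary_imp_eq:
  assumes "open S" "convex S" "f holomorphic_on S" "g holomorphic_on S"
    and ev: "\<forall>\<^sub>F \<zeta> in at a within S. f \<zeta> = g \<zeta>" and a: "a islimpt S" and z: "z \<in> S"
  shows "f z = g z"
proof -
  obtain d where d: "d > 0" "\<And>\<zeta>. \<zeta> \<in> S \<Longrightarrow> \<zeta> \<noteq> a \<Longrightarrow> dist \<zeta> a < d \<Longrightarrow> f \<zeta> = g \<zeta>"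
    using ev unfolding eventually_at by blast
  obtain x where x: "x \<in> S" "x \<noteq> a" "dist x a < d"
    using a d(1) unfolding islimpt_approachable by blast
  define U where "U = S \<inter> (ball a d - {a})"
  show ?thesis
    by (rule analytic_continuation_open[of U S])
       (use assms d x in \<open>auto simp: U_def convex_connected dist_commute\<close>)
qed

lemma sector_extension_unique:
  fixes \<alpha> \<beta> :: real
  assumes J: "\<alpha> < \<beta>" "\<beta> - \<alpha> < pi"
    and "sector_extension {\<alpha><..<\<beta>} \<phi> F" "sector_extension {\<alpha><..<\<beta>} \<phi> G"
    and z: "z \<in> open_sector {\<alpha><..<\<beta>}"
  shows "F z = G z"
proof (rule eventually_eq_at_boundary_imp_eq[where f = F and g = G and a = 0 and S = "open_sector {\<alpha><..<\<beta>}"])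
  show "\<forall>\<^sub>F \<zeta> in at 0 within open_sector {\<alpha><..<\<beta>}. F \<zeta> = G \<zeta>"
    using assms(3,4) unfolding sector_extension_def by (auto elim: eventually_elim2)
  show "0 islimpt open_sector {\<alpha><..<\<beta>}"
    using J by (intro zero_islimpt_open_sector[of "(\<alpha>+\<beta>)/2"]) auto
qed (use assms in \<open>auto simp: sector_extension_def open_open_sector convex_open_sector\<close>)

lemma locally_bounded_on_compact:
  assumes "locally_bounded_on J f" "compact K" "K \<subseteq> J"
  obtains B where "\<And>t. t \<in> K \<Longrightarrow> \<bar>f t\<bar> \<le> B"
proof -
  have "\<forall>t\<in>K. \<exists>U. open U \<and> t \<in> U \<and> bounded (f ` (J \<inter> U))"
    using assms unfolding locally_bounded_on_def by blast
  then obtain U where U: "\<And>t. t \<in> K \<Longrightarrow> open (U t) \<and> t \<in> U t \<and> bounded (f ` (J \<inter> U t))"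
    by metis
  obtain T where T: "T \<subseteq> K" "finite T" "K \<subseteq> (\<Union>t\<in>T. U t)"
    using compactE_image[OF assms(2), of K U] U by blast
  have "bounded (\<Union>t\<in>T. f ` (J \<inter> U t))"
    using T U by (intro bounded_UN) auto
  moreover have "f ` K \<subseteq> (\<Union>t\<in>T. f ` (J \<inter> U t))"
    using T assms(3) by blast
  ultimately have "bounded (f ` K)" by (rule bounded_subset)
  then show thesis using that unfolding bounded_iff by (metis imageI real_norm_def)
qed

lemma locally_bounded_on_subset:
  assumes "locally_bounded_on J f" "J' \<subseteq> J"
  shows "locally_bounded_on J' f"
  unfolding locally_bounded_on_def
proof
  fix t assume "t \<in> J'"
  then obtain U where "open U" "t \<in> U" "bounded (f ` (J \<inter> U))"
    using assms unfolding locally_bounded_on_def by blast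
  then show "\<exists>U. open U \<and> t \<in> U \<and> bounded (f ` (J' \<inter> U))"
    using assms(2) bounded_subset[of "f ` (J \<inter> U)" "f ` (J' \<inter> U)"] by blast
qed

section \<open>Laplace integrals along rays\<close>

lemma cone_combination:
  assumes "s \<le> s'" "s' - s < pi" "0 \<le> x" "0 \<le> y" "0 < x + y"
  obtains r u where "of_real x * cis s + of_real y * cis s' = of_real r * cis u"
    "0 < r" "r \<le> x + y" "s \<le> u" "u \<le> s'"
proof (cases "s = s' \<or> x = 0 \<or> y = 0")
  case True
  then consider "s = s'" | "x = 0" | "y = 0" by blast
  then show thesis
  proof cases
    case 1 then show thesis using that[of "x + y" s] assms by (simp add: algebra_simps)
  next
    case 2 then show thesis using that[of y s'] assms by simp
  next
    case 3 then show thesis using that[of x s] assms by simp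
  qed
next
  case False
  then have A: "s < s'" "0 < x" "0 < y" using assms by auto
  define p where "p = of_real x * cis s + of_real y * cis s'"
  have "p \<in> open_sector {s<..<s'}"
  proof -
    have pos: "0 < sin (s' - s)" using A assms by (intro sin_gt_zero) auto
    have neg: "sin (s - s') = - sin (s' - s)"
      by (metis minus_diff_eq sin_minus)
    have "Im (p * cis (- s)) = x * sin (s - s) + y * sin (s' - s)"
      "Im (p * cis (- s')) = x * sin (s - s') + y * sin (s' - s')"
      unfolding p_def distrib_right plus_complex.sel Im_of_real_cis_mult by simp_all
    then show ?thesis
      using A assms mem_open_sector_iff[of s s' p] pos neg by simp
  qed
  then obtain r u where ru: "p = of_real r * cis u" "0 < r" "s < u" "u < s'"
    unfolding open_sector_def by auto
  have "r = cmod p" using ru by (simp add: norm_mult)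
  also have "\<dots> \<le> x + y"
    unfolding p_def using norm_triangle_ineq[of "of_real x * cis s" "of_real y * cis s'"] A
    by (simp add: norm_mult)
  finally show thesis using that[of r u] ru unfolding p_def by simp
qed

lemma tendsto_exp_minus_mult:
  assumes "0 < (k::real)"
  shows "((\<lambda>x. exp (- k * x)) \<longlongrightarrow> 0) at_top"
proof -
  have "filterlim (\<lambda>x. - k * x) at_bot at_top"
    using assms filterlim_tendsto_neg_mult_at_bot[OF tendsto_const, of "- k" "\<lambda>x::real. x" at_top]
    by (simp add: filterlim_ident)
  then show ?thesis
    by (rule filterlim_compose[OF exp_at_bot])
qed

lemma set_integrable_exp_minus:
  assumes "0 < (k::real)"
  shows "set_integrable lborel {0<..} (\<lambda>x. exp (- k * x))"
    and "(LBINT x:{0<..}. exp (- k * x)) = 1 / k"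
proof -
  have lim: "(((\<lambda>x. - exp (- k * x) / k) \<circ> real_of_ereal) \<longlongrightarrow> - 1 / k) (at_right 0)"
    unfolding zero_ereal_def ereal_tendsto_simps
    by (rule tendsto_eq_intros | use assms in simp)+
  have lim': "(((\<lambda>x. - exp (- k * x) / k) \<circ> real_of_ereal) \<longlongrightarrow> 0) (at_left \<infinity>)"
    unfolding ereal_tendsto_simps
  proof -
    from tendsto_divide[OF tendsto_minus[OF tendsto_exp_minus_mult[OF assms]] tendsto_const, of k] assms
    show "((\<lambda>x. - exp (- k * x) / k) \<longlongrightarrow> 0) at_top" by simp
  qed
  have d: "DERIV (\<lambda>x. - exp (- k * x) / k) x :> exp (- k * x)" for x
    using assms by (auto intro!: derivative_eq_intros simp: field_simps)
  have "set_integrable lborel (einterval 0 \<infinity>) (\<lambda>x. exp (- k * x))"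
    "(LBINT x=0..\<infinity>. exp (- k * x)) = 0 - (- 1 / k)"
    by (rule interval_integral_FTC_nonneg[OF _ d _ _ lim lim']; simp)+
  then show "set_integrable lborel {0<..} (\<lambda>x. exp (- k * x))"
    "(LBINT x:{0<..}. exp (- k * x)) = 1 / k"
    unfolding interval_lebesgue_integral_0_infty by (simp_all add: zero_ereal_def)
qed

text \<open>One direction and one explicit extension, without the constant term;
  \<open>laplace_eq\<close> relates it to \<open>laplace\<close>, which hides both choices.\<close>

definition ray_laplace :: "(complex \<Rightarrow> complex) \<Rightarrow> real \<Rightarrow> complex \<Rightarrow> complex" where
  "ray_laplace F t z =
     (LBINT \<xi>:{0<..}. exp (- (z * of_real \<xi> * cis t)) * F (of_real \<xi> * cis t) * cis t)"

text \<open>The data whose existence membership in \<open>exp_growth_germs\<close> asserts, with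
  extension and bound named. It is used for \<open>\<Phi>\<close> on the right of the ray and for
  the truncated Stokes image on the left.\<close>

locale sector_function =
  fixes \<alpha> \<beta> :: real and \<gamma> A :: "real \<Rightarrow> real" and \<phi> :: "complex fps" and F :: "complex \<Rightarrow> complex"
  assumes less: "\<alpha> < \<beta>" and width: "\<beta> - \<alpha> < pi"
    and radius: "0 < fps_conv_radius \<phi>"
    and ext: "sector_extension {\<alpha><..<\<beta>} \<phi> F"
    and A: "locally_bounded_on {\<alpha><..<\<beta>} A" "\<And>t. t \<in> {\<alpha><..<\<beta>} \<Longrightarrow> 0 \<le> A t"
    and \<gamma>: "locally_bounded_on {\<alpha><..<\<beta>} \<gamma>"
    and growth: "\<And>t \<xi>. t \<in> {\<alpha><..<\<beta>} \<Longrightarrow> 0 < \<xi> \<Longrightarrow>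
      cmod (F (of_real \<xi> * cis t)) \<le> A t * exp (\<gamma> t * \<xi>)"
begin

abbreviation "J \<equiv> {\<alpha><..<\<beta>}"
abbreviation "S \<equiv> open_sector J"

lemma open_S: "open S" and convex_S: "convex S"
  using open_open_sector convex_open_sector less width by auto

lemma holomorphic_F: "F holomorphic_on S"
  using ext by (simp add: sector_extension_def)

lemma isCont_F: "\<zeta> \<in> S \<Longrightarrow> isCont F \<zeta>"
  using holomorphic_F open_S continuous_on_eq_continuous_at holomorphic_on_imp_continuous_on by blast

lemma integrand_bound:
  assumes "t \<in> J" "0 < \<xi>"
  shows "cmod (exp (- (z * of_real \<xi> * cis t)) * F (of_real \<xi> * cis t) * cis t)
      \<le> A t * exp (- (Re (z * cis t) - \<gamma> t) * \<xi>)"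
proof -
  have "cmod (exp (- (z * of_real \<xi> * cis t))) = exp (- (Re (z * cis t) * \<xi>))"
    by (simp add: algebra_simps)
  then have "cmod (exp (- (z * of_real \<xi> * cis t)) * F (of_real \<xi> * cis t) * cis t)
      \<le> exp (- (Re (z * cis t) * \<xi>)) * (A t * exp (\<gamma> t * \<xi>))"
    unfolding norm_mult using growth[OF assms] by (simp add: mult_left_mono)
  also have "\<dots> = A t * exp (- (Re (z * cis t) - \<gamma> t) * \<xi>)"
    by (simp add: exp_add[symmetric] algebra_simps)
  finally show ?thesis .
qed

lemma integrand_isCont:
  assumes "t \<in> J" "0 < \<xi>"
  shows "isCont (\<lambda>\<xi>. exp (- (z * of_real \<xi> * cis t)) * F (of_real \<xi> * cis t) * cis t) \<xi>"
proof -
  have "isCont (\<lambda>\<xi>. F (of_real \<xi> * cis t)) \<xi>"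
    by (rule isCont_o2[where g = F])
      (intro isCont_F cis_mem_open_sector assms continuous_intros)+
  then show ?thesis
    by (intro continuous_intros)
qed

lemma integrand_integrable:
  assumes "t \<in> J" "\<gamma> t < Re (z * cis t)"
  shows "set_integrable lborel {0<..}
    (\<lambda>\<xi>. exp (- (z * of_real \<xi> * cis t)) * F (of_real \<xi> * cis t) * cis t)"
proof (rule set_integrable_bound)
  show "set_integrable lborel {0<..} (\<lambda>\<xi>. A t * exp (- (Re (z * cis t) - \<gamma> t) * \<xi>))"
    using set_integrable_exp_minus(1)[of "Re (z * cis t) - \<gamma> t"] assms(2) by simp
  have "continuous_on {0<..} (\<lambda>\<xi>. exp (- (z * of_real \<xi> * cis t)) * F (of_real \<xi> * cis t) * cis t)"
    using integrand_isCont[OF assms(1)] by (intro continuous_at_imp_continuous_on) auto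
  then show "set_borel_measurable lborel {0<..}
      (\<lambda>\<xi>. exp (- (z * of_real \<xi> * cis t)) * F (of_real \<xi> * cis t) * cis t)"
    by (simp add: set_borel_measurable_def borel_measurable_continuous_on_indicator)
  show "AE \<xi> in lborel. \<xi> \<in> {0<..} \<longrightarrow>
      cmod (exp (- (z * of_real \<xi> * cis t)) * F (of_real \<xi> * cis t) * cis t)
      \<le> norm (A t * exp (- (Re (z * cis t) - \<gamma> t) * \<xi>))"
    using integrand_bound[OF assms(1)] A(2)[OF assms(1)] by (auto simp: abs_mult)
qed

lemma ray_laplace_bound:
  assumes "t \<in> J" "\<gamma> t < Re (z * cis t)"
  shows "cmod (ray_laplace F t z) \<le> A t / (Re (z * cis t) - \<gamma> t)"
proof -
  have "cmod (ray_laplace F t z) \<le>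
      (LBINT \<xi>:{0<..}. cmod (exp (- (z * of_real \<xi> * cis t)) * F (of_real \<xi> * cis t) * cis t))"
    unfolding ray_laplace_def by (rule set_integral_norm_bound[OF integrand_integrable[OF assms]])
  also have "\<dots> \<le> (LBINT \<xi>:{0<..}. A t * exp (- (Re (z * cis t) - \<gamma> t) * \<xi>))"
  proof (rule set_integral_mono)
    show "set_integrable lborel {0<..} (\<lambda>\<xi>. A t * exp (- (Re (z * cis t) - \<gamma> t) * \<xi>))"
      using set_integrable_exp_minus(1)[of "Re (z * cis t) - \<gamma> t"] assms(2) by simp
  qed (use set_integrable_norm[OF integrand_integrable[OF assms]] integrand_bound[OF assms(1)] in auto)
  also have "\<dots> = A t / (Re (z * cis t) - \<gamma> t)"
    using set_integrable_exp_minus(2)[of "Re (z * cis t) - \<gamma> t"] assms(2) by simp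
  finally show ?thesis .
qed

text \<open>On a compact range of directions local boundedness gives one exponential bound for
  \<open>F\<close>. Both constants are made non-negative, so that the modulus in the exponent may be
  enlarged freely.\<close>

lemma sector_bound:
  assumes "lo \<in> J" "hi \<in> J"
  obtains C K where "0 \<le> C" "0 \<le> K"
    "\<And>s \<xi>. lo \<le> s \<Longrightarrow> s \<le> hi \<Longrightarrow> 0 < \<xi> \<Longrightarrow> cmod (F (of_real \<xi> * cis s)) \<le> C * exp (K * \<xi>)"
    "\<And>s. lo \<le> s \<Longrightarrow> s \<le> hi \<Longrightarrow> \<gamma> s \<le> K"
proof -
  have sub: "{lo..hi} \<subseteq> J" using assms by auto
  obtain C where C: "\<And>t. t \<in> {lo..hi} \<Longrightarrow> \<bar>A t\<bar> \<le> C"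
    using locally_bounded_on_compact[OF A(1) compact_Icc sub] by blast
  obtain K where K: "\<And>t. t \<in> {lo..hi} \<Longrightarrow> \<bar>\<gamma> t\<bar> \<le> K"
    using locally_bounded_on_compact[OF \<gamma> compact_Icc sub] by blast
  show thesis
  proof (rule that[of "\<bar>C\<bar>" "\<bar>K\<bar>"])
    fix s \<xi> :: real assume s: "lo \<le> s" "s \<le> hi" "0 < \<xi>"
    then have "A t * exp (\<gamma> t * \<xi>) \<le> \<bar>C\<bar> * exp (\<bar>K\<bar> * \<xi>)" if "t = s" for t
      using that C[of t] K[of t] A(2)[of t] sub by (intro mult_mono) (auto simp: mult_right_mono)
    then show "cmod (F (of_real \<xi> * cis s)) \<le> \<bar>C\<bar> * exp (\<bar>K\<bar> * \<xi>)"
      using growth[of s \<xi>] s sub by force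
  next
    fix s assume "lo \<le> s" "s \<le> hi"
    then show "\<gamma> s \<le> \<bar>K\<bar>" using K[of s] by force
  qed auto
qed

text \<open>The normalisation at the vertex makes the limit of \<open>P\<close> at infinity along an
  admissible ray equal to the Laplace integral itself. Contour arguments thereby become comparisons
  of values of \<open>P\<close>.\<close>

definition is_primitive :: "complex \<Rightarrow> (complex \<Rightarrow> complex) \<Rightarrow> bool" where
  "is_primitive z P \<longleftrightarrow> (\<forall>\<zeta>\<in>S. (P has_field_derivative F \<zeta> * exp (- (z * \<zeta>))) (at \<zeta>)) \<and>
      (P \<longlongrightarrow> 0) (at 0 within S)"

lemma tendsto_ray_at_right_0:
  assumes "t \<in> J"
  shows "filterlim (\<lambda>\<xi>. of_real \<xi> * cis t) (at 0 within S) (at_right 0)"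
  unfolding filterlim_at
proof
  have "((\<lambda>\<xi>::real. of_real \<xi> * cis t) \<longlongrightarrow> of_real 0 * cis t) (at_right 0)"
    by (intro tendsto_intros)
  then show "((\<lambda>\<xi>. of_real \<xi> * cis t) \<longlongrightarrow> 0) (at_right 0)" by simp
  show "\<forall>\<^sub>F \<xi> in at_right 0. of_real \<xi> * cis t \<in> S \<and> of_real \<xi> * cis t \<noteq> 0"
    unfolding eventually_at_right_field
    by (intro exI[of _ 1]) (use assms cis_mem_open_sector in auto)
qed

lemma primitive_tendsto_ray_laplace:
  assumes "t \<in> J" "\<gamma> t < Re (z * cis t)" and P: "is_primitive z P"
  shows "((\<lambda>\<xi>. P (of_real \<xi> * cis t)) \<longlongrightarrow> ray_laplace F t z) at_top"
proof -
  define f where "f \<xi> = exp (- (z * of_real \<xi> * cis t)) * F (of_real \<xi> * cis t) * cis t" for \<xi> :: real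
  define Q where "Q \<xi> = P (of_real \<xi> * cis t)" for \<xi> :: real
  have dQ: "(Q has_vector_derivative f \<xi>) (at \<xi>)" if "0 < \<xi>" for \<xi>
  proof -
    have "(P has_field_derivative F (of_real \<xi> * cis t) * exp (- (z * (of_real \<xi> * cis t)))) (at (of_real \<xi> * cis t))"
      using P cis_mem_open_sector[OF assms(1) that] unfolding is_primitive_def by blast
    moreover have "((\<lambda>\<xi>. of_real \<xi> * cis t) has_vector_derivative cis t) (at \<xi>)"
      by (auto intro!: derivative_eq_intros)
    ultimately have "((P \<circ> (\<lambda>\<xi>. of_real \<xi> * cis t)) has_vector_derivative
        cis t * (F (of_real \<xi> * cis t) * exp (- (z * (of_real \<xi> * cis t))))) (at \<xi>)"
      by (rule field_vector_diff_chain_at[rotated])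
    then show ?thesis unfolding Q_def f_def comp_def by (simp add: mult_ac)
  qed
  have Q0: "(Q \<longlongrightarrow> 0) (at_right 0)"
  proof -
    have "(P \<longlongrightarrow> 0) (at 0 within S)" by (rule conjunct2[OF P[unfolded is_primitive_def]])
    then show ?thesis
      unfolding Q_def by (rule filterlim_compose) (rule tendsto_ray_at_right_0[OF assms(1)])
  qed
  have int: "set_integrable lborel {0<..} f"
    unfolding f_def by (rule integrand_integrable[OF assms(1,2)])
  have FTC: "Q y - Q x = (LBINT \<xi>:{x..y}. f \<xi>)" if "0 < x" "x \<le> y" for x y
  proof -
    have "(LBINT \<xi>=ereal x..ereal y. f \<xi>) = Q y - Q x"
    proof (rule interval_integral_FTC_finite)
      have pos: "0 < \<xi>" if "min x y \<le> \<xi>" for \<xi>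
        using that \<open>0 < x\<close> \<open>x \<le> y\<close> by linarith
      show "continuous_on {min x y..max x y} f"
        unfolding f_def
        by (rule continuous_at_imp_continuous_on, rule ballI, rule integrand_isCont[OF assms(1)], rule pos)
          (simp only: atLeastAtMost_iff)
      show "(Q has_vector_derivative f \<xi>) (at \<xi> within {min x y..max x y})"
        if "min x y \<le> \<xi>" "\<xi> \<le> max x y" for \<xi>
        by (rule has_vector_derivative_at_within, rule dQ, rule pos, rule that)
    qed
    then show ?thesis unfolding interval_integral_Icc[OF \<open>x \<le> y\<close>] by (rule sym)
  qed
  have lim1: "((\<lambda>y. LBINT \<xi>:{x..y}. f \<xi>) \<longlongrightarrow> (LBINT \<xi>:{x..}. f \<xi>)) at_top" if "0 < x" for x
  proof (rule tendsto_set_lebesgue_integral_at_top)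
    show "set_integrable lborel {x..} f"
      by (rule set_integrable_subset[OF int]) (use that in auto)
  qed simp
  have Qlim: "(Q \<longlongrightarrow> Q x + (LBINT \<xi>:{x..}. f \<xi>)) at_top" if "0 < x" for x
  proof (rule Lim_transform_eventually)
    show "((\<lambda>y. Q x + (LBINT \<xi>:{x..y}. f \<xi>)) \<longlongrightarrow> Q x + (LBINT \<xi>:{x..}. f \<xi>)) at_top"
      by (rule tendsto_add[OF tendsto_const lim1[OF that]])
    show "\<forall>\<^sub>F y in at_top. Q x + (LBINT \<xi>:{x..y}. f \<xi>) = Q y"
      using eventually_ge_at_top[of x]
    proof eventually_elim
      case (elim y)
      show ?case unfolding FTC[OF that elim, symmetric] by simp
    qed
  qed
  \<comment> \<open>The fundamental theorem on the whole half-line presupposes a limit at infinity;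
    integrability of \<open>f\<close> provides it as \<open>Q 1\<close> plus the integral beyond
    1.\<close>
  define l where "l = Q 1 + (LBINT \<xi>:{1..}. f \<xi>)"
  have l: "(Q \<longlongrightarrow> l) at_top" unfolding l_def by (rule Qlim) simp
  have "(LBINT \<xi>=0..\<infinity>. f \<xi>) = l - 0"
  proof (rule interval_integral_FTC_integrable)
    show "((Q \<circ> real_of_ereal) \<longlongrightarrow> 0) (at_right 0)"
      unfolding zero_ereal_def ereal_tendsto_simps using Q0 .
    show "((Q \<circ> real_of_ereal) \<longlongrightarrow> l) (at_left \<infinity>)"
      unfolding ereal_tendsto_simps using l .
    show "set_integrable lborel (einterval 0 \<infinity>) f"
      using int by (simp add: zero_ereal_def)
    show "isCont f \<xi>" if "0 < ereal \<xi>" for \<xi>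
      unfolding f_def by (rule integrand_isCont[OF assms(1)]) (use that in simp)
    show "(Q has_vector_derivative f \<xi>) (at \<xi>)" if "0 < ereal \<xi>" for \<xi>
      by (rule dQ) (use that in simp)
  qed simp
  then have "ray_laplace F t z = l"
    unfolding interval_lebesgue_integral_0_infty ray_laplace_def f_def by (simp only: diff_zero)
  then show ?thesis using l unfolding Q_def by simp
qed

end

section \<open>Existence of primitives, and the tail of a Laplace integral\<close>

lemma holomorphic_on_eval_fps_ball:
  assumes "ereal r \<le> fps_conv_radius \<phi>"
  shows "eval_fps \<phi> holomorphic_on ball 0 r"
  using ball_eball_mono[OF assms, of 0] by (rule holomorphic_on_eval_fps)

lemma holomorphic_convex_primitive_at:
  fixes f :: "complex \<Rightarrow> complex"
  assumes "convex S" "open S" "f holomorphic_on S"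
  obtains g where "\<And>x. x \<in> S \<Longrightarrow> (g has_field_derivative f x) (at x)"
proof -
  obtain g where g: "\<And>x. x \<in> S \<Longrightarrow> (g has_field_derivative f x) (at x within S)"
    using holomorphic_convex_primitive'[OF assms] by blast
  show thesis
  proof (rule that)
    fix x assume "x \<in> S"
    then show "(g has_field_derivative f x) (at x)"
      using g[of x] by (simp only: at_within_open[OF _ assms(2)])
  qed
qed

context sector_function
begin

text \<open>Convexity of the sector gives some primitive. It has a limit at the vertex because near
  0 it differs by a constant from a primitive of the germ times the exponential, which is
  holomorphic across 0.\<close>

lemma ex_primitive: "\<exists>P. is_primitive z P"
proof -
  have "\<forall>\<^sub>F \<zeta> in at 0 within S. F \<zeta> = eval_fps \<phi> \<zeta>"
    using ext by (simp add: sector_extension_def)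
  then obtain d where d: "0 < d" "\<And>\<zeta>. \<zeta> \<in> S \<Longrightarrow> \<zeta> \<noteq> 0 \<Longrightarrow> dist \<zeta> 0 < d \<Longrightarrow> F \<zeta> = eval_fps \<phi> \<zeta>"
    unfolding eventually_at by blast
  obtain r where r: "0 < r" "ereal r < fps_conv_radius \<phi>"
    using radius ereal_dense2[of 0 "fps_conv_radius \<phi>"] by (auto simp: zero_ereal_def)
  define e where "e = min d r"
  have e: "0 < e" using d r by (simp add: e_def)
  have S0: "0 \<notin> S" by (auto simp: open_sector_def)
  have "(\<lambda>\<zeta>. F \<zeta> * exp (- (z * \<zeta>))) holomorphic_on S"
    by (intro holomorphic_intros holomorphic_F)
  then obtain G where G: "\<And>\<zeta>. \<zeta> \<in> S \<Longrightarrow> (G has_field_derivative F \<zeta> * exp (- (z * \<zeta>))) (at \<zeta>)"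
    using holomorphic_convex_primitive_at[OF convex_S open_S] by blast
  have "(\<lambda>\<zeta>. eval_fps \<phi> \<zeta> * exp (- (z * \<zeta>))) holomorphic_on ball 0 r"
    by (intro holomorphic_intros holomorphic_on_eval_fps_ball less_imp_le[OF r(2)])
  then obtain Q where Q: "\<And>\<zeta>. \<zeta> \<in> ball 0 r \<Longrightarrow> (Q has_field_derivative eval_fps \<phi> \<zeta> * exp (- (z * \<zeta>))) (at \<zeta>)"
    using holomorphic_convex_primitive_at[OF convex_ball open_ball] by blast
  have "convex (S \<inter> ball 0 e)" by (intro convex_Int convex_S convex_ball)
  moreover have "((\<lambda>\<zeta>. G \<zeta> - Q \<zeta>) has_field_derivative 0) (at \<zeta> within S \<inter> ball 0 e)"
    if "\<zeta> \<in> S \<inter> ball 0 e" for \<zeta>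
  proof -
    have "F \<zeta> = eval_fps \<phi> \<zeta>" using that S0 d(2)[of \<zeta>] by (auto simp: e_def)
    then have "((\<lambda>\<zeta>. G \<zeta> - Q \<zeta>) has_field_derivative 0) (at \<zeta>)"
      using DERIV_diff[OF G[of \<zeta>] Q[of \<zeta>]] that by (simp add: e_def)
    then show ?thesis by (rule has_field_derivative_at_within)
  qed
  ultimately obtain c where c: "\<And>\<zeta>. \<zeta> \<in> S \<inter> ball 0 e \<Longrightarrow> G \<zeta> - Q \<zeta> = c"
    using has_field_derivative_zero_constant[of "S \<inter> ball 0 e" "\<lambda>\<zeta>. G \<zeta> - Q \<zeta>"] by blast
  define P where "P \<zeta> = G \<zeta> - c - Q 0" for \<zeta>
  have "(P has_field_derivative F \<zeta> * exp (- (z * \<zeta>))) (at \<zeta>)" if "\<zeta> \<in> S" for \<zeta>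
    unfolding P_def by (rule derivative_eq_intros G that | simp)+
  moreover have "(P \<longlongrightarrow> 0) (at 0 within S)"
  proof -
    have "isCont Q 0" using Q[of 0] r(1) DERIV_isCont by force
    then have "(Q \<longlongrightarrow> Q 0) (at 0 within S)"
      by (metis isCont_def tendsto_within_subset subset_UNIV)
    then have "((\<lambda>\<zeta>. Q \<zeta> - Q 0) \<longlongrightarrow> 0) (at 0 within S)"
      by (simp add: LIM_zero)
    moreover have "\<forall>\<^sub>F \<zeta> in at 0 within S. Q \<zeta> - Q 0 = P \<zeta>"
      unfolding eventually_at P_def using c e by (intro exI[of _ e]) force
    ultimately show ?thesis using Lim_transform_eventually by blast
  qed
  ultimately show ?thesis unfolding is_primitive_def by blast
qed

text \<open>The ray from the vertex is replaced by the parallel ray starting at \<open>q\<close>: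
  the segment joining the two at height \<open>y\<close> contributes nothing in the limit, so the
  integral minus \<open>P q\<close> is the increment of \<open>P\<close> along the shifted ray.
  \<open>C\<close> and \<open>K\<close> are fixed before \<open>z\<close> and
  \<open>P\<close>.\<close>

lemma ray_laplace_tail:
  assumes "q \<in> S" "t \<in> J"
  obtains C K where "0 \<le> C" "\<gamma> t < K" "\<And>z P. is_primitive z P \<Longrightarrow> K \<le> Re (z * cis t) \<Longrightarrow>
    cmod (ray_laplace F t z - P q) \<le> C * exp (- Re (z * q))"
proof -
  obtain r s where q: "q = of_real r * cis s" "0 < r" "s \<in> J"
    using assms(1) by (auto simp: open_sector_def)
  define lo hi where "lo = min s t" and "hi = max s t"
  have lohi: "lo \<in> J" "hi \<in> J" "lo \<le> s" "s \<le> hi" "lo \<le> t" "t \<le> hi" "hi - lo < pi"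
    using q assms less width by (auto simp: lo_def hi_def min_def max_def)
  obtain C K where CK: "0 \<le> C" "0 \<le> K"
    "\<And>s \<xi>. lo \<le> s \<Longrightarrow> s \<le> hi \<Longrightarrow> 0 < \<xi> \<Longrightarrow> cmod (F (of_real \<xi> * cis s)) \<le> C * exp (K * \<xi>)"
    "\<And>s. lo \<le> s \<Longrightarrow> s \<le> hi \<Longrightarrow> \<gamma> s \<le> K"
    using sector_bound[OF lohi(1,2)] by blast
  \<comment> \<open>The strip between the two parallel rays lies in the closed cone spanned by the
    directions \<open>s\<close> and \<open>t\<close>, at modulus at most
    \<open>r + y\<close>.\<close>
  have pt: "x * q + of_real y * cis t \<in> S \<and>
      cmod (F (of_real x * q + of_real y * cis t)) \<le> C * exp (K * (r + y))"
    if xy: "0 \<le> x" "x \<le> 1" "0 \<le> y" "0 < x + y" for x y :: real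
  proof -
    have pos: "0 < x * r + y"
    proof (cases "y = 0")
      case True then show ?thesis using xy q(2) by simp
    next
      case False then show ?thesis using xy q(2) by (simp add: add_nonneg_pos)
    qed
    have "\<exists>p u. of_real x * q + of_real y * cis t = of_real p * cis u \<and> 0 < p \<and> p \<le> x * r + y \<and> lo \<le> u \<and> u \<le> hi"
    proof (cases "s \<le> t")
      case True
      then show ?thesis
        using cone_combination[of s t "x * r" y] xy pos lohi q(2)
        by (simp add: q(1) lo_def hi_def mult.assoc) metis
    next
      case False
      then show ?thesis
        using cone_combination[of t s y "x * r"] xy pos lohi q(2)
        by (simp add: q(1) lo_def hi_def mult.assoc add.commute) metis
    qed
    then obtain p u where pu: "of_real x * q + of_real y * cis t = of_real p * cis u"
        "0 < p" "p \<le> x * r + y" "lo \<le> u" "u \<le> hi" by blast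
    have "x * r \<le> r" using xy q(2) by (simp add: mult_left_le_one_le)
    then have "C * exp (K * p) \<le> C * exp (K * (r + y))"
      using CK pu by (intro mult_left_mono) (auto intro!: mult_left_mono)
    moreover have "u \<in> J" using pu lohi by auto
    ultimately show ?thesis
      unfolding pu(1) using CK(3)[of u p] pu cis_mem_open_sector[of u J p] by auto
  qed
  \<comment> \<open>The extra 1 in \<open>K + 1\<close> leaves a decay \<open>exp (- y)\<close>
    after the growth \<open>exp (K * y)\<close> of \<open>F\<close> has been compensated.\<close>
  show thesis
  proof (rule that[of "C * exp (K * r)" "K + 1"])
    show "0 \<le> C * exp (K * r)" "\<gamma> t < K + 1" using CK(1) CK(4)[OF lohi(5,6)] by simp_all
    fix z P assume P: "is_primitive z P" and z: "K + 1 \<le> Re (z * cis t)"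
    define B where "B = C * exp (K * r) * exp (- Re (z * q))"
    have dP: "(P has_field_derivative F \<zeta> * exp (- (z * \<zeta>))) (at \<zeta>)" if "\<zeta> \<in> S" for \<zeta>
      using P that by (simp add: is_primitive_def)
    have bd: "cmod (F (q + of_real y * cis t) * exp (- (z * (q + of_real y * cis t)))) \<le> B * exp (- y)"
      if "0 \<le> y" for y
    proof -
      have "cmod (exp (- (z * (q + of_real y * cis t)))) = exp (- Re (z * q)) * exp (- (Re (z * cis t) * y))"
        by (simp add: algebra_simps exp_add[symmetric])
      also have "\<dots> \<le> exp (- Re (z * q)) * exp (- ((K + 1) * y))"
        using z that by (simp add: mult_right_mono)
      finally have "cmod (F (q + of_real y * cis t)) * cmod (exp (- (z * (q + of_real y * cis t))))
         \<le> (C * exp (K * (r + y))) * (exp (- Re (z * q)) * exp (- ((K + 1) * y)))"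
        using pt[of 1 y] that CK(1) by (intro mult_mono) auto
      also have "\<dots> = B * (exp (K * y) * exp (- ((K + 1) * y)))"
        unfolding B_def by (simp add: distrib_left exp_add)
      also have "\<dots> = B * exp (- y)"
        by (simp add: exp_add[symmetric] algebra_simps)
      finally show ?thesis by (simp add: norm_mult)
    qed
    have dray: "((\<lambda>y. P (q + of_real y * cis t)) has_vector_derivative
          cis t * (F (q + of_real y * cis t) * exp (- (z * (q + of_real y * cis t))))) (at y)"
      if "0 \<le> y" for y
    proof -
      have "q + of_real y * cis t \<in> S" using pt[of 1 y] that by simp
      moreover have "((\<lambda>y. q + of_real y * cis t) has_vector_derivative cis t) (at y)"
        by (auto intro!: derivative_eq_intros)
      ultimately show ?thesis
        using field_vector_diff_chain_at[OF _ dP, unfolded comp_def] by blast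
    qed
    \<comment> \<open>The derivative is compared with that of \<open>- B * exp (- y)\<close>, whose
      increase over the half-line is at most \<open>B\<close>.\<close>
    have step: "cmod (P (q + of_real y * cis t) - P q) \<le> B" if "0 < y" for y
    proof -
      have "cmod ((\<lambda>y. P (q + of_real y * cis t)) y - (\<lambda>y. P (q + of_real y * cis t)) 0)
          \<le> (\<lambda>y. - B * exp (- y)) y - (\<lambda>y. - B * exp (- y)) 0"
      proof (rule differentiable_bound_general[OF that])
        show "continuous_on {0..y} (\<lambda>y. P (q + of_real y * cis t))"
          by (intro continuous_at_imp_continuous_on ballI has_vector_derivative_continuous[OF dray]) simp
        show "continuous_on {0..y} (\<lambda>y. - B * exp (- y))" by (intro continuous_intros)
        fix y' assume y': "0 < y'" "y' < y"
        show "((\<lambda>y. - B * exp (- y)) has_vector_derivative B * exp (- y')) (at y')"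
          by (auto intro!: derivative_eq_intros simp: has_real_derivative_iff_has_vector_derivative[symmetric])
        show "((\<lambda>y. P (q + of_real y * cis t)) has_vector_derivative
          cis t * (F (q + of_real y' * cis t) * exp (- (z * (q + of_real y' * cis t))))) (at y')"
          by (rule dray) (use y' in simp)
        show "cmod (cis t * (F (q + of_real y' * cis t) * exp (- (z * (q + of_real y' * cis t))))) \<le> B * exp (- y')"
          using bd[of y'] y' by (simp add: norm_mult)
      qed
      also have "\<dots> \<le> B" using CK(1) by (simp add: B_def)
      finally show ?thesis by simp
    qed
    \<comment> \<open>\<open>D\<close> depends on \<open>z\<close>, which is harmless since the
      joining segment only has to vanish as \<open>y\<close> grows. The sign of
      \<open>Re (z * q)\<close> is unknown, hence the maximum with 1.\<close>
    define D where "D = C * exp (K * r) * max 1 (exp (- Re (z * q))) * r"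
    have side: "cmod (P (q + of_real y * cis t) - P (of_real y * cis t)) \<le> D * exp (- y)" if "0 < y" for y
    proof -
      define T where "T = closed_segment (of_real y * cis t) (q + of_real y * cis t)"
      have T: "\<exists>x\<in>{0..1}. \<zeta> = of_real x * q + of_real y * cis t" if "\<zeta> \<in> T" for \<zeta>
        using that unfolding T_def closed_segment_def
        by (auto simp: algebra_simps scaleR_conv_of_real)
      have "cmod (P (q + of_real y * cis t) - P (of_real y * cis t))
          \<le> (C * exp (K * r) * max 1 (exp (- Re (z * q))) * exp (- y)) *
             cmod ((q + of_real y * cis t) - (of_real y * cis t))"
      proof (rule field_differentiable_bound[of T])
        fix \<zeta> assume "\<zeta> \<in> T"
        then obtain x where x: "0 \<le> x" "x \<le> 1" "\<zeta> = of_real x * q + of_real y * cis t"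
          using T by force
        show "(P has_field_derivative F \<zeta> * exp (- (z * \<zeta>))) (at \<zeta> within T)"
          by (rule has_field_derivative_at_within, rule dP) (use pt[of x y] x \<open>0 < y\<close> in simp)
        have "cmod (exp (- (z * \<zeta>))) = exp (- (x * Re (z * q))) * exp (- (Re (z * cis t) * y))"
          unfolding x by (simp add: algebra_simps exp_add[symmetric])
        also have "\<dots> \<le> max 1 (exp (- Re (z * q))) * exp (- ((K + 1) * y))"
        proof (rule mult_mono)
          show "exp (- (x * Re (z * q))) \<le> max 1 (exp (- Re (z * q)))"
          proof (cases "0 \<le> Re (z * q)")
            case True
            then show ?thesis using x by (simp add: le_max_iff_disj del: times_complex.sel)
          next
            case False
            then have "- (x * Re (z * q)) \<le> - Re (z * q)"
              using x mult_left_le_one_le[of "- Re (z * q)" x] by (simp del: times_complex.sel)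
            then show ?thesis by (simp add: le_max_iff_disj del: times_complex.sel)
          qed
        qed (use z \<open>0 < y\<close> in \<open>auto simp: mult_right_mono simp del: times_complex.sel\<close>)
        finally have "cmod (F \<zeta>) * cmod (exp (- (z * \<zeta>))) \<le>
            (C * exp (K * (r + y))) * (max 1 (exp (- Re (z * q))) * exp (- ((K + 1) * y)))"
          using pt[of x y] x \<open>0 < y\<close> CK(1) by (intro mult_mono) auto
        also have "\<dots> = C * exp (K * r) * max 1 (exp (- Re (z * q))) * (exp (K * y) * exp (- ((K + 1) * y)))"
          by (simp add: distrib_left exp_add mult_ac del: times_complex.sel)
        also have "exp (K * y) * exp (- ((K + 1) * y)) = exp (- y)"
          by (simp add: exp_add[symmetric] algebra_simps)
        finally show "cmod (F \<zeta> * exp (- (z * \<zeta>))) \<le> C * exp (K * r) * max 1 (exp (- Re (z * q))) * exp (- y)"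
          by (simp add: norm_mult del: times_complex.sel)
      qed (auto simp: T_def)
      also have "\<dots> = D * exp (- y)"
        using q(2) by (simp add: D_def q(1) norm_mult)
      finally show ?thesis .
    qed
    have Dlim: "((\<lambda>y. D * exp (- y)) \<longlongrightarrow> D * 0) at_top"
      using tendsto_exp_minus_mult[of 1] by (intro tendsto_intros) simp
    have "((\<lambda>y. P (q + of_real y * cis t) - P (of_real y * cis t)) \<longlongrightarrow> 0) at_top"
    proof (rule Lim_null_comparison[rotated])
      show "((\<lambda>y. D * exp (- y)) \<longlongrightarrow> 0) at_top"
        using Dlim by simp
      show "\<forall>\<^sub>F y in at_top. cmod (P (q + of_real y * cis t) - P (of_real y * cis t)) \<le> D * exp (- y)"
        using eventually_gt_at_top[of 0] by eventually_elim (rule side)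
    qed
    moreover have "((\<lambda>y. P (of_real y * cis t)) \<longlongrightarrow> ray_laplace F t z) at_top"
      using primitive_tendsto_ray_laplace[OF assms(2) _ P] z CK(4)[OF lohi(5,6)] by simp
    ultimately have "((\<lambda>y. (P (q + of_real y * cis t) - P (of_real y * cis t)) + P (of_real y * cis t))
         \<longlongrightarrow> 0 + ray_laplace F t z) at_top"
      by (rule tendsto_add)
    then have lim: "((\<lambda>y. P (q + of_real y * cis t)) \<longlongrightarrow> ray_laplace F t z) at_top"
      by simp
    have "((\<lambda>y. P (q + of_real y * cis t) - P q) \<longlongrightarrow> ray_laplace F t z - P q) at_top"
      by (rule tendsto_diff[OF lim tendsto_const])
    then show "cmod (ray_laplace F t z - P q) \<le> C * exp (K * r) * exp (- Re (z * q))"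
      unfolding B_def[symmetric]
    proof (rule Lim_norm_ubound[rotated])
      show "\<forall>\<^sub>F y in at_top. cmod (P (q + of_real y * cis t) - P q) \<le> B"
        using eventually_gt_at_top[of 0] by eventually_elim (rule step)
    qed simp
  qed
qed

end

section \<open>Independence of the Laplace integral from the direction\<close>

context sector_function
begin

text \<open>Truncations to compact intervals away from 0 are holomorphic by differentiation under
  the integral, and they converge locally uniformly. Holomorphy is needed for the identity theorem
  in \<open>z\<close>.\<close>

lemma holomorphic_ray_laplace:
  assumes t: "t \<in> J"
  shows "ray_laplace F t holomorphic_on {z. \<gamma> t < Re (z * cis t)}"
proof (rule holomorphic_uniform_sequence)
  define f where "f z \<xi> = exp (- (z * of_real \<xi> * cis t)) * F (of_real \<xi> * cis t) * cis t" for z and \<xi> :: real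
  define X where "X n = {1 / (real n + 1)..real n + 1}" for n
  show "open {z. \<gamma> t < Re (z * cis t)}"
    by (intro open_Collect_less continuous_intros)
  show "(\<lambda>z. integral (X n) (f z)) holomorphic_on {z. \<gamma> t < Re (z * cis t)}" for n
  proof -
    have pos: "0 < \<xi>" if "\<xi> \<in> X n" for \<xi>
    proof -
      have "0 < 1 / (real n + 1)" by simp
      then show ?thesis using that less_le_trans[of 0 "1 / (real n + 1)" \<xi>] unfolding X_def by simp
    qed
    have cF: "continuous_on (X n) (\<lambda>\<xi>. F (of_real \<xi> * cis t))"
    proof (rule continuous_on_compose2[OF holomorphic_on_imp_continuous_on[OF holomorphic_F]])
      show "(\<lambda>\<xi>. of_real \<xi> * cis t) ` X n \<subseteq> S" using pos t cis_mem_open_sector by blast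
    qed (intro continuous_intros)
    have "(\<lambda>z. integral (cbox (1 / (real n + 1)) (real n + 1)) (f z)) holomorphic_on UNIV"
    proof (rule leibniz_rule_holomorphic)
      show "((\<lambda>z. f z \<xi>) has_field_derivative - (of_real \<xi> * cis t) * f z \<xi>) (at z within UNIV)" for z \<xi>
        unfolding f_def by (auto intro!: derivative_eq_intros)
      show "f z integrable_on cbox (1 / (real n + 1)) (real n + 1)" for z
        unfolding f_def[abs_def] using cF unfolding X_def
        by (intro integrable_continuous continuous_intros) (simp_all add: cbox_interval)
      have "continuous_on (UNIV \<times> X n) (\<lambda>p. F (of_real (snd p) * cis t))"
        by (rule continuous_on_compose2[OF cF]) (auto intro!: continuous_intros)
      then show "continuous_on (UNIV \<times> cbox (1 / (real n + 1)) (real n + 1)) (\<lambda>(z, \<xi>). - (of_real \<xi> * cis t) * f z \<xi>)"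
        unfolding f_def case_prod_unfold X_def cbox_interval
        by (intro continuous_intros)
    qed simp
    then show ?thesis unfolding X_def cbox_interval by (rule holomorphic_on_subset) simp
  qed
  fix z0 assume "z0 \<in> {z. \<gamma> t < Re (z * cis t)}"
  then have z0: "\<gamma> t < Re (z0 * cis t)" by simp
  \<comment> \<open>Half of the margin at \<open>z0\<close>: since \<open>cis t\<close> has modulus
    1, the other half survives on the whole disc \<open>cball z0 \<kappa>\<close>.\<close>
  define \<kappa> where "\<kappa> = (Re (z0 * cis t) - \<gamma> t) / 2"
  have \<kappa>: "0 < \<kappa>" using z0 by (simp add: \<kappa>_def)
  have half: "\<gamma> t + \<kappa> \<le> Re (z * cis t)" if "z \<in> cball z0 \<kappa>" for z
  proof -
    have "\<bar>Re ((z0 - z) * cis t)\<bar> \<le> cmod ((z0 - z) * cis t)" by (rule abs_Re_le_cmod)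
    also have "\<dots> \<le> \<kappa>" using that by (simp add: norm_mult dist_norm)
    finally have "Re (z0 * cis t) - Re (z * cis t) \<le> \<kappa>" by (simp add: left_diff_distrib abs_le_iff)
    then show ?thesis unfolding \<kappa>_def by (simp add: field_simps)
  qed
  define g where "g \<xi> = A t * exp (- \<kappa> * \<xi>)" for \<xi>
  have gi: "set_integrable lborel {0<..} g"
    unfolding g_def using set_integrable_exp_minus(1)[OF \<kappa>] by simp
  have Xs: "X n \<in> sets lborel" "X n \<subseteq> {0<..}" for n
  proof -
    have "0 < 1 / (real n + 1)" by simp
    then show "X n \<subseteq> {0<..}" unfolding X_def using less_le_trans[of 0 "1 / (real n + 1)"] by auto
  qed (simp add: X_def)
  \<comment> \<open>A majorant of the truncation error that no longer depends on
    \<open>z\<close>.\<close>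
  define c where "c n = (LBINT \<xi>:{0<..} - X n. g \<xi>)" for n
  have split: "(LBINT \<xi>:{0<..}. h \<xi>) = (LBINT \<xi>:X n. h \<xi>) + (LBINT \<xi>:{0<..} - X n. h \<xi>)"
    if "set_integrable lborel {0<..} h" for h :: "real \<Rightarrow> 'a :: {banach, second_countable_topology}" and n
  proof -
    have "(LBINT \<xi>:X n \<union> ({0<..} - X n). h \<xi>) = (LBINT \<xi>:X n. h \<xi>) + (LBINT \<xi>:{0<..} - X n. h \<xi>)"
      by (rule set_integral_Un) (use Xs[of n] in \<open>auto intro!: set_integrable_subset[OF that]\<close>)
    moreover have "X n \<union> ({0<..} - X n) = {0<..}" using Xs(2)[of n] by blast
    ultimately show ?thesis by simp
  qed
  have "(\<lambda>n. LBINT \<xi>:X n. g \<xi>) \<longlonglongrightarrow> (LBINT \<xi>:(\<Union>n. X n). g \<xi>)"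
  proof (rule set_integral_cont_up)
    show "incseq X"
      unfolding incseq_def X_def by (auto intro!: frac_le intro: order_trans)
    show "set_integrable lborel (\<Union>n. X n) g"
      by (rule set_integrable_subset[OF gi]) (use Xs in auto)
  qed (use Xs in auto)
  moreover have "(\<Union>n. X n) = {0<..}"
  proof (intro equalityI subsetI)
    fix \<xi> :: real assume "\<xi> \<in> {0<..}"
    then have \<xi>: "0 < \<xi>" by simp
    obtain n :: nat where n: "max \<xi> (1 / \<xi>) \<le> real n" using real_arch_simple by blast
    then have "1 / \<xi> \<le> real n + 1" by simp
    then have "1 / (real n + 1) \<le> \<xi>" using \<xi> by (simp add: field_simps)
    then show "\<xi> \<in> (\<Union>n. X n)" using n unfolding X_def by (intro UN_I[of n]) auto
  qed (use Xs in blast)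
  ultimately have "(\<lambda>n. (LBINT \<xi>:{0<..}. g \<xi>) - (LBINT \<xi>:X n. g \<xi>)) \<longlonglongrightarrow> (LBINT \<xi>:{0<..}. g \<xi>) - (LBINT \<xi>:{0<..}. g \<xi>)"
    by (intro tendsto_diff tendsto_const) simp
  moreover have "c = (\<lambda>n. (LBINT \<xi>:{0<..}. g \<xi>) - (LBINT \<xi>:X n. g \<xi>))"
    using split[OF gi] by (simp add: fun_eq_iff c_def algebra_simps)
  ultimately have c0: "c \<longlonglongrightarrow> 0" by (simp only: diff_self)
  have bound: "cmod (ray_laplace F t z - integral (X n) (f z)) \<le> c n" if z: "z \<in> cball z0 \<kappa>" for z n
  proof -
    have adm: "\<gamma> t < Re (z * cis t)" using half[OF z] \<kappa> by simp
    have fi: "set_integrable lborel {0<..} (f z)"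
      unfolding f_def[abs_def] by (rule integrand_integrable[OF t adm])
    have "(LBINT \<xi>:X n. f z \<xi>) = integral (X n) (f z)"
      by (rule set_borel_integral_eq_integral(2)) (rule set_integrable_subset[OF fi], use Xs in auto)
    moreover have "ray_laplace F t z = (LBINT \<xi>:{0<..}. f z \<xi>)" unfolding ray_laplace_def f_def ..
    ultimately have "ray_laplace F t z - integral (X n) (f z) = (LBINT \<xi>:{0<..} - X n. f z \<xi>)"
      using split[OF fi, of n] by simp
    also have "cmod \<dots> \<le> (LBINT \<xi>:{0<..} - X n. cmod (f z \<xi>))"
      by (rule set_integral_norm_bound, rule set_integrable_subset[OF fi]) (use Xs in auto)
    also have "\<dots> \<le> (LBINT \<xi>:{0<..} - X n. g \<xi>)"
    proof (rule set_integral_mono)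
      show "set_integrable lborel ({0<..} - X n) (\<lambda>\<xi>. cmod (f z \<xi>))"
        by (rule set_integrable_norm, rule set_integrable_subset[OF fi]) (use Xs in auto)
      show "set_integrable lborel ({0<..} - X n) g"
        by (rule set_integrable_subset[OF gi]) (use Xs in auto)
      fix \<xi> assume "\<xi> \<in> {0<..} - X n"
      then have \<xi>: "0 < \<xi>" by simp
      have "cmod (f z \<xi>) \<le> A t * exp (- (Re (z * cis t) - \<gamma> t) * \<xi>)"
        unfolding f_def by (rule integrand_bound[OF t \<xi>])
      also have "\<dots> \<le> g \<xi>"
      proof -
        have "\<kappa> * \<xi> \<le> (Re (z * cis t) - \<gamma> t) * \<xi>"
          by (rule mult_right_mono) (use half[OF z] \<xi> in linarith)+
        then have "- (Re (z * cis t) - \<gamma> t) * \<xi> \<le> - \<kappa> * \<xi>"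
          by (simp only: mult_minus_left neg_le_iff_le)
        then show ?thesis unfolding g_def
          by (intro mult_left_mono A(2)[OF t]) (simp only: exp_le_cancel_iff)
      qed
      finally show "cmod (f z \<xi>) \<le> g \<xi>" .
    qed
    finally show ?thesis unfolding c_def .
  qed
  have "uniform_limit (cball z0 \<kappa>) (\<lambda>n z. integral (X n) (f z)) (ray_laplace F t) sequentially"
  proof (rule uniform_limitI)
    fix e :: real assume "0 < e"
    then have "\<forall>\<^sub>F n in sequentially. c n < e" by (rule order_tendstoD(2)[OF c0])
    then show "\<forall>\<^sub>F n in sequentially. \<forall>z\<in>cball z0 \<kappa>. dist (integral (X n) (f z)) (ray_laplace F t z) < e"
    proof eventually_elim
      case (elim n)
      show ?case
      proof
        fix z assume "z \<in> cball z0 \<kappa>"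
        from order.strict_trans1[OF bound[OF this] elim]
        show "dist (integral (X n) (f z)) (ray_laplace F t z) < e"
          by (simp only: dist_norm norm_minus_commute)
      qed
    qed
  qed
  moreover have "cball z0 \<kappa> \<subseteq> {z. \<gamma> t < Re (z * cis t)}" using half \<kappa> by fastforce
  ultimately show "\<exists>d. 0 < d \<and> cball z0 d \<subseteq> {z. \<gamma> t < Re (z * cis t)} \<and>
      uniform_limit (cball z0 d) (\<lambda>n z. integral (X n) (f z)) (ray_laplace F t) sequentially"
    using \<kappa> by blast
qed

text \<open>Directions between \<open>t\<close> and \<open>t'\<close> need not be admissible for a given \<open>z\<close>, so the contour
  cannot be rotated directly; far out on the bisecting ray it can, and the identity theorem in
  \<open>z\<close> does the rest.\<close>

lemma ray_laplace_eq_far: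
  assumes t: "t \<in> J" "t' \<in> J" "t < t'"
  obtains X0 where "\<And>X. X0 \<le> X \<Longrightarrow> \<gamma> t < Re (of_real X * cis (- ((t + t') / 2)) * cis t) \<and>
    \<gamma> t' < Re (of_real X * cis (- ((t + t') / 2)) * cis t') \<and>
    ray_laplace F t (of_real X * cis (- ((t + t') / 2))) = ray_laplace F t' (of_real X * cis (- ((t + t') / 2)))"
proof -
  define h where "h = (t' - t) / 2"
  have "0 < h" "h < pi / 2" using t width by (auto simp: h_def)
  then have ch: "0 < cos h" by (intro cos_gt_zero)
  obtain C K where CK: "0 \<le> C" "0 \<le> K"
    "\<And>s \<xi>. t \<le> s \<Longrightarrow> s \<le> t' \<Longrightarrow> 0 < \<xi> \<Longrightarrow> cmod (F (of_real \<xi> * cis s)) \<le> C * exp (K * \<xi>)"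
    "\<And>s. t \<le> s \<Longrightarrow> s \<le> t' \<Longrightarrow> \<gamma> s \<le> K"
    using sector_bound[OF t(1,2)] by blast
  show thesis
  proof (rule that[of "(K + 2) / cos h"])
    fix X assume X: "(K + 2) / cos h \<le> X"
    then have Xc: "K + 2 \<le> X * cos h" using ch by (simp add: field_simps)
    define z where "z = of_real X * cis (- ((t + t') / 2))"
    have "- ((t + t') / 2) + t = - h" "- ((t + t') / 2) + t' = h" by (simp_all add: h_def field_simps)
    then have zt: "z * cis t = of_real X * cis (- h)" "z * cis t' = of_real X * cis h"
      unfolding z_def mult.assoc cis_mult by simp_all
    then have Rt: "Re (z * cis t) = X * cos h" "Re (z * cis t') = X * cos h" by simp_all
    have adm: "\<gamma> t < Re (z * cis t)" "\<gamma> t' < Re (z * cis t')"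
      unfolding Rt using CK(4)[of t] CK(4)[of t'] t(3) Xc by auto
    obtain P where P: "is_primitive z P" using ex_primitive[of z] by (rule exE)
    \<comment> \<open>Both directions make the angle \<open>h\<close> with the bisector, so
      \<open>Re (z * \<zeta>)\<close> is constant on the chord and exceeds the growth by at least
      \<open>2 * \<xi>\<close>. One factor \<open>exp (- \<xi>)\<close> absorbs the length of the
      chord, the other sends the difference to 0.\<close>
    have step: "cmod (P (of_real \<xi> * cis t) - P (of_real \<xi> * cis t')) \<le> 2 * C * exp (- \<xi>)" if \<xi>: "0 < \<xi>" for \<xi>
    proof -
      define T where "T = closed_segment (of_real \<xi> * cis t) (of_real \<xi> * cis t')"
      have T: "\<zeta> \<in> S \<and> cmod (F \<zeta> * exp (- (z * \<zeta>))) \<le> C * exp (- 2 * \<xi>)" if \<zeta>T: "\<zeta> \<in> T" for \<zeta>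
      proof -
        obtain u where u: "0 \<le> u" "u \<le> 1" "\<zeta> = (1 - u) *\<^sub>R (of_real \<xi> * cis t) + u *\<^sub>R (of_real \<xi> * cis t')"
          using \<zeta>T unfolding T_def closed_segment_def by blast
        then have \<zeta>: "\<zeta> = of_real ((1 - u) * \<xi>) * cis t + of_real (u * \<xi>) * cis t'"
          by (simp add: scaleR_conv_of_real)
        have "(1 - u) * \<xi> + u * \<xi> = \<xi>" by (simp add: algebra_simps)
        moreover have "t \<le> t'" "t' - t < pi" "0 \<le> (1 - u) * \<xi>" "0 \<le> u * \<xi>" using t width u \<xi> by auto
        ultimately obtain r s where rs: "\<zeta> = of_real r * cis s" "0 < r" "r \<le> \<xi>" "t \<le> s" "s \<le> t'"
          unfolding \<zeta> using \<xi> by (metis cone_combination)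
        have "cmod (F \<zeta>) \<le> C * exp (K * r)" unfolding rs(1) using CK(3) rs by blast
        also have "\<dots> \<le> C * exp (K * \<xi>)" using rs(3) CK by (intro mult_left_mono) (auto intro: mult_left_mono)
        finally have 1: "cmod (F \<zeta>) \<le> C * exp (K * \<xi>)" .
        have "Re (z * \<zeta>) = (1 - u) * \<xi> * Re (z * cis t) + u * \<xi> * Re (z * cis t')"
          unfolding \<zeta> by (simp add: algebra_simps)
        also have "\<dots> = X * cos h * \<xi>" unfolding Rt by (simp add: algebra_simps)
        finally have "Re (z * \<zeta>) = X * cos h * \<xi>" .
        then have 2: "cmod (exp (- (z * \<zeta>))) = exp (- (X * cos h * \<xi>))" by (simp only: norm_exp_eq_Re uminus_complex.sel)
        have "cmod (F \<zeta> * exp (- (z * \<zeta>))) \<le> C * exp (K * \<xi>) * exp (- (X * cos h * \<xi>))"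
          unfolding norm_mult 2 using 1 by (intro mult_right_mono) auto
        also have "\<dots> = C * exp (K * \<xi> - X * cos h * \<xi>)" by (simp add: exp_diff exp_minus field_simps)
        also have "\<dots> \<le> C * exp (- 2 * \<xi>)"
        proof -
          have "(K + 2) * \<xi> \<le> X * cos h * \<xi>" using Xc \<xi> by (intro mult_right_mono) auto
          then show ?thesis using CK(1) by (intro mult_left_mono) (auto simp: algebra_simps)
        qed
        finally have 3: "cmod (F \<zeta> * exp (- (z * \<zeta>))) \<le> C * exp (- 2 * \<xi>)" .
        have "s \<in> J" using rs t by auto
        then have "\<zeta> \<in> S" unfolding rs(1) using rs(2) by (intro cis_mem_open_sector)
        then show ?thesis using 3 by blast
      qed
      have "cmod (P (of_real \<xi> * cis t) - P (of_real \<xi> * cis t')) \<le>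
          C * exp (- 2 * \<xi>) * cmod (of_real \<xi> * cis t - of_real \<xi> * cis t')"
      proof (rule field_differentiable_bound[of T])
        fix \<zeta> assume "\<zeta> \<in> T"
        then show "cmod (F \<zeta> * exp (- (z * \<zeta>))) \<le> C * exp (- 2 * \<xi>)" using T by blast
        have "\<zeta> \<in> S" using T \<open>\<zeta> \<in> T\<close> by blast
        then have "(P has_field_derivative F \<zeta> * exp (- (z * \<zeta>))) (at \<zeta>)"
          using P unfolding is_primitive_def by blast
        then show "(P has_field_derivative F \<zeta> * exp (- (z * \<zeta>))) (at \<zeta> within T)"
          by (rule has_field_derivative_at_within)
      qed (auto simp: T_def)
      also have "\<dots> \<le> C * exp (- 2 * \<xi>) * (2 * exp \<xi>)"
      proof (intro mult_left_mono)
        have "cmod (of_real \<xi> * cis t - of_real \<xi> * cis t') \<le> \<xi> + \<xi>"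
          using norm_triangle_ineq4[of "of_real \<xi> * cis t" "of_real \<xi> * cis t'"] \<xi> by (simp add: norm_mult)
        also have "\<dots> \<le> 2 * exp \<xi>" using exp_ge_add_one_self[of \<xi>] by linarith
        finally show "cmod (of_real \<xi> * cis t - of_real \<xi> * cis t') \<le> 2 * exp \<xi>" .
      qed (use CK in simp)
      also have "\<dots> = 2 * C * exp (- \<xi>)"
        by (simp add: exp_add[symmetric])
      finally show ?thesis .
    qed
    have "((\<lambda>\<xi>. P (of_real \<xi> * cis t) - P (of_real \<xi> * cis t')) \<longlongrightarrow> ray_laplace F t z - ray_laplace F t' z) at_top"
      by (intro tendsto_diff primitive_tendsto_ray_laplace t adm P)
    moreover have "((\<lambda>\<xi>. P (of_real \<xi> * cis t) - P (of_real \<xi> * cis t')) \<longlongrightarrow> 0) at_top"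
    proof (rule Lim_null_comparison)
      show "\<forall>\<^sub>F \<xi> in at_top. cmod (P (of_real \<xi> * cis t) - P (of_real \<xi> * cis t')) \<le> 2 * C * exp (- 1 * \<xi>)"
        using eventually_gt_at_top[of 0] by eventually_elim (use step in simp)
      have "((\<lambda>\<xi>. 2 * C * exp (- 1 * \<xi>)) \<longlongrightarrow> 2 * C * 0) at_top"
        by (intro tendsto_mult tendsto_const tendsto_exp_minus_mult) simp
      then show "((\<lambda>\<xi>. 2 * C * exp (- 1 * \<xi>)) \<longlongrightarrow> 0) at_top" by simp
    qed
    ultimately have "ray_laplace F t z - ray_laplace F t' z = 0"
      using tendsto_unique[OF trivial_limit_at_top_linorder] by blast
    then show "\<gamma> t < Re (of_real X * cis (- ((t + t') / 2)) * cis t) \<and>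
      \<gamma> t' < Re (of_real X * cis (- ((t + t') / 2)) * cis t') \<and>
      ray_laplace F t (of_real X * cis (- ((t + t') / 2))) = ray_laplace F t' (of_real X * cis (- ((t + t') / 2)))"
      using adm unfolding z_def by simp
  qed
qed

lemma ray_laplace_eq_less:
  assumes t: "t \<in> J" "t' \<in> J" "t < t'" and adm: "\<gamma> t < Re (z * cis t)" "\<gamma> t' < Re (z * cis t')"
  shows "ray_laplace F t z = ray_laplace F t' z"
proof -
  obtain X0 where X0: "\<And>X. X0 \<le> X \<Longrightarrow> \<gamma> t < Re (of_real X * cis (- ((t + t') / 2)) * cis t) \<and>
    \<gamma> t' < Re (of_real X * cis (- ((t + t') / 2)) * cis t') \<and>
    ray_laplace F t (of_real X * cis (- ((t + t') / 2))) = ray_laplace F t' (of_real X * cis (- ((t + t') / 2)))"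
    using ray_laplace_eq_far[OF t] by blast
  define H where "H s = {z. \<gamma> s < Re (z * cis s)}" for s
  define U where "U = (\<lambda>X. of_real X * cis (- ((t + t') / 2))) ` {X0..}"
  have Hc: "convex (H s)" for s
  proof -
    have "linear (\<lambda>z. Re (z * cis s))" by (intro linearI) (auto simp: algebra_simps)
    then have "convex ((\<lambda>z. Re (z * cis s)) -` {\<gamma> s<..})" by (rule convex_linear_vimage) simp
    moreover have "(\<lambda>z. Re (z * cis s)) -` {\<gamma> s<..} = H s" by (auto simp: H_def)
    ultimately show ?thesis by simp
  qed
  have Ho: "open (H s)" for s unfolding H_def by (intro open_Collect_less continuous_intros)
  define p where "p = of_real X0 * cis (- ((t + t') / 2))"
  \<comment> \<open>The intersection of the two half-planes of admissibility is convex. It contains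
    the half-line \<open>U\<close>, where the integrals agree and which accumulates at its own
    starting point \<open>p\<close>.\<close>
  have "ray_laplace F t z - ray_laplace F t' z = 0"
  proof (rule analytic_continuation[of "\<lambda>z. ray_laplace F t z - ray_laplace F t' z" "H t \<inter> H t'" U p])
    have "ray_laplace F t holomorphic_on H t" "ray_laplace F t' holomorphic_on H t'"
      unfolding H_def using holomorphic_ray_laplace t by blast+
    then show "(\<lambda>z. ray_laplace F t z - ray_laplace F t' z) holomorphic_on H t \<inter> H t'"
      by (intro holomorphic_on_diff) (auto intro: holomorphic_on_subset)
    show "open (H t \<inter> H t')" "connected (H t \<inter> H t')"
      using Ho Hc by (auto intro!: convex_connected convex_Int)
    show "U \<subseteq> H t \<inter> H t'" unfolding U_def H_def using X0 by blast
    then show "p \<in> H t \<inter> H t'" unfolding p_def U_def by blast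
    show "p islimpt U"
      unfolding islimpt_approachable
    proof (intro allI impI)
      fix e :: real assume e: "0 < e"
      define q where "q = of_real (X0 + e / 2) * cis (- ((t + t') / 2))"
      have "q - p = of_real (e / 2) * cis (- ((t + t') / 2))" by (simp add: q_def p_def algebra_simps)
      then have "dist q p = e / 2" unfolding dist_norm using e by (simp only: norm_mult) simp
      moreover have "q \<in> U" unfolding q_def U_def by (rule imageI) (use e in simp)
      ultimately show "\<exists>x'\<in>U. x' \<noteq> p \<and> dist x' p < e" using e by (intro bexI[of _ q]) auto
    qed
    show "ray_laplace F t z - ray_laplace F t' z = 0" if "z \<in> U" for z
      using that X0 unfolding U_def by auto
    show "z \<in> H t \<inter> H t'" using adm by (simp add: H_def)
  qed
  then show ?thesis by simp
qed

lemma ray_laplace_eq: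
  assumes "t \<in> J" "t' \<in> J" "\<gamma> t < Re (z * cis t)" "\<gamma> t' < Re (z * cis t')"
  shows "ray_laplace F t z = ray_laplace F t' z"
  using ray_laplace_eq_less[of t t' z] ray_laplace_eq_less[of t' t z] assms
  by (cases t t' rule: linorder_cases) auto

text \<open>Resolves both choices in \<open>laplace\<close>: the extension is unique on the sector
  by the identity theorem, and the value is the same for all admissible directions by
  \<open>ray_laplace_eq\<close>.\<close>

lemma laplace_eq:
  assumes t: "t \<in> J" "\<gamma> t < Re (z * cis t)"
  shows "laplace J \<gamma> (a, \<phi>) z = a + ray_laplace F t z"
proof -
  define G where "G = (SOME F. sector_extension J \<phi> F)"
  have G: "sector_extension J \<phi> G" unfolding G_def by (rule someI[of _ F]) (rule ext)
  have GF: "G \<zeta> = F \<zeta>" if "\<zeta> \<in> S" for \<zeta>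
    by (rule sector_extension_unique[OF less width G ext that])
  have int: "(LBINT \<xi>:{0<..}. exp (- (z * of_real \<xi> * cis s)) * G (of_real \<xi> * cis s) * cis s)
      = ray_laplace F s z" if "s \<in> J" for s
    unfolding ray_laplace_def
    by (rule set_lebesgue_integral_cong) (use GF cis_mem_open_sector that in auto)
  show ?thesis
    unfolding laplace_def snd_conv fst_conv G_def[symmetric] Let_def
  proof (rule the_equality)
    show "\<forall>s\<in>J. \<gamma> s < Re (z * cis s) \<longrightarrow> a + ray_laplace F t z = a +
        (LBINT \<xi>:{0<..}. exp (- (z * of_real \<xi> * cis s)) * G (of_real \<xi> * cis s) * cis s)"
      using int ray_laplace_eq t by (metis (no_types, lifting))
    show "v = a + ray_laplace F t z" if "\<forall>s\<in>J. \<gamma> s < Re (z * cis s) \<longrightarrow> v = a +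
        (LBINT \<xi>:{0<..}. exp (- (z * of_real \<xi> * cis s)) * G (of_real \<xi> * cis s) * cis s)" for v
      using that t int by simp
  qed
qed

text \<open>A margin \<open>\<kappa>\<close> bounds the denominator of the integral estimate from
  below, and directions in a compact interval bound its numerator. The constant serves every
  \<open>z\<close> having such a direction, whatever its size.\<close>

lemma laplace_bounded:
  assumes "lo \<in> J" "hi \<in> J" "0 < \<kappa>"
  obtains C where "\<And>t z. lo \<le> t \<Longrightarrow> t \<le> hi \<Longrightarrow> \<gamma> t + \<kappa> < Re (z * cis t) \<Longrightarrow> cmod (laplace J \<gamma> (a, \<phi>) z) \<le> C"
proof -
  have sub: "{lo..hi} \<subseteq> J" using assms by auto
  obtain B where B: "\<And>t. t \<in> {lo..hi} \<Longrightarrow> \<bar>A t\<bar> \<le> B"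
    using locally_bounded_on_compact[OF A(1) compact_Icc sub] by blast
  show thesis
  proof (rule that[of "cmod a + B / \<kappa>"])
    fix t z assume t: "lo \<le> t" "t \<le> hi" "\<gamma> t + \<kappa> < Re (z * cis t)"
    then have tJ: "t \<in> J" and adm: "\<gamma> t < Re (z * cis t)" using sub assms(3) by auto
    have "cmod (ray_laplace F t z) \<le> A t / (Re (z * cis t) - \<gamma> t)" by (rule ray_laplace_bound[OF tJ adm])
    also have "\<dots> \<le> B / \<kappa>" using B[of t] A(2)[OF tJ] t assms(3) by (intro frac_le) auto
    finally show "cmod (laplace J \<gamma> (a, \<phi>) z) \<le> cmod a + B / \<kappa>"
      unfolding laplace_eq[OF tJ adm] using norm_triangle_ineq[of a "ray_laplace F t z"] by linarith
  qed
qed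

end

section \<open>Continuation of germs\<close>

lemma holomorphic_eq_on_connected:
  assumes "open S" "connected S" "f holomorphic_on S" "g holomorphic_on S"
    and ev: "\<forall>\<^sub>F \<zeta> in nhds p. f \<zeta> = g \<zeta>" and p: "p \<in> S" and z: "z \<in> S"
  shows "f z = g z"
proof -
  obtain U where U: "open U" "p \<in> U" "\<And>\<zeta>. \<zeta> \<in> U \<Longrightarrow> f \<zeta> = g \<zeta>"
    using ev unfolding eventually_nhds by blast
  show ?thesis
    by (rule analytic_continuation_open[of "U \<inter> S" S]) (use U p assms in auto)
qed

lemma holomorphic_on_eval_fps_at:
  assumes "ereal r \<le> fps_conv_radius \<psi>"
  shows "(\<lambda>\<zeta>. eval_fps \<psi> (\<zeta> - c)) holomorphic_on ball c r"
proof -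
  have "eval_fps \<psi> holomorphic_on ball 0 r"
    by (rule holomorphic_on_eval_fps_ball[OF assms])
  then have "(eval_fps \<psi> \<circ> (\<lambda>\<zeta>. \<zeta> - c)) holomorphic_on ball c r"
    by (rule holomorphic_on_compose_gen[rotated])
       (auto simp: dist_norm norm_minus_commute intro!: holomorphic_intros)
  then show ?thesis by (simp add: comp_def)
qed

lemma eval_fps_expansion_ball:
  assumes "f holomorphic_on ball c r" "\<zeta> \<in> ball c r"
  shows "eval_fps (fps_expansion f c) (\<zeta> - c) = f \<zeta>"
  using eval_fps_expansion[of f c "ereal r" \<zeta>] assms by simp

lemma conv_radius_fps_expansion_ball:
  assumes "f holomorphic_on ball c r"
  shows "ereal r \<le> fps_conv_radius (fps_expansion f c)"
  using conv_radius_fps_expansion[of f c "ereal r"] assms by simp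

lemma eventually_eval_fps_expansion:
  assumes "open U" "f holomorphic_on U" "c \<in> U"
  shows "\<forall>\<^sub>F \<zeta> in nhds c. eval_fps (fps_expansion f c) (\<zeta> - c) = f \<zeta>"
    and "0 < fps_conv_radius (fps_expansion f c)"
proof -
  obtain r where r: "0 < r" "ball c r \<subseteq> U"
    using assms openE by blast
  then have f: "f holomorphic_on ball c r" using assms holomorphic_on_subset by blast
  show "\<forall>\<^sub>F \<zeta> in nhds c. eval_fps (fps_expansion f c) (\<zeta> - c) = f \<zeta>"
    using eval_fps_expansion_ball[OF f] r(1) by (auto simp: eventually_nhds intro!: exI[of _ "ball c r"])
  have "0 < ereal r" using r by simp
  then show "0 < fps_conv_radius (fps_expansion f c)"
    using conv_radius_fps_expansion_ball[OF f] by (rule less_le_trans)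
qed

lemma eval_fps_eventually_eqD:
  fixes \<psi> \<psi>' :: "complex fps"
  assumes "0 < fps_conv_radius \<psi>" "0 < fps_conv_radius \<psi>'"
    and "\<forall>\<^sub>F \<zeta> in nhds c. eval_fps \<psi> (\<zeta> - c) = eval_fps \<psi>' (\<zeta> - c)"
  shows "\<psi> = \<psi>'"
proof (rule eval_fps_eqD[OF assms(1,2)])
  have "((\<lambda>\<zeta>. \<zeta> + c) \<longlongrightarrow> 0 + c) (nhds 0)"
    by (intro tendsto_intros filterlim_ident)
  then have "filterlim (\<lambda>\<zeta>. \<zeta> + c) (nhds c) (nhds 0)" by simp
  from eventually_compose_filterlim[OF assms(3) this]
  show "\<forall>\<^sub>F \<zeta> in nhds 0. eval_fps \<psi> \<zeta> = eval_fps \<psi>' \<zeta>" by simp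
qed

lemma fps_expansion_eval_fps:
  assumes "0 < fps_conv_radius \<psi>"
    and ev: "\<forall>\<^sub>F \<zeta> in nhds c. eval_fps \<psi> (\<zeta> - c) = f \<zeta>"
    and f: "open U" "f holomorphic_on U" "c \<in> U"
  shows "\<psi> = fps_expansion f c"
proof (rule eval_fps_eventually_eqD[where c = c])
  show "\<forall>\<^sub>F \<zeta> in nhds c. eval_fps \<psi> (\<zeta> - c) = eval_fps (fps_expansion f c) (\<zeta> - c)"
    using ev eventually_eval_fps_expansion(1)[OF f] by eventually_elim simp
qed (use assms eventually_eval_fps_expansion(2)[OF f] in auto)

text \<open>The part of \<open>continuation_along\<close> that ignores the initial germ. Unlike the
  full notion it can be restricted to a later piece of a path, or compared starting from any
  parameter.\<close>

definition germ_chain :: "(real \<Rightarrow> complex) \<Rightarrow> (real \<Rightarrow> complex fps) \<Rightarrow> bool" where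
  "germ_chain g G \<longleftrightarrow> (\<forall>t\<in>{0..1}. 0 < fps_conv_radius (G t) \<and>
        (\<forall>\<^sub>F s in at t within {0..1}. \<forall>\<^sub>F \<zeta> in nhds (g s).
            eval_fps (G s) (\<zeta> - g s) = eval_fps (G t) (\<zeta> - g t)))"

lemma continuation_along_iff:
  "continuation_along \<phi> g G \<longleftrightarrow> ereal (cmod (g 0)) < fps_conv_radius \<phi> \<and>
     (\<forall>\<^sub>F \<zeta> in nhds (g 0). eval_fps (G 0) (\<zeta> - g 0) = eval_fps \<phi> \<zeta>) \<and> germ_chain g G"
  by (simp add: continuation_along_def germ_chain_def)

lemma eventually_ereal_cmod_less:
  assumes "0 < R" "continuous_on {0..1} g" "t \<in> {0..1}"
  shows "\<forall>\<^sub>F s in at t within {0..1}. ereal (cmod (g s - g t)) < R"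
proof -
  obtain r where r: "0 < ereal r" "ereal r < R"
    using assms(1) ereal_dense2 by blast
  have "(g \<longlongrightarrow> g t) (at t within {0..1})"
    using assms by (simp add: continuous_on_def)
  then have "\<forall>\<^sub>F s in at t within {0..1}. dist (g s) (g t) < r"
    using r(1) by (simp add: tendsto_iff)
  then show ?thesis
    by eventually_elim (use r(2) in \<open>auto simp: dist_norm intro: less_trans[of _ "ereal r"]\<close>)
qed

text \<open>Equality of the two germs is locally constant along the connected interval: it spreads
  from \<open>a\<close> to nearby \<open>b\<close> by the chain condition, and from \<open>b\<close>
  back to \<open>a\<close> by the identity theorem in a common disc of convergence. The reference
  parameter \<open>t0\<close> is arbitrary, so chains can also be compared backwards.\<close>

lemma germ_chain_unique:
  assumes G: "germ_chain g G" and H: "germ_chain g H" and g: "continuous_on {0..1} g"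
    and t0: "t0 \<in> {0..1}" "G t0 = H t0" and t: "t \<in> {0..1}"
  shows "G t = H t"
proof -
  define P where "P t = (G t = H t)" for t
  have "P t = P t0"
  proof (rule connected_local_const[of "{0..1}", THEN sym])
    show "\<forall>a\<in>{0..1}. \<forall>\<^sub>F b in at a within {0..1}. P a = P b"
    proof
      fix a :: real assume a: "a \<in> {0..1}"
      have rG: "0 < fps_conv_radius (G a)" and rH: "0 < fps_conv_radius (H a)"
        using G H a unfolding germ_chain_def by blast+
      obtain r where r: "0 < ereal r" "ereal r < min (fps_conv_radius (G a)) (fps_conv_radius (H a))"
        using ereal_dense2[of 0 "min (fps_conv_radius (G a)) (fps_conv_radius (H a))"] rG rH by auto
      have "\<forall>\<^sub>F b in at a within {0..1}. ereal (cmod (g b - g a)) < ereal r"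
        by (rule eventually_ereal_cmod_less[OF r(1) g a])
      moreover have "\<forall>\<^sub>F b in at a within {0..1}. \<forall>\<^sub>F \<zeta> in nhds (g b).
            eval_fps (G b) (\<zeta> - g b) = eval_fps (G a) (\<zeta> - g a)"
         "\<forall>\<^sub>F b in at a within {0..1}. \<forall>\<^sub>F \<zeta> in nhds (g b).
            eval_fps (H b) (\<zeta> - g b) = eval_fps (H a) (\<zeta> - g a)"
        using G H a unfolding germ_chain_def by blast+
      moreover have "\<forall>\<^sub>F b in at a within {0..1}. b \<in> {0..1}"
        by (simp add: eventually_at_filter)
      ultimately show "\<forall>\<^sub>F b in at a within {0..1}. P a = P b"
      proof eventually_elim
        case (elim b)
        have rb: "0 < fps_conv_radius (G b)" "0 < fps_conv_radius (H b)"
          using G H elim(4) unfolding germ_chain_def by blast+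
        have b: "g b \<in> ball (g a) r" using elim(1) by (simp add: dist_norm norm_minus_commute)
        show ?case
        proof (cases "G a = H a")
          case True
          have "\<forall>\<^sub>F \<zeta> in nhds (g b). eval_fps (G b) (\<zeta> - g b) = eval_fps (H b) (\<zeta> - g b)"
            using elim(2,3) by eventually_elim (simp add: True)
          then show ?thesis using eval_fps_eventually_eqD[OF rb] True by (simp add: P_def)
        next
          case False
          have "G b \<noteq> H b"
          proof
            assume eq: "G b = H b"
            \<comment> \<open>Agreement near \<open>g b\<close> is transported to the series centred
              at \<open>g a\<close>, whose discs of convergence both contain
              \<open>g b\<close>.\<close>
            have ev: "\<forall>\<^sub>F \<zeta> in nhds (g b). eval_fps (G a) (\<zeta> - g a) = eval_fps (H a) (\<zeta> - g a)"
              using elim(2,3) by eventually_elim (simp add: eq)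
            have "eval_fps (G a) (\<zeta> - g a) = eval_fps (H a) (\<zeta> - g a)" if "\<zeta> \<in> ball (g a) r" for \<zeta>
              by (rule holomorphic_eq_on_connected[where f = "\<lambda>\<zeta>. eval_fps (G a) (\<zeta> - g a)"
                    and g = "\<lambda>\<zeta>. eval_fps (H a) (\<zeta> - g a)", OF open_ball connected_ball _ _ ev b that])
                 (rule holomorphic_on_eval_fps_at, use r(2) in \<open>simp add: less_imp_le\<close>)+
            then have "\<forall>\<^sub>F \<zeta> in nhds (g a). eval_fps (G a) (\<zeta> - g a) = eval_fps (H a) (\<zeta> - g a)"
              unfolding eventually_nhds using r(1) by (intro exI[of _ "ball (g a) r"]) auto
            then show False using eval_fps_eventually_eqD[OF rG rH] False by blast
          qed
          then show ?thesis using False by (simp add: P_def)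
        qed
      qed
    qed
  qed (use t t0 in auto)
  then show ?thesis using t0 by (simp add: P_def)
qed

lemma continuation_along_unique:
  assumes "continuation_along \<phi> g G" "continuation_along \<phi> g H" "continuous_on {0..1} g"
    and t: "t \<in> {0..1}"
  shows "G t = H t"
proof (rule germ_chain_unique)
  show "G 0 = H 0"
  proof (rule eval_fps_eventually_eqD)
    show "\<forall>\<^sub>F \<zeta> in nhds (g 0). eval_fps (G 0) (\<zeta> - g 0) = eval_fps (H 0) (\<zeta> - g 0)"
      using assms(1,2) unfolding continuation_along_iff by (auto elim: eventually_elim2)
  qed (use assms in \<open>auto simp: continuation_along_def\<close>)
qed (use assms in \<open>auto simp: continuation_along_iff\<close>)

lemma cont_eq:
  assumes "continuation_along \<phi> g G" "continuous_on {0..1} g"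
  shows "cont g \<phi> = G 1"
  unfolding cont_def
proof (rule the_equality)
  show "\<exists>H. continuation_along \<phi> g H \<and> G 1 = H 1" using assms by blast
  show "\<psi> = G 1" if "\<exists>H. continuation_along \<phi> g H \<and> \<psi> = H 1" for \<psi>
    using that continuation_along_unique[OF _ assms(1,2), of _ 1] by auto
qed

text \<open>Converse passage from functions to germs: local holomorphic functions attached to the
  parameters form a chain as soon as they agree wherever the path lies in both domains. The
  functions may change along the path, as the branches do.\<close>

lemma germ_chain_fps_expansion:
  assumes g: "continuous_on {0..1} g" and U: "\<And>t. t \<in> {0..1} \<Longrightarrow> open (U t) \<and> g t \<in> U t \<and> f t holomorphic_on U t"
    and eq: "\<And>s t. s \<in> {0..1} \<Longrightarrow> t \<in> {0..1} \<Longrightarrow> g s \<in> U t \<Longrightarrow> \<forall>\<^sub>F \<zeta> in nhds (g s). f s \<zeta> = f t \<zeta>"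
  shows "germ_chain g (\<lambda>t. fps_expansion (f t) (g t))"
  unfolding germ_chain_def
proof (intro ballI conjI)
  fix t :: real assume t: "t \<in> {0..1}"
  show "0 < fps_conv_radius (fps_expansion (f t) (g t))"
    using eventually_eval_fps_expansion(2)[of "U t"] U[OF t] by blast
  obtain r where r: "0 < r" "ball (g t) r \<subseteq> U t" using U[OF t] openE by blast
  have hol: "f t holomorphic_on ball (g t) r" using U[OF t] r holomorphic_on_subset by blast
  have "\<forall>\<^sub>F s in at t within {0..1}. ereal (cmod (g s - g t)) < ereal r"
    by (rule eventually_ereal_cmod_less[OF _ g t]) (use r in simp)
  moreover have "\<forall>\<^sub>F s in at t within {0..1}. s \<in> {0..1}"
    by (simp add: eventually_at_filter)
  ultimately show "\<forall>\<^sub>F s in at t within {0..1}. \<forall>\<^sub>F \<zeta> in nhds (g s).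
       eval_fps (fps_expansion (f s) (g s)) (\<zeta> - g s) = eval_fps (fps_expansion (f t) (g t)) (\<zeta> - g t)"
  proof eventually_elim
    case (elim s)
    then have s: "g s \<in> ball (g t) r" by (simp add: dist_norm norm_minus_commute)
    have "\<forall>\<^sub>F \<zeta> in nhds (g s). \<zeta> \<in> ball (g t) r"
      using s by (intro eventually_nhds_in_open) auto
    moreover have "\<forall>\<^sub>F \<zeta> in nhds (g s). f s \<zeta> = f t \<zeta>"
      using eq[OF elim(2) t] s r by blast
    moreover have "\<forall>\<^sub>F \<zeta> in nhds (g s). eval_fps (fps_expansion (f s) (g s)) (\<zeta> - g s) = f s \<zeta>"
      using eventually_eval_fps_expansion(1)[of "U s"] U[OF elim(2)] by blast
    ultimately show ?case
      by eventually_elim (use eval_fps_expansion_ball[OF hol] in simp)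
  qed
qed

text \<open>The radius of convergence cannot drop suddenly along the path, because nearby germs are
  re-expansions of one function; compactness of the interval does the rest.\<close>

lemma germ_chain_uniform_radius:
  assumes G: "germ_chain g G" and g: "continuous_on {0..1} g"
  obtains \<delta> where "0 < \<delta>" "\<And>t. t \<in> {0..1} \<Longrightarrow> ereal \<delta> \<le> fps_conv_radius (G t)"
proof -
  have loc: "\<exists>U r. open U \<and> t \<in> U \<and> 0 < r \<and> (\<forall>s\<in>U \<inter> {0..1}. ereal r \<le> fps_conv_radius (G s))"
    if t: "t \<in> {0..1}" for t
  proof -
    \<comment> \<open>With \<open>2 * r\<close> available at \<open>g t\<close>, discs of radius
      \<open>r\<close> about nearby points of the path stay inside the disc of convergence.\<close>
    obtain r where r: "0 < ereal (2 * r)" "ereal (2 * r) \<le> fps_conv_radius (G t)"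
    proof -
      obtain r where "0 < ereal r" "ereal r < fps_conv_radius (G t)"
        using G t ereal_dense2 unfolding germ_chain_def by blast
      then show thesis using that[of "r/2"] by (simp add: less_imp_le)
    qed
    have hol: "(\<lambda>\<zeta>. eval_fps (G t) (\<zeta> - g t)) holomorphic_on ball (g t) (2 * r)"
      by (rule holomorphic_on_eval_fps_at[OF r(2)])
    have r0: "0 < r" using r(1) by simp
    have "\<forall>\<^sub>F s in at t within {0..1}. ereal (cmod (g s - g t)) < ereal r"
      by (rule eventually_ereal_cmod_less[OF _ g t]) (use r0 in simp)
    moreover have "\<forall>\<^sub>F s in at t within {0..1}. s \<in> {0..1}"
      by (simp add: eventually_at_filter)
    moreover have "\<forall>\<^sub>F s in at t within {0..1}. \<forall>\<^sub>F \<zeta> in nhds (g s).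
            eval_fps (G s) (\<zeta> - g s) = eval_fps (G t) (\<zeta> - g t)"
      using G t unfolding germ_chain_def by blast
    ultimately have "\<forall>\<^sub>F s in at t within {0..1}. ereal r \<le> fps_conv_radius (G s)"
    proof eventually_elim
      case (elim s)
      have "ball (g s) r \<subseteq> ball (g t) (2 * r)"
        using elim(1) by (auto simp: dist_norm) (smt (verit) norm_minus_commute norm_triangle_sub norm_triangle_ineq4 diff_add_cancel norm_diff_triangle_less)
      then have h: "(\<lambda>\<zeta>. eval_fps (G t) (\<zeta> - g t)) holomorphic_on ball (g s) r"
        using hol holomorphic_on_subset by blast
      have "G s = fps_expansion (\<lambda>\<zeta>. eval_fps (G t) (\<zeta> - g t)) (g s)"
        by (rule fps_expansion_eval_fps[OF _ elim(3) open_ball h])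
           (use G elim(2) r0 in \<open>auto simp: germ_chain_def\<close>)
      then show ?case using conv_radius_fps_expansion_ball[OF h] by simp
    qed
    then obtain U where U: "open U" "t \<in> U" "\<And>s. s \<in> U \<Longrightarrow> s \<noteq> t \<Longrightarrow> s \<in> {0..1} \<Longrightarrow> ereal r \<le> fps_conv_radius (G s)"
      unfolding eventually_at_topological by blast
    have "ereal r \<le> fps_conv_radius (G t)"
      using r r0 order_trans[of "ereal r" "ereal (2 * r)"] by simp
    then have "\<forall>s\<in>U \<inter> {0..1}. ereal r \<le> fps_conv_radius (G s)" using U(3) by blast
    then show ?thesis using U(1,2) r0 by blast
  qed
  then obtain U r where Ur: "\<And>t. t \<in> {0..1} \<Longrightarrow> open (U t) \<and> t \<in> U t \<and> 0 < r t \<and> (\<forall>s\<in>U t \<inter> {0..1}. ereal (r t) \<le> fps_conv_radius (G s))"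
    by metis
  obtain T where T: "T \<subseteq> {0..1}" "finite T" "{0..1} \<subseteq> (\<Union>t\<in>T. U t)"
    using compactE_image[OF compact_Icc, of "{0..1}" U 0 1] Ur by blast
  have Tne: "T \<noteq> {}" using T(3) by force
  show thesis
  proof (rule that[of "Min (r ` T)"])
    show "0 < Min (r ` T)" using T Tne Ur by (subst Min_gr_iff) auto
    fix t :: real assume "t \<in> {0..1}"
    then obtain u where u: "u \<in> T" "t \<in> U u" using T by blast
    then have "ereal (r u) \<le> fps_conv_radius (G t)" using Ur T \<open>t \<in> {0..1}\<close> by blast
    moreover have "Min (r ` T) \<le> r u" using u T by (intro Min_le) auto
    ultimately show "ereal (Min (r ` T)) \<le> fps_conv_radius (G t)"
      using order_trans ereal_less_eq(3) by blast
  qed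
qed

text \<open>The discs of uniform radius around the original path carry the continuation along every
  nearby path: it suffices to re-expand the same functions at the points of the new path.\<close>

lemma germ_chain_perturb:
  assumes G: "germ_chain g G" and g: "continuous_on {0..1} g"
  obtains \<delta> where "0 < \<delta>"
    "\<And>t. t \<in> {0..1} \<Longrightarrow> (\<lambda>\<zeta>. eval_fps (G t) (\<zeta> - g t)) holomorphic_on ball (g t) \<delta>"
    "\<And>h. continuous_on {0..1} h \<Longrightarrow> (\<And>t. t \<in> {0..1} \<Longrightarrow> cmod (h t - g t) < \<delta>) \<Longrightarrow>
      germ_chain h (\<lambda>t. fps_expansion (\<lambda>\<zeta>. eval_fps (G t) (\<zeta> - g t)) (h t))"
proof -
  obtain \<delta> where \<delta>: "0 < \<delta>" "\<And>t. t \<in> {0..1} \<Longrightarrow> ereal \<delta> \<le> fps_conv_radius (G t)"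
    using germ_chain_uniform_radius[OF G g] by blast
  define f where "f t \<zeta> = eval_fps (G t) (\<zeta> - g t)" for t \<zeta>
  have hol: "f t holomorphic_on ball (g t) \<delta>" if "t \<in> {0..1}" for t
    unfolding f_def by (rule holomorphic_on_eval_fps_at[OF \<delta>(2)[OF that]])
  show thesis
  proof (rule that[OF \<delta>(1)])
    fix h :: "real \<Rightarrow> complex" assume h: "continuous_on {0..1} h" "\<And>t. t \<in> {0..1} \<Longrightarrow> cmod (h t - g t) < \<delta>"
    show "germ_chain h (\<lambda>t. fps_expansion (\<lambda>\<zeta>. eval_fps (G t) (\<zeta> - g t)) (h t))"
      unfolding f_def[symmetric] germ_chain_def
    proof (intro ballI conjI)
      fix t :: real assume t: "t \<in> {0..1}"
      have ht: "h t \<in> ball (g t) \<delta>" using h(2)[OF t] by (simp add: dist_norm norm_minus_commute)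
      show "0 < fps_conv_radius (fps_expansion (f t) (h t))"
        by (rule eventually_eval_fps_expansion(2)[OF open_ball hol[OF t] ht])
      obtain r where r: "0 < r" "ball (h t) r \<subseteq> ball (g t) \<delta>"
        using ht openE[OF open_ball] by metis
      have rhol: "f t holomorphic_on ball (h t) r" using hol[OF t] r holomorphic_on_subset by blast
      have "\<forall>\<^sub>F s in at t within {0..1}. ereal (cmod (h s - h t)) < ereal r"
        by (rule eventually_ereal_cmod_less[OF _ h(1) t]) (use r in simp)
      moreover have "\<forall>\<^sub>F s in at t within {0..1}. ereal (cmod (g s - g t)) < ereal \<delta>"
        by (rule eventually_ereal_cmod_less[OF _ g t]) (use \<delta> in simp)
      moreover have "\<forall>\<^sub>F s in at t within {0..1}. s \<in> {0..1}"
        by (simp add: eventually_at_filter)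
      moreover have "\<forall>\<^sub>F s in at t within {0..1}. \<forall>\<^sub>F \<zeta> in nhds (g s). f s \<zeta> = f t \<zeta>"
        using G t unfolding germ_chain_def f_def by blast
      ultimately show "\<forall>\<^sub>F s in at t within {0..1}. \<forall>\<^sub>F \<zeta> in nhds (h s).
          eval_fps (fps_expansion (f s) (h s)) (\<zeta> - h s) = eval_fps (fps_expansion (f t) (h t)) (\<zeta> - h t)"
      proof eventually_elim
        case (elim s)
        have hs: "h s \<in> ball (g s) \<delta>" using h(2)[OF elim(3)] by (simp add: dist_norm norm_minus_commute)
        have hs': "h s \<in> ball (h t) r" using elim(1) by (simp add: dist_norm norm_minus_commute)
        \<comment> \<open>The overlap of two discs is convex; it contains \<open>g s\<close>, where
          the germs are known to agree, and \<open>h s\<close>, where agreement is wanted.\<close>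
        define B where "B = ball (g s) \<delta> \<inter> ball (g t) \<delta>"
        have "f s \<zeta> = f t \<zeta>" if "\<zeta> \<in> B" for \<zeta>
        proof (rule holomorphic_eq_on_connected[of B "f s" "f t" "g s"])
          show "open B" "connected B" unfolding B_def by (auto intro!: convex_connected convex_Int)
          show "f s holomorphic_on B" "f t holomorphic_on B"
            unfolding B_def using hol[OF elim(3)] hol[OF t] holomorphic_on_subset by blast+
          show "g s \<in> B" using elim(2) \<delta> by (simp add: B_def dist_norm norm_minus_commute)
        qed (use elim(4) that in auto)
        moreover have "\<forall>\<^sub>F \<zeta> in nhds (h s). \<zeta> \<in> B \<inter> ball (h t) r"
          using hs hs' r(2) by (intro eventually_nhds_in_open) (auto simp: B_def)
        ultimately have "\<forall>\<^sub>F \<zeta> in nhds (h s). f s \<zeta> = f t \<zeta> \<and> \<zeta> \<in> ball (h t) r"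
          by (auto elim: eventually_mono)
        moreover have "\<forall>\<^sub>F \<zeta> in nhds (h s). eval_fps (fps_expansion (f s) (h s)) (\<zeta> - h s) = f s \<zeta>"
          by (rule eventually_eval_fps_expansion(1)[OF open_ball hol[OF elim(3)] hs])
        ultimately show ?case
          by eventually_elim (use eval_fps_expansion_ball[OF rhol] in simp)
      qed
    qed
  qed (use hol in \<open>simp add: f_def[abs_def]\<close>)
qed

text \<open>Cuts a continuation along a broken line at the corner \<open>c\<close>. The second half
  keeps no reference to the initial germ, hence is only a chain.\<close>

lemma continuation_along_joinpaths:
  assumes G: "continuation_along \<phi> (linepath z0 c +++ linepath c p) G"
  shows "continuation_along \<phi> (linepath z0 c) (\<lambda>t. G (t / 2))"
    and "germ_chain (linepath c p) (\<lambda>t. G ((1 + t) / 2))"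
proof -
  define g where "g = linepath z0 c +++ linepath c p"
  have chain: "germ_chain g G" using G by (simp add: continuation_along_iff g_def)
  have g1: "g (t / 2) = linepath z0 c t" if "t \<in> {0..1}" for t
    using that by (simp add: g_def joinpaths_def)
  have g2: "g ((1 + t) / 2) = linepath c p t" if "t \<in> {0..1}" for t
  proof (cases "t = 0")
    case True
    then show ?thesis by (simp add: g_def joinpaths_def linepath_def)
  next
    case False
    have "2 * ((1 + t) / 2) - 1 = t" by (simp add: add_divide_distrib)
    moreover have "\<not> (1 + t) / 2 \<le> 1 / 2" using that False by simp
    ultimately show ?thesis unfolding g_def joinpaths_def by simp
  qed
  \<comment> \<open>Injectivity of the reparametrisation \<open>u\<close> is required because the
    chain condition speaks of punctured neighbourhoods of a parameter.\<close>
  have re: "germ_chain h (\<lambda>t. G (u t))"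
    if h: "\<And>t. t \<in> {0..1} \<Longrightarrow> g (u t) = h t" and u: "continuous_on {0..1} u" "\<And>t. t \<in> {0..1} \<Longrightarrow> u t \<in> {0..1}"
      "inj_on u {0..1}" for h u
    unfolding germ_chain_def
  proof (intro ballI conjI)
    fix t :: real assume t: "t \<in> {0..1}"
    show "0 < fps_conv_radius (G (u t))"
      using chain u(2)[OF t] unfolding germ_chain_def by blast
    have "filterlim u (at (u t) within {0..1}) (at t within {0..1})"
      unfolding filterlim_at
    proof
      show "\<forall>\<^sub>F x in at t within {0..1}. u x \<in> {0..1} \<and> u x \<noteq> u t"
      proof -
        have "\<forall>\<^sub>F x in at t within {0..1}. x \<in> {0..1} \<and> x \<noteq> t"
          by (simp add: eventually_at_filter)
        then show ?thesis
          by eventually_elim (use u(2) inj_onD[OF u(3)] t in blast)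
      qed
      show "(u \<longlongrightarrow> u t) (at t within {0..1})"
        using u(1) t by (simp add: continuous_on_def)
    qed
    moreover have "\<forall>\<^sub>F s in at (u t) within {0..1}. \<forall>\<^sub>F \<zeta> in nhds (g s).
            eval_fps (G s) (\<zeta> - g s) = eval_fps (G (u t)) (\<zeta> - g (u t))"
      using chain u(2)[OF t] unfolding germ_chain_def by blast
    ultimately have "\<forall>\<^sub>F s in at t within {0..1}. \<forall>\<^sub>F \<zeta> in nhds (g (u s)).
            eval_fps (G (u s)) (\<zeta> - g (u s)) = eval_fps (G (u t)) (\<zeta> - g (u t))"
      by (rule eventually_compose_filterlim[rotated])
    moreover have "\<forall>\<^sub>F s in at t within {0..1}. s \<in> {0..1}"
      by (simp add: eventually_at_filter)
    ultimately show "\<forall>\<^sub>F s in at t within {0..1}. \<forall>\<^sub>F \<zeta> in nhds (h s).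
            eval_fps (G (u s)) (\<zeta> - h s) = eval_fps (G (u t)) (\<zeta> - h t)"
      by eventually_elim (simp add: h h[OF t])
  qed
  have "germ_chain (linepath z0 c) (\<lambda>t. G (t / 2))"
    by (rule re[OF g1]) (auto intro!: continuous_intros inj_onI)
  then show "continuation_along \<phi> (linepath z0 c) (\<lambda>t. G (t / 2))"
    using G g1[of 0] by (simp add: continuation_along_iff g_def)
  show "germ_chain (linepath c p) (\<lambda>t. G ((1 + t) / 2))"
    by (rule re[OF g2]) (auto intro!: continuous_intros inj_onI)
qed

text \<open>The function at \<open>p\<close> is the value of the continuation along the segment from
  \<open>c\<close> to \<open>p\<close>. For nearby end points the segments are uniformly close, so
  the perturbed chain and uniqueness show that it is locally a convergent power series. Only
  segments issuing from \<open>c\<close> are compared, so no homotopy enters.\<close>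

lemma germ_chain_starlike_extension:
  assumes U: "open U" "c \<in> U" "\<And>p. p \<in> U \<Longrightarrow> closed_segment c p \<subseteq> U"
    and H: "\<And>p. p \<in> U \<Longrightarrow> germ_chain (linepath c p) (H p) \<and> H p 0 = \<psi>"
  obtains f where "f holomorphic_on U" "fps_expansion f c = \<psi>"
proof -
  define f where "f p = eval_fps (H p 1) 0" for p
  have loc: "\<exists>\<delta>>0. ball p \<delta> \<subseteq> U \<and> (\<lambda>\<zeta>. eval_fps (H p 1) (\<zeta> - p)) holomorphic_on ball p \<delta> \<and>
      (\<forall>q\<in>ball p \<delta>. f q = eval_fps (H p 1) (q - p))"
    if p: "p \<in> U" for p
  proof -
    have chain: "germ_chain (linepath c p) (H p)" and H0: "H p 0 = \<psi>" using H[OF p] by auto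
    have cont: "continuous_on {0..1} (linepath c q)" for q by (intro continuous_intros)
    obtain d where d: "0 < d"
      "\<And>t. t \<in> {0..1} \<Longrightarrow> (\<lambda>\<zeta>. eval_fps (H p t) (\<zeta> - linepath c p t)) holomorphic_on ball (linepath c p t) d"
      "\<And>h. continuous_on {0..1} h \<Longrightarrow> (\<And>t. t \<in> {0..1} \<Longrightarrow> cmod (h t - linepath c p t) < d) \<Longrightarrow>
        germ_chain h (\<lambda>t. fps_expansion (\<lambda>\<zeta>. eval_fps (H p t) (\<zeta> - linepath c p t)) (h t))"
      using germ_chain_perturb[OF chain cont] by blast
    obtain e where e: "0 < e" "ball p e \<subseteq> U" using U(1) p openE by blast
    have hol: "(\<lambda>\<zeta>. eval_fps (H p 1) (\<zeta> - p)) holomorphic_on ball p d"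
      using d(2)[of 1] by (simp add: linepath_def)
    have "f q = eval_fps (H p 1) (q - p)" if q: "q \<in> ball p (min d e)" for q
    proof -
      have qU: "q \<in> U" using q e by auto
      have close: "cmod (linepath c q t - linepath c p t) < d" if "t \<in> {0..1}" for t
      proof -
        have "linepath c q t - linepath c p t = of_real t * (q - p)"
          by (simp add: linepath_def algebra_simps scaleR_conv_of_real)
        then have "cmod (linepath c q t - linepath c p t) \<le> cmod (q - p)"
          using that by (simp add: norm_mult mult_left_le_one_le)
        then show ?thesis using q by (simp add: dist_norm norm_minus_commute)
      qed
      define K where "K t = fps_expansion (\<lambda>\<zeta>. eval_fps (H p t) (\<zeta> - linepath c p t)) (linepath c q t)" for t
      have K: "germ_chain (linepath c q) K"
        unfolding K_def[abs_def] by (rule d(3)[OF cont close])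
      \<comment> \<open>Re-expanding at the unmoved starting point \<open>c\<close> changes nothing;
        the perturbed chain and the chain given for \<open>q\<close> start alike and therefore end
        alike.\<close>
      have "K 0 = H q 0"
      proof -
        have hol0: "(\<lambda>\<zeta>. eval_fps \<psi> (\<zeta> - c)) holomorphic_on ball c d"
          using d(2)[of 0] by (simp add: linepath_def H0)
        have "\<psi> = fps_expansion (\<lambda>\<zeta>. eval_fps \<psi> (\<zeta> - c)) c"
          by (rule fps_expansion_eval_fps[OF _ _ open_ball hol0])
             (use chain H0 d(1) in \<open>auto simp: germ_chain_def\<close>)
        then show ?thesis using H[OF qU] by (simp add: K_def linepath_def H0)
      qed
      then have "K 1 = H q 1"
        using germ_chain_unique[OF K _ cont, of "H q" 0 1] H[OF qU] by simp
      then have "f q = eval_fps (fps_expansion (\<lambda>\<zeta>. eval_fps (H p 1) (\<zeta> - p)) q) (q - q)"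
        by (simp add: f_def K_def linepath_def flip: \<open>K 1 = H q 1\<close>)
      also have "\<dots> = eval_fps (H p 1) (q - p)"
      proof -
        obtain r where "0 < r" "ball q r \<subseteq> ball p d" using q openE[of "ball p d" q] by auto
        then show ?thesis
          using eval_fps_expansion_ball[of "\<lambda>\<zeta>. eval_fps (H p 1) (\<zeta> - p)" q r q]
            holomorphic_on_subset[OF hol] by simp
      qed
      finally show ?thesis .
    qed
    then show ?thesis
      using d(1) e hol holomorphic_on_subset[OF hol, of "ball p (min d e)"]
      by (intro exI[of _ "min d e"]) auto
  qed
  have holf: "f holomorphic_on U"
  proof -
    have "f field_differentiable (at p)" if p: "p \<in> U" for p
    proof -
      obtain \<delta> where \<delta>: "\<delta> > 0" "(\<lambda>\<zeta>. eval_fps (H p 1) (\<zeta> - p)) holomorphic_on ball p \<delta>"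
        "\<And>q. q \<in> ball p \<delta> \<Longrightarrow> f q = eval_fps (H p 1) (q - p)" using loc[OF p] by blast
      have "f holomorphic_on ball p \<delta>"
        using \<delta>(2) holomorphic_cong[of "ball p \<delta>" "ball p \<delta>" f "\<lambda>\<zeta>. eval_fps (H p 1) (\<zeta> - p)"] \<delta>(3) by simp
      then show ?thesis using \<delta>(1) holomorphic_on_imp_differentiable_at[OF _ open_ball] by simp
    qed
    then show ?thesis using U(1) by (simp add: holomorphic_on_open field_differentiable_def)
  qed
  have "H c 1 = \<psi>"
  proof -
    have rad: "0 < fps_conv_radius \<psi>" using H[OF U(2)] by (force simp: germ_chain_def)
    have "germ_chain (linepath c c) (\<lambda>_. \<psi>)"
      unfolding germ_chain_def using rad by (simp add: linepath_def)
    then have "H c 1 = (\<lambda>_. \<psi>) 1"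
      using germ_chain_unique[of "linepath c c" "H c" "\<lambda>_. \<psi>" 0 1] H[OF U(2)] by simp
    then show ?thesis by simp
  qed
  then obtain \<delta> where \<delta>: "\<delta> > 0" "\<And>q. q \<in> ball c \<delta> \<Longrightarrow> f q = eval_fps \<psi> (q - c)"
    using loc[OF U(2)] by auto
  have "\<psi> = fps_expansion f c"
  proof (rule fps_expansion_eval_fps[OF _ _ U(1) holf U(2)])
    show "0 < fps_conv_radius \<psi>" using H[OF U(2)] by (force simp: germ_chain_def)
    show "\<forall>\<^sub>F \<zeta> in nhds c. eval_fps \<psi> (\<zeta> - c) = f \<zeta>"
      unfolding eventually_nhds using \<delta> by (intro exI[of _ "ball c \<delta>"]) auto
  qed
  then show thesis using that holf by simp
qed

text \<open>The initial point \<open>z0\<close>, which must be near the origin, is not the star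
  centre. The germ is first carried to \<open>c\<close>, extended from there to \<open>U\<close>,
  and then recognised again at \<open>z0\<close>.\<close>

lemma continuation_starlike:
  assumes U: "open U" "\<And>p. p \<in> U \<Longrightarrow> closed_segment c p \<subseteq> U" and z0: "z0 \<in> U"
    and ex: "\<And>p. p \<in> U \<Longrightarrow> \<exists>G. continuation_along \<phi> (linepath z0 c +++ linepath c p) G"
  obtains f where "f holomorphic_on U" "\<forall>\<^sub>F \<zeta> in nhds z0. f \<zeta> = eval_fps \<phi> \<zeta>"
proof -
  have cU: "c \<in> U" using U(2)[OF z0] by auto
  obtain G where G: "\<And>p. p \<in> U \<Longrightarrow> continuation_along \<phi> (linepath z0 c +++ linepath c p) (G p)"
    using ex by metis
  \<comment> \<open>Any end point would do: up to the corner all these continuations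
    coincide.\<close>
  define L where "L = G z0"
  have contL: "continuation_along \<phi> (linepath z0 c) (\<lambda>t. L (t / 2))"
    unfolding L_def by (rule continuation_along_joinpaths(1)[OF G[OF z0]])
  have half: "G p (1/2) = L (1/2)" if "p \<in> U" for p
  proof -
    have "continuation_along \<phi> (linepath z0 c) (\<lambda>t. G p (t / 2))"
      by (rule continuation_along_joinpaths(1)[OF G[OF that]])
    from continuation_along_unique[OF this contL, of 1]
    show ?thesis by (simp add: continuous_on_linepath)
  qed
  have H: "germ_chain (linepath c p) (\<lambda>t. G p ((1 + t) / 2)) \<and> G p ((1 + 0) / 2) = L (1/2)" if "p \<in> U" for p
    using continuation_along_joinpaths(2)[OF G[OF that]] half[OF that] by simp
  obtain f where f: "f holomorphic_on U" "fps_expansion f c = L (1/2)"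
    using germ_chain_starlike_extension[of U c "\<lambda>p t. G p ((1 + t) / 2)" "L (1/2)"] U cU H by blast
  have line: "linepath z0 c t \<in> U" if "t \<in> {0..1}" for t
    using U(2)[OF z0] that linepath_in_path[of t z0 c] by (auto simp: closed_segment_commute)
  have F: "germ_chain (linepath z0 c) (\<lambda>t. fps_expansion f (linepath z0 c t))"
    using line U(1) f(1) by (intro germ_chain_fps_expansion[where U = "\<lambda>_. U"]) (auto intro!: continuous_on_linepath)
  \<comment> \<open>Uniqueness is used backwards, from parameter 1 at \<open>c\<close> to parameter
    0 at \<open>z0\<close>.\<close>
  have "germ_chain (linepath z0 c) (\<lambda>t. L (t / 2))"
    using contL by (simp add: continuation_along_iff)
  from germ_chain_unique[OF F this continuous_on_linepath, of 1 0]
  have "fps_expansion f (linepath z0 c 0) = L (0/2)"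
    using f(2) by (simp add: linepath_def)
  then have L0: "fps_expansion f z0 = L 0" by (simp add: linepath_def)
  have "\<forall>\<^sub>F \<zeta> in nhds z0. eval_fps (L 0) (\<zeta> - z0) = eval_fps \<phi> \<zeta>"
    using contL by (simp add: continuation_along_def linepath_def)
  moreover have "\<forall>\<^sub>F \<zeta> in nhds z0. eval_fps (L 0) (\<zeta> - z0) = f \<zeta>"
    using eventually_eval_fps_expansion(1)[OF U(1) f(1) z0] L0 by simp
  ultimately have "\<forall>\<^sub>F \<zeta> in nhds z0. f \<zeta> = eval_fps \<phi> \<zeta>"
    by eventually_elim simp
  then show thesis using that f(1) by blast
qed

section \<open>Branches across the singular ray\<close>

text \<open>The geometry seen from one component: \<open>\<Omega>\<close> will be the translated set
  and \<open>x i\<close> the distance from the base point to the \<open>i\<close>-th singularity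
  beyond it on the ray. The base point is \<open>x 0 = 0\<close>, the vertex, which is not in the
  open sector.\<close>

locale slit_sector =
  fixes a b \<theta> :: real and \<Omega> :: "complex set" and x :: "nat \<Rightarrow> real"
  assumes angles: "a < \<theta>" "\<theta> < b" "b - a < pi"
    and x: "strict_mono x" "x 0 = 0"
    and \<Omega>: "\<Omega> \<inter> open_sector {a<..<b} = {of_real (x i) * cis \<theta> | i. 1 \<le> i}"
begin

abbreviation "S \<equiv> open_sector {a<..<b}"
abbreviation "Sr \<equiv> open_sector {a<..<\<theta>}"
abbreviation "Sl \<equiv> open_sector {\<theta><..<b}"

definition rot :: "complex \<Rightarrow> complex" where "rot z = z * cis (- \<theta>)"

text \<open>The sector cut along its central ray outside the gap between \<open>x k\<close> and \<open>x (Suc k)\<close>.\<close>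

definition slit :: "nat \<Rightarrow> complex set" where
  "slit k = {z \<in> S. Im (rot z) = 0 \<longrightarrow> x k < Re (rot z) \<and> Re (rot z) < x (Suc k)}"

lemma rot_of_cis [simp]: "rot (w * cis \<theta>) = w"
  by (simp add: rot_def cis_mult mult.assoc)

lemma rot_cis: "z = rot z * cis \<theta>"
  by (simp add: rot_def cis_mult mult.assoc)

lemma cmod_rot [simp]: "cmod (rot z) = cmod z"
  by (simp add: rot_def norm_mult)

lemma rot_add: "rot (z + w) = rot z + rot w"
  and rot_diff: "rot (z - w) = rot z - rot w"
  and rot_scaleR: "rot (r *\<^sub>R z) = r *\<^sub>R rot z"
  by (simp_all add: rot_def algebra_simps)

lemma continuous_on_rot [continuous_intros]: "continuous_on A f \<Longrightarrow> continuous_on A (\<lambda>z. rot (f z))"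
  unfolding rot_def by (intro continuous_intros)

lemma ab: "a < b" using angles by simp

lemma open_S: "open S" and convex_S: "convex S"
  and open_Sr: "open Sr" and convex_Sr: "convex Sr"
  and open_Sl: "open Sl" and convex_Sl: "convex Sl"
  using open_open_sector convex_open_sector angles by simp_all

lemma mem_S_iff: "z \<in> S \<longleftrightarrow> 0 < Im (z * cis (- a)) \<and> Im (z * cis (- b)) < 0"
  using mem_open_sector_iff ab angles by blast

lemma Sr_subset: "Sr \<subseteq> S" and Sl_subset: "Sl \<subseteq> S"
  using angles by (auto intro!: open_sector_mono)

lemma mem_Sr_iff: "z \<in> Sr \<longleftrightarrow> z \<in> S \<and> Im (rot z) < 0"
proof -
  have "z \<in> Sr \<longleftrightarrow> 0 < Im (z * cis (- a)) \<and> Im (rot z) < 0"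
    unfolding rot_def using angles by (intro mem_open_sector_iff) auto
  then show ?thesis using Sr_subset mem_S_iff by blast
qed

lemma mem_Sl_iff: "z \<in> Sl \<longleftrightarrow> z \<in> S \<and> 0 < Im (rot z)"
proof -
  have "z \<in> Sl \<longleftrightarrow> 0 < Im (rot z) \<and> Im (z * cis (- b)) < 0"
    unfolding rot_def using angles by (intro mem_open_sector_iff) auto
  then show ?thesis using Sl_subset mem_S_iff by blast
qed

lemma Im_mult_cis: "Im (w * cis t) = Re w * sin t + Im w * cos t"
  by simp

lemma Im_cis_a: "Im (z * cis (- a)) = Re (rot z) * sin (\<theta> - a) + Im (rot z) * cos (\<theta> - a)"
proof -
  have "z * cis (- a) = rot z * cis (\<theta> - a)"
    by (simp add: rot_def cis_mult mult.assoc)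
  then show ?thesis by (simp only: Im_mult_cis)
qed

lemma Im_cis_b: "Im (z * cis (- b)) = - Re (rot z) * sin (b - \<theta>) + Im (rot z) * cos (b - \<theta>)"
proof -
  have "z * cis (- b) = rot z * cis (- (b - \<theta>))"
    by (simp add: rot_def cis_mult mult.assoc)
  then show ?thesis by (simp only: Im_mult_cis sin_minus cos_minus)
qed

lemma sin_pos: "0 < sin (\<theta> - a)" "0 < sin (b - \<theta>)"
  using angles by (auto intro!: sin_gt_zero)

lemma Re_rot_pos:
  assumes "z \<in> S" "Im (rot z) = 0"
  shows "0 < Re (rot z)" "z = of_real (Re (rot z)) * cis \<theta>"
proof -
  have "0 < Re (rot z) * sin (\<theta> - a)"
    using assms Im_cis_a[of z] mem_S_iff[of z] by simp
  then show "0 < Re (rot z)" using sin_pos(1) zero_less_mult_pos2 by blast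
  have "rot z = of_real (Re (rot z))" using assms(2) by (simp add: complex_eq_iff)
  then show "z = of_real (Re (rot z)) * cis \<theta>" using rot_cis[of z] by metis
qed

lemma ray_mem_S: "0 < y \<Longrightarrow> of_real y * cis \<theta> \<in> S"
  using angles by (intro cis_mem_open_sector) auto

text \<open>Replaces the cosines in the half-plane inequalities by 1, leaving a bound on the height
  alone that is proportional to the abscissa.\<close>

lemma near_ray_mem_S:
  assumes "0 < X" "\<bar>Y\<bar> < X * sin (\<theta> - a)" "\<bar>Y\<bar> < X * sin (b - \<theta>)"
  shows "Complex X Y * cis \<theta> \<in> S"
proof -
  have "\<bar>Y * cos t\<bar> \<le> \<bar>Y\<bar>" for t
    using abs_cos_le_one[of t] by (simp add: abs_mult mult_left_le)
  then have "\<bar>Y * cos (\<theta> - a)\<bar> < X * sin (\<theta> - a)" "\<bar>Y * cos (b - \<theta>)\<bar> < X * sin (b - \<theta>)"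
    using assms(2,3) order.strict_trans1 by blast+
  then show ?thesis
    unfolding mem_S_iff Im_cis_a Im_cis_b rot_of_cis by (simp add: abs_less_iff)
qed

lemma x_pos: "0 < i \<Longrightarrow> 0 < x i"
  using x strict_monoD by fastforce

lemma ray_mem_\<Omega>_iff: "0 < y \<Longrightarrow> of_real y * cis \<theta> \<in> \<Omega> \<longleftrightarrow> (\<exists>i\<ge>1. y = x i)"
proof -
  assume y: "0 < y"
  then have "of_real y * cis \<theta> \<in> \<Omega> \<longleftrightarrow> (\<exists>i\<ge>1. of_real y * cis \<theta> = of_real (x i) * cis \<theta>)"
    using ray_mem_S[OF y] \<Omega> by blast
  then show ?thesis by simp
qed

lemma open_slit: "open (slit k)"
proof -
  have "closed ({z. Im (rot z) = 0} \<inter> ({z. Re (rot z) \<le> x k} \<union> {z. x (Suc k) \<le> Re (rot z)}))"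
    by (intro closed_Int closed_Un closed_Collect_eq closed_Collect_le continuous_intros)
  moreover have "slit k = S - ({z. Im (rot z) = 0} \<inter> ({z. Re (rot z) \<le> x k} \<union> {z. x (Suc k) \<le> Re (rot z)}))"
    by (auto simp: slit_def not_less)
  ultimately show ?thesis using open_S by (simp only: open_Diff)
qed

lemma slit_disjoint: "slit k \<subseteq> - \<Omega>"
proof
  fix z assume z: "z \<in> slit k"
  show "z \<in> - \<Omega>"
  proof
    assume "z \<in> \<Omega>"
    then obtain i where i: "z = of_real (x i) * cis \<theta>"
      using z \<Omega> unfolding slit_def by blast
    then have "x k < x i" "x i < x (Suc k)"
      using z by (simp_all add: slit_def)
    then show False using strict_mono_less[OF x(1)] by simp
  qed
qed

lemma Sr_subset_slit: "Sr \<subseteq> slit k" and Sl_subset_slit: "Sl \<subseteq> slit k"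
  unfolding slit_def by (auto simp: mem_Sr_iff mem_Sl_iff)

lemma ray_mem_slit_iff: "0 < y \<Longrightarrow> of_real y * cis \<theta> \<in> slit k \<longleftrightarrow> x k < y \<and> y < x (Suc k)"
  unfolding slit_def using ray_mem_S[of y] by simp

definition centre :: "nat \<Rightarrow> complex" where
  "centre k = of_real ((x k + x (Suc k)) / 2) * cis \<theta>"

lemma x_less_Suc: "x k < x (Suc k)" using x(1) by (simp add: strict_mono_Suc_iff)

lemma x_nonneg: "0 \<le> x k" using x_pos[of k] x(2) by (cases k) auto

lemma rot_centre: "rot (centre k) = of_real ((x k + x (Suc k)) / 2)"
  unfolding centre_def by (rule rot_of_cis)

lemma centre_mem_slit: "centre k \<in> slit k"
  unfolding centre_def using x_less_Suc[of k] x_nonneg[of k]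
  by (subst ray_mem_slit_iff) auto

text \<open>On the segment from the midpoint of the gap the distance to the ray's line is
  proportional to the parameter. The segment meets that line again only if \<open>p\<close> lies on
  it, and then both ends are in the same gap.\<close>

lemma slit_starlike:
  assumes p: "p \<in> slit k"
  shows "closed_segment (centre k) p \<subseteq> slit k"
proof
  fix z assume "z \<in> closed_segment (centre k) p"
  then obtain s where s: "0 \<le> s" "s \<le> 1" "z = (1 - s) *\<^sub>R centre k + s *\<^sub>R p"
    unfolding closed_segment_def by blast
  have "centre k \<in> S" "p \<in> S" using p centre_mem_slit by (auto simp: slit_def)
  then have zS: "z \<in> S" using convexD[OF convex_S, of "centre k" p "1 - s" s] s by simp
  define m where "m = (x k + x (Suc k)) / 2"
  have m: "x k < m" "m < x (Suc k)" using x_less_Suc[of k] by (simp_all add: m_def)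
  have "rot z = (1 - s) *\<^sub>R rot (centre k) + s *\<^sub>R rot p"
    unfolding s(3) by (simp add: rot_add rot_scaleR)
  then have im: "Im (rot z) = s * Im (rot p)" and re: "Re (rot z) = (1 - s) * m + s * Re (rot p)"
    unfolding rot_centre m_def[symmetric] by simp_all
  have "x k < Re (rot z) \<and> Re (rot z) < x (Suc k)" if "Im (rot z) = 0"
  proof (cases "s = 0")
    case True then show ?thesis using m re by simp
  next
    case False
    then have "Im (rot p) = 0" using that im by simp
    then have r: "x k < Re (rot p)" "Re (rot p) < x (Suc k)" using p by (auto simp: slit_def)
    show ?thesis
      using convex_bound_lt[of m "x (Suc k)" "Re (rot p)" "1 - s" s]
        convex_bound_lt[of "- m" "- x k" "- Re (rot p)" "1 - s" s] s m r re by simp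
  qed
  then show "z \<in> slit k" using zS by (simp add: slit_def)
qed

end

text \<open>\<open>F\<close> is the one extension to the right sector that all branches share; the
  branches differ in the gap through which they continue it to the left.\<close>

locale resurgent_sector = slit_sector +
  fixes \<phi> :: "complex fps" and F :: "complex \<Rightarrow> complex"
  assumes continuable: "continuable \<Omega> \<phi>"
    and ext: "sector_extension {a<..<\<theta>} \<phi> F"
begin

lemma radius_pos: "0 < fps_conv_radius \<phi>"
proof -
  obtain R where "0 < R" "ereal R \<le> fps_conv_radius \<phi>"
    using continuable unfolding continuable_def by blast
  then show ?thesis by (meson ereal_less(2) less_le_trans)
qed

lemma holomorphic_F: "F holomorphic_on Sr"
  using ext by (simp add: sector_extension_def)

lemma ex_near_zero:
  assumes "0 < (r::real)"
  obtains z0 where "z0 \<in> Sr" "cmod z0 < r" "\<forall>\<^sub>F \<zeta> in nhds z0. F \<zeta> = eval_fps \<phi> \<zeta>"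
proof -
  obtain d where d: "0 < d" "\<And>\<zeta>. \<zeta> \<in> Sr \<Longrightarrow> \<zeta> \<noteq> 0 \<Longrightarrow> dist \<zeta> 0 < d \<Longrightarrow> F \<zeta> = eval_fps \<phi> \<zeta>"
    using ext unfolding sector_extension_def eventually_at by blast
  define z0 where "z0 = of_real (min d r / 2) * cis ((a + \<theta>) / 2)"
  have n: "cmod z0 = min d r / 2" using assms d(1) by (simp add: z0_def norm_mult)
  have z0: "z0 \<in> Sr" unfolding z0_def using assms d(1) angles by (intro cis_mem_open_sector) auto
  have "\<forall>\<^sub>F \<zeta> in nhds z0. \<zeta> \<in> Sr \<inter> (ball 0 d - {0})"
    using z0 n assms d(1) open_Sr by (intro eventually_nhds_in_open) auto
  then have "\<forall>\<^sub>F \<zeta> in nhds z0. F \<zeta> = eval_fps \<phi> \<zeta>"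
    by eventually_elim (use d(2) in auto)
  then show thesis using that[OF z0] n assms d(1) by simp
qed

text \<open>Paths from a point \<open>z0\<close> of the right sector near 0 through the midpoint of
  the gap stay in the slit sector, hence avoid \<open>\<Omega>\<close>; star-shapedness assembles
  the continuations into one function.\<close>

lemma ex_branch: "\<exists>f. f holomorphic_on slit k \<and> (\<forall>\<zeta>\<in>Sr. f \<zeta> = F \<zeta>)"
proof -
  obtain R where R: "0 < R" "ereal R \<le> fps_conv_radius \<phi>"
    "\<And>g. path g \<Longrightarrow> path_image g \<subseteq> - \<Omega> \<Longrightarrow> pathstart g \<in> punctured_disc R \<Longrightarrow> \<exists>G. continuation_along \<phi> g G"
    using continuable unfolding continuable_def by blast
  obtain z0 where z0: "z0 \<in> Sr" "cmod z0 < R" "\<forall>\<^sub>F \<zeta> in nhds z0. F \<zeta> = eval_fps \<phi> \<zeta>"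
    using ex_near_zero[OF R(1)] by blast
  have z0s: "z0 \<in> slit k" using z0(1) Sr_subset_slit by blast
  have "z0 \<noteq> 0" using z0(1) by (auto simp: open_sector_def)
  then have pd: "z0 \<in> punctured_disc R" using z0(2) by (simp add: punctured_disc_def)
  have "\<exists>G. continuation_along \<phi> (linepath z0 (centre k) +++ linepath (centre k) p) G"
    if p: "p \<in> slit k" for p
  proof (rule R(3))
    have "path_image (linepath z0 (centre k) +++ linepath (centre k) p) \<subseteq> slit k"
      using slit_starlike[OF z0s] slit_starlike[OF p] by (simp add: path_image_join closed_segment_commute)
    then show "path_image (linepath z0 (centre k) +++ linepath (centre k) p) \<subseteq> - \<Omega>"
      using slit_disjoint by blast
  qed (use pd in simp_all)
  then obtain f where f: "f holomorphic_on slit k" "\<forall>\<^sub>F \<zeta> in nhds z0. f \<zeta> = eval_fps \<phi> \<zeta>"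
    using continuation_starlike[OF open_slit slit_starlike z0s] by blast
  have ev: "\<forall>\<^sub>F \<zeta> in nhds z0. f \<zeta> = F \<zeta>" using f(2) z0(3) by eventually_elim simp
  have "f \<zeta> = F \<zeta>" if "\<zeta> \<in> Sr" for \<zeta>
    by (rule holomorphic_eq_on_connected[OF open_Sr convex_connected[OF convex_Sr] _ holomorphic_F ev z0(1) that])
       (rule holomorphic_on_subset[OF f(1) Sr_subset_slit])
  then show ?thesis using f(1) by blast
qed

definition branch :: "nat \<Rightarrow> complex \<Rightarrow> complex" where
  "branch k = (SOME f. f holomorphic_on slit k \<and> (\<forall>\<zeta>\<in>Sr. f \<zeta> = F \<zeta>))"

lemma holomorphic_branch: "branch k holomorphic_on slit k"
  and branch_eq: "\<zeta> \<in> Sr \<Longrightarrow> branch k \<zeta> = F \<zeta>"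
  using someI_ex[OF ex_branch[of k]] unfolding branch_def by blast+

text \<open>Gap 0 begins at the vertex, so near 0 nothing is cut and the zeroth branch is still the
  germ itself on the left of the ray.\<close>

lemma branch_0:
  obtains r where "0 < r" "\<And>\<zeta>. \<zeta> \<in> S \<Longrightarrow> cmod \<zeta> < r \<Longrightarrow> branch 0 \<zeta> = eval_fps \<phi> \<zeta>"
proof -
  obtain r' where r': "0 < ereal r'" "ereal r' < fps_conv_radius \<phi>"
    using radius_pos ereal_dense2 by blast
  define r where "r = min r' (x 1)"
  have r: "0 < r" "r \<le> x 1" "ereal r \<le> fps_conv_radius \<phi>"
    using r' x_pos[of 1] by (auto simp: r_def intro: order_trans[of _ "ereal r'"])
  define V where "V = S \<inter> ball 0 r"
  have V: "open V" "connected V" unfolding V_def by (auto intro!: convex_connected convex_Int convex_S open_S)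
  have "V \<subseteq> slit 0"
  proof
    fix z assume z: "z \<in> V"
    have "Re (rot z) < x 1" if "Im (rot z) = 0"
      using z r(2) complex_Re_le_cmod[of "rot z"] by (simp add: V_def)
    then show "z \<in> slit 0"
      using z Re_rot_pos(1)[of z] by (auto simp: slit_def V_def x(2))
  qed
  then have h1: "branch 0 holomorphic_on V" using holomorphic_branch holomorphic_on_subset by blast
  have h2: "eval_fps \<phi> holomorphic_on V"
    using holomorphic_on_eval_fps_ball[OF r(3)] by (rule holomorphic_on_subset) (auto simp: V_def)
  obtain z0 where z0: "z0 \<in> Sr" "cmod z0 < r" "\<forall>\<^sub>F \<zeta> in nhds z0. F \<zeta> = eval_fps \<phi> \<zeta>"
    using ex_near_zero[OF r(1)] by blast
  have "\<forall>\<^sub>F \<zeta> in nhds z0. \<zeta> \<in> Sr" using z0 open_Sr by (intro eventually_nhds_in_open)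
  then have ev: "\<forall>\<^sub>F \<zeta> in nhds z0. branch 0 \<zeta> = eval_fps \<phi> \<zeta>"
    using z0(3) by eventually_elim (simp add: branch_eq)
  have "z0 \<in> V" using z0 Sr_subset by (auto simp: V_def)
  then have "branch 0 \<zeta> = eval_fps \<phi> \<zeta>" if "\<zeta> \<in> V" for \<zeta>
    using holomorphic_eq_on_connected[OF V h1 h2 ev _ that] by blast
  then show thesis using that[OF r(1)] by (auto simp: V_def)
qed

end

section \<open>The path passing the singularities on the right\<close>

context slit_sector
begin

text \<open>Depth of the path below the ray at abscissa \<open>X\<close>. Neither the starting
  vertex \<open>x 0\<close> nor the target \<open>x n\<close> carries a half-circle.\<close>

definition half_circles :: "nat \<Rightarrow> real \<Rightarrow> real \<Rightarrow> real" where
  "half_circles n e X = (\<Sum>i\<in>{1..<n}. sqrt (max 0 (e\<^sup>2 - (X - x i)\<^sup>2)))"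

lemma right_path_eq:
  assumes "0 < n"
  shows "right_path \<Omega> (of_real (x n) * cis \<theta>) e t =
    Complex (e + t * (x n - 2 * e)) (- half_circles n e (e + t * (x n - 2 * e))) * cis \<theta>"
proof -
  have n: "0 < x n" by (rule x_pos[OF assms])
  have c: "cmod (of_real (x n) * cis \<theta>) = x n" using n by (simp add: norm_mult)
  have s: "sgn (of_real (x n) * cis \<theta>) = cis \<theta>"
    using n by (simp add: sgn_mult sgn_cis sgn_of_real)
  have "{s. 0 < s \<and> s < x n \<and> of_real s * cis \<theta> \<in> \<Omega>} = x ` {1..<n}"
  proof (intro set_eqI iffI)
    fix s assume "s \<in> {s. 0 < s \<and> s < x n \<and> of_real s * cis \<theta> \<in> \<Omega>}"
    then obtain i where "i \<ge> 1" "s = x i" "x i < x n" using ray_mem_\<Omega>_iff by auto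
    then show "s \<in> x ` {1..<n}" using strict_mono_less[OF x(1)] by auto
  next
    fix s assume "s \<in> x ` {1..<n}"
    then obtain i where i: "1 \<le> i" "i < n" "s = x i" by auto
    then show "s \<in> {s. 0 < s \<and> s < x n \<and> of_real s * cis \<theta> \<in> \<Omega>}"
      using x_pos[of i] ray_mem_\<Omega>_iff[of s] strict_mono_less[OF x(1)] by auto
  qed
  then have "(\<Sum>s | 0 < s \<and> s < x n \<and> of_real s * cis \<theta> \<in> \<Omega>. sqrt (max 0 (e\<^sup>2 - (X - s)\<^sup>2))) = half_circles n e X" for X
    unfolding half_circles_def using strict_mono_imp_inj_on[OF x(1)]
    by (simp add: sum.reindex inj_on_subset)
  then show ?thesis
    unfolding right_path_def c s by (simp add: Let_def mult.commute)
qed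

text \<open>The half-circles have total height at most \<open>n * e\<close> and lie beyond abscissa \<open>x 1 / 2\<close>, so
  the conditions on \<open>n * e\<close> keep the path in the sector.\<close>

definition small :: "nat \<Rightarrow> real \<Rightarrow> bool" where
  "small n e \<longleftrightarrow> 0 < e \<and> (\<forall>i<n. 2 * e < x (Suc i) - x i) \<and>
     real n * e < x 1 / 2 * sin (\<theta> - a) \<and> real n * e < x 1 / 2 * sin (b - \<theta>) \<and>
     e < x 1 / 4 * sin (\<theta> - a) \<and> e < x 1 / 4 * sin (b - \<theta>) \<and> e < x 1 / 4"

lemma eventually_small: "\<forall>\<^sub>F e in at_right 0. small n e"
proof -
  have lt: "\<forall>\<^sub>F e in at_right 0. e < d" if "0 < d" for d :: real
    using that by (rule eventually_at_right_less[THEN eventually_mono, rotated, unfolded not_def] |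
      auto simp: eventually_at_right_field)+
  have ltn: "\<forall>\<^sub>F e in at_right 0. real n * e < d" if "0 < d" for d :: real
  proof -
    have "\<forall>\<^sub>F e in at_right 0. e < d / (real n + 1)" using that by (intro lt) simp
    moreover have "\<forall>\<^sub>F e in at_right (0::real). 0 < e" by (rule eventually_at_right_less)
    ultimately show ?thesis
    proof eventually_elim
      case (elim e)
      then have "(real n + 1) * e < d" by (simp add: field_simps)
      then show ?case using elim(2) by (simp add: algebra_simps)
    qed
  qed
  have gap: "\<forall>\<^sub>F e in at_right 0. \<forall>i<n. 2 * e < x (Suc i) - x i"
  proof -
    have "\<forall>\<^sub>F e in at_right 0. \<forall>i\<in>{..<n}. e < (x (Suc i) - x i) / 2"
      using x_less_Suc by (intro eventually_ball_finite ballI lt) auto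
    then show ?thesis by eventually_elim (auto simp: mult.commute)
  qed
  have "0 < x 1" by (rule x_pos) simp
  then show ?thesis
    unfolding small_def using sin_pos
    by (intro eventually_conj gap eventually_at_right_less lt ltn) auto
qed

lemma half_circles_nonneg: "0 \<le> half_circles n e X"
  unfolding half_circles_def by (intro sum_nonneg) auto

lemma half_circles_le:
  assumes "0 < e" shows "half_circles n e X \<le> real n * e"
proof -
  have "half_circles n e X \<le> (\<Sum>i\<in>{1..<n}. e)"
    unfolding half_circles_def
  proof (rule sum_mono)
    fix i
    have "max 0 (e\<^sup>2 - (X - x i)\<^sup>2) \<le> e\<^sup>2" by simp
    then show "sqrt (max 0 (e\<^sup>2 - (X - x i)\<^sup>2)) \<le> e"
      using assms real_le_lsqrt by (simp add: real_sqrt_le_iff real_le_lsqrt)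
  qed
  also have "\<dots> \<le> real n * e" using assms by simp
  finally show ?thesis .
qed

lemma half_circles_eq_0_iff:
  assumes "0 < e"
  shows "half_circles n e X = 0 \<longleftrightarrow> (\<forall>i\<in>{1..<n}. e \<le> \<bar>X - x i\<bar>)"
proof -
  have "sqrt (max 0 (e\<^sup>2 - (X - x i)\<^sup>2)) = 0 \<longleftrightarrow> e \<le> \<bar>X - x i\<bar>" for i
  proof -
    have "e\<^sup>2 \<le> (X - x i)\<^sup>2 \<longleftrightarrow> e \<le> \<bar>X - x i\<bar>"
      using abs_le_square_iff[of e "X - x i"] assms by simp
    then show ?thesis by (auto simp: max_def)
  qed
  then show ?thesis
    unfolding half_circles_def by (subst sum_nonneg_eq_0_iff) auto
qed

lemma continuous_half_circles: "continuous_on A (half_circles n e)"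
  unfolding half_circles_def by (intro continuous_intros)

lemma x_le_x_n: "i \<le> n \<Longrightarrow> x i \<le> x n"
  using strict_mono_less_eq[OF x(1)] by blast

lemma gap_le:
  assumes "small n e" "i < j" "j \<le> n"
  shows "x i + 2 * e < x j"
proof -
  have "x i + 2 * e < x (Suc i)" using assms unfolding small_def by (simp add: algebra_simps)
  also have "\<dots> \<le> x j" using assms by (intro x_le_x_n) simp
  finally show ?thesis .
qed

text \<open>At depth 0 the point is on the ray at distance at least \<open>e\<close> from every
  singularity, hence inside a gap. At positive depth it lies strictly below the ray and beyond
  \<open>x 1 / 2\<close>, where the sector is deep enough to contain it; there it belongs to every
  slit domain.\<close>

lemma right_path_point:
  assumes n: "0 < n" and e: "small n e" and X: "e \<le> X" "X \<le> x n - e"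
  defines "z \<equiv> Complex X (- half_circles n e X) * cis \<theta>"
  shows "\<exists>k<n. z \<in> slit k" "Im (rot z) \<le> 0"
proof -
  have e0: "0 < e" and X0: "0 < X" using e X unfolding small_def by auto
  show "Im (rot z) \<le> 0" by (simp add: z_def half_circles_nonneg)
  show "\<exists>k<n. z \<in> slit k"
  proof (cases "half_circles n e X = 0")
    case True
    then have dist: "e \<le> \<bar>X - x i\<bar>" if "1 \<le> i" "i < n" for i
      using that half_circles_eq_0_iff[OF e0] by auto
    \<comment> \<open>The index of the last singularity, or the vertex, strictly before
      \<open>X\<close>; it names the gap.\<close>
    define k where "k = (GREATEST k. x k < X)"
    have b: "\<And>k. x k < X \<Longrightarrow> k \<le> n"
    proof (rule ccontr)
      fix k assume "x k < X" "\<not> k \<le> n"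
      then have "x n \<le> x k" by (intro x_le_x_n) simp
      then show False using \<open>x k < X\<close> X e0 by simp
    qed
    have k: "x k < X" unfolding k_def
      by (rule GreatestI_nat[of _ 0 n]) (use b X0 x(2) in auto)
    have kn: "k < n" using x_le_x_n[of n k] k X e0 by (cases "k < n") auto
    have "\<not> x (Suc k) < X"
    proof
      assume "x (Suc k) < X"
      then have "Suc k \<le> k" unfolding k_def by (rule Greatest_le_nat[of _ _ n]) (use b in auto)
      then show False by simp
    qed
    moreover have "x (Suc k) \<noteq> X"
    proof (cases "Suc k < n")
      case True then show ?thesis using dist[of "Suc k"] e0 by auto
    next
      case False
      then have "Suc k = n" using kn by simp
      then show ?thesis using X e0 by auto
    qed
    ultimately have "X < x (Suc k)" by simp
    moreover have "z = of_real X * cis \<theta>" unfolding z_def True by (simp add: complex_of_real_def)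
    ultimately show ?thesis using ray_mem_slit_iff[OF X0] k kn by auto
  next
    case False
    then have pos: "0 < half_circles n e X" using half_circles_nonneg[of n e X] by simp
    obtain i where i: "1 \<le> i" "i < n" "\<bar>X - x i\<bar> < e"
      using False half_circles_eq_0_iff[OF e0] by (auto simp: not_le)
    have "x 1 \<le> x i" using strict_mono_less_eq[OF x(1)] i(1) by blast
    moreover have "e < x 1 / 4" using e unfolding small_def by simp
    ultimately have X1: "x 1 / 2 < X" using i(3) by linarith
    have "half_circles n e X < X * sin (\<theta> - a)" "half_circles n e X < X * sin (b - \<theta>)"
      using half_circles_le[OF e0, of n X] e sin_pos X1 mult_strict_right_mono[OF X1 sin_pos(1)]
       mult_strict_right_mono[OF X1 sin_pos(2)] unfolding small_def by linarith+
    then have "z \<in> S" unfolding z_def using X0 pos by (intro near_ray_mem_S) auto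
    then have "z \<in> Sr" using pos by (simp add: mem_Sr_iff z_def)
    then show ?thesis using Sr_subset_slit[of 0] n by blast
  qed
qed

lemma parameter_bounds:
  assumes n: "0 < n" and e: "small n e" and t: "t \<in> {0..1}"
  shows "e \<le> e + t * (x n - 2 * e)" "e + t * (x n - 2 * e) \<le> x n - e"
proof -
  have "x 0 + 2 * e < x n" using gap_le[OF e n] by simp
  then have p: "0 \<le> x n - 2 * e" using x(2) by simp
  show "e \<le> e + t * (x n - 2 * e)" using p t by simp
  have "t * (x n - 2 * e) \<le> 1 * (x n - 2 * e)" using p t by (intro mult_right_mono) auto
  then show "e + t * (x n - 2 * e) \<le> x n - e" by simp
qed

lemma right_path_in_slits:
  assumes "0 < n" "small n e" "t \<in> {0..1}"
  shows "\<exists>k<n. right_path \<Omega> (of_real (x n) * cis \<theta>) e t \<in> slit k"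
    "Im (rot (right_path \<Omega> (of_real (x n) * cis \<theta>) e t)) \<le> 0"
  unfolding right_path_eq[OF assms(1)]
  using right_path_point[OF assms(1,2)] parameter_bounds[OF assms] by blast+

lemma right_path_ends:
  assumes "0 < n" "small n e"
  shows "pathstart (right_path \<Omega> (of_real (x n) * cis \<theta>) e) = of_real e * cis \<theta>"
    "pathfinish (right_path \<Omega> (of_real (x n) * cis \<theta>) e) = of_real (x n - e) * cis \<theta>"
proof -
  have e0: "0 < e" using assms(2) unfolding small_def by simp
  have "half_circles n e e = 0"
    unfolding half_circles_eq_0_iff[OF e0]
  proof
    fix i assume i: "i \<in> {1..<n}"
    then have "x 0 + 2 * e < x i" using gap_le[OF assms(2), of 0 i] by simp
    then show "e \<le> \<bar>e - x i\<bar>" using x(2) by simp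
  qed
  then show "pathstart (right_path \<Omega> (of_real (x n) * cis \<theta>) e) = of_real e * cis \<theta>"
    unfolding pathstart_def right_path_eq[OF assms(1)] by (simp add: complex_of_real_def)
  have "half_circles n e (x n - e) = 0"
    unfolding half_circles_eq_0_iff[OF e0]
  proof
    fix i assume i: "i \<in> {1..<n}"
    then have "x i + 2 * e < x n" using gap_le[OF assms(2), of i n] by simp
    then show "e \<le> \<bar>x n - e - x i\<bar>" by simp
  qed
  moreover have "e + 1 * (x n - 2 * e) = x n - e" by simp
  ultimately show "pathfinish (right_path \<Omega> (of_real (x n) * cis \<theta>) e) = of_real (x n - e) * cis \<theta>"
    unfolding pathfinish_def right_path_eq[OF assms(1)] by (simp add: complex_of_real_def)
qed

lemma continuous_right_path:
  assumes "0 < n"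
  shows "continuous_on {0..1} (right_path \<Omega> (of_real (x n) * cis \<theta>) e)"
proof -
  have eq: "right_path \<Omega> (of_real (x n) * cis \<theta>) e = (\<lambda>t. (of_real (e + t * (x n - 2 * e)) -
      \<i> * of_real (half_circles n e (e + t * (x n - 2 * e)))) * cis \<theta>)"
    by (rule ext) (simp add: right_path_eq[OF assms] Complex_eq)
  have "continuous_on {0..1} (half_circles n e \<circ> (\<lambda>t. e + t * (x n - 2 * e)))"
    by (intro continuous_on_compose continuous_half_circles continuous_intros)
  then show ?thesis unfolding eq comp_def by (intro continuous_intros)
qed

text \<open>This is the disc of \<open>disc_at\<close>, centred at the end of the path and touching
  the singularity. Inside the slit domain the Taylor series at its centre sums to the branch on the
  whole disc.\<close>

lemma ball_subset_slit:
  assumes "small (Suc k) e"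
  shows "ball (of_real (x (Suc k) - e) * cis \<theta>) e \<subseteq> slit k"
proof
  fix z assume "z \<in> ball (of_real (x (Suc k) - e) * cis \<theta>) e"
  then have "cmod (z - of_real (x (Suc k) - e) * cis \<theta>) < e" by (simp add: dist_norm norm_minus_commute)
  then have d: "cmod (rot z - of_real (x (Suc k) - e)) < e"
    using cmod_rot[of "z - of_real (x (Suc k) - e) * cis \<theta>"] by (simp add: rot_diff)
  have re: "\<bar>Re (rot z) - (x (Suc k) - e)\<bar> < e" and im: "\<bar>Im (rot z)\<bar> < e"
    using le_less_trans[OF abs_Re_le_cmod d] le_less_trans[OF abs_Im_le_cmod d] by simp_all
  have "x 1 \<le> x (Suc k)" by (rule x_le_x_n) simp
  moreover have small: "e < x 1 / 4 * sin (\<theta> - a)" "e < x 1 / 4 * sin (b - \<theta>)" "e < x 1 / 4"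
    using assms unfolding small_def by auto
  ultimately have lo: "x 1 / 4 < Re (rot z)" using re by linarith
  have "e < Re (rot z) * sin (\<theta> - a)" "e < Re (rot z) * sin (b - \<theta>)"
    using small mult_strict_right_mono[OF lo sin_pos(1)] mult_strict_right_mono[OF lo sin_pos(2)] by linarith+
  moreover have "0 < x 1" by (rule x_pos) simp
  ultimately have "Complex (Re (rot z)) (Im (rot z)) * cis \<theta> \<in> S"
    using im lo by (intro near_ray_mem_S) auto
  then have "z \<in> S" using rot_cis[of z] by simp
  moreover have "x k + 2 * e < x (Suc k)" using gap_le[OF assms, of k "Suc k"] by simp
  ultimately show "z \<in> slit k" using re unfolding slit_def by auto
qed

end

context resurgent_sector
begin

text \<open>Each point of the path is assigned a gap index. On the ray the index is forced, and
  below the ray all branches equal \<open>F\<close>, so the assigned branches fit together into a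
  continuation. It starts in gap 0 with the germ and ends in gap \<open>m\<close>, the one just
  before \<open>x n\<close>.\<close>

lemma continuation_along_right_path:
  assumes n: "n = Suc m" and e: "small n e" and r: "ereal e < fps_conv_radius \<phi>"
    "\<And>\<zeta>. \<zeta> \<in> S \<Longrightarrow> cmod \<zeta> < r \<Longrightarrow> branch 0 \<zeta> = eval_fps \<phi> \<zeta>" "e < r"
  defines "g \<equiv> right_path \<Omega> (of_real (x n) * cis \<theta>) e"
  shows "cont g \<phi> = fps_expansion (branch m) (of_real (x n - e) * cis \<theta>)"
proof -
  have n0: "0 < n" using n by simp
  have e0: "0 < e" using e unfolding small_def by simp
  \<comment> \<open>Below the ray every index qualifies; the arbitrary choice is immaterial because
    the branches agree there.\<close>
  define i where "i t = (SOME k. k < n \<and> g t \<in> slit k)" for t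
  have i: "i t < n" "g t \<in> slit (i t)" if "t \<in> {0..1}" for t
  proof -
    have "\<exists>k. k < n \<and> g t \<in> slit k"
      unfolding g_def using right_path_in_slits(1)[OF n0 e that] by blast
    from someI_ex[OF this] show "i t < n" "g t \<in> slit (i t)" unfolding i_def by blast+
  qed
  have im: "Im (rot (g t)) \<le> 0" if "t \<in> {0..1}" for t
    unfolding g_def by (rule right_path_in_slits(2)[OF n0 e that])
  have uniq: "j = k" if "z \<in> slit j" "z \<in> slit k" "Im (rot z) = 0" for z j k
  proof -
    have "x j < x (Suc k)" "x k < x (Suc j)" using that unfolding slit_def by auto
    then show ?thesis using strict_mono_less[OF x(1)] by simp
  qed
  have cont: "continuous_on {0..1} g" unfolding g_def by (rule continuous_right_path[OF n0])
  define G where "G t = fps_expansion (branch (i t)) (g t)" for t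
  have chain: "germ_chain g G"
    unfolding G_def[abs_def]
  proof (rule germ_chain_fps_expansion[OF cont, where U = "\<lambda>t. slit (i t)"])
    show "open (slit (i t)) \<and> g t \<in> slit (i t) \<and> branch (i t) holomorphic_on slit (i t)" if "t \<in> {0..1}" for t
      using open_slit i[OF that] holomorphic_branch by blast
    fix s t :: real assume st: "s \<in> {0..1}" "t \<in> {0..1}" "g s \<in> slit (i t)"
    show "\<forall>\<^sub>F \<zeta> in nhds (g s). branch (i s) \<zeta> = branch (i t) \<zeta>"
    proof (cases "Im (rot (g s)) = 0")
      case True
      then have "i s = i t" using uniq i(2)[OF st(1)] st(3) by blast
      then show ?thesis by simp
    next
      case False
      then have "g s \<in> Sr" using im[OF st(1)] st(3) by (auto simp: mem_Sr_iff slit_def)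
      then have "\<forall>\<^sub>F \<zeta> in nhds (g s). \<zeta> \<in> Sr" using open_Sr by (intro eventually_nhds_in_open)
      then show ?thesis by eventually_elim (simp add: branch_eq)
    qed
  qed
  have g0: "g 0 = of_real e * cis \<theta>" and g1: "g 1 = of_real (x n - e) * cis \<theta>"
    using right_path_ends[OF n0 e] unfolding g_def pathstart_def pathfinish_def by auto
  have i0: "i 0 = 0"
  proof -
    have "x 0 + 2 * e < x 1" using gap_le[OF e, of 0 1] n by simp
    then have "g 0 \<in> slit 0" unfolding g0 ray_mem_slit_iff[OF e0] using e0 x(2) by simp
    moreover have "g 0 \<in> slit (i 0)" using i(2)[of 0] by simp
    moreover have "Im (rot (g 0)) = 0" by (simp add: g0)
    ultimately show ?thesis using uniq by blast
  qed
  have gap: "x m + 2 * e < x n" using gap_le[OF e, of m n] n by simp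
  have i1: "i 1 = m"
  proof -
    have "x n - e < x (Suc m)" using e0 n by simp
    moreover have "x m < x n - e" "0 < x n - e" using gap e0 x_nonneg[of m] by linarith+
    ultimately have "g 1 \<in> slit m" unfolding g1 by (subst ray_mem_slit_iff) auto
    moreover have "g 1 \<in> slit (i 1)" using i(2)[of 1] by simp
    moreover have "Im (rot (g 1)) = 0" by (simp add: g1)
    ultimately show ?thesis using uniq by blast
  qed
  have cg0: "cmod (g 0) = e" using e0 by (simp add: g0 norm_mult)
  have "continuation_along \<phi> g G"
    unfolding continuation_along_iff
  proof (intro conjI chain)
    show "ereal (cmod (g 0)) < fps_conv_radius \<phi>" using cg0 r(1) by simp
    have "g 0 \<in> S \<inter> ball 0 r" using cg0 r(3) i(2)[of 0] by (auto simp: slit_def)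
    then have "\<forall>\<^sub>F \<zeta> in nhds (g 0). \<zeta> \<in> S \<inter> ball 0 r"
      using open_S by (intro eventually_nhds_in_open) auto
    moreover have "\<forall>\<^sub>F \<zeta> in nhds (g 0). eval_fps (G 0) (\<zeta> - g 0) = branch 0 \<zeta>"
      unfolding G_def i0
      by (rule eventually_eval_fps_expansion(1)[OF open_slit holomorphic_branch]) (use i(2)[of 0] i0 in simp)
    ultimately show "\<forall>\<^sub>F \<zeta> in nhds (g 0). eval_fps (G 0) (\<zeta> - g 0) = eval_fps \<phi> \<zeta>"
      by eventually_elim (simp add: r(2))
  qed
  from cont_eq[OF this cont] show ?thesis
    by (simp add: G_def i1 g1)
qed

text \<open>Collects what the definition of a simple resurgent function asks of a path.
  \<open>R\<close> is an extended real because \<open>rho \<Omega>\<close> is one.\<close>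

lemma eventually_right_path:
  assumes "0 < R"
  shows "\<forall>\<^sub>F e in at_right 0. small (Suc k) e \<and>
    path (right_path \<Omega> (of_real (x (Suc k)) * cis \<theta>) e) \<and>
    path_image (right_path \<Omega> (of_real (x (Suc k)) * cis \<theta>) e) \<subseteq> - \<Omega> \<and>
    pathstart (right_path \<Omega> (of_real (x (Suc k)) * cis \<theta>) e) \<in> punctured_disc R \<and>
    pathfinish (right_path \<Omega> (of_real (x (Suc k)) * cis \<theta>) e) = of_real (x (Suc k) - e) * cis \<theta> \<and>
    cont (right_path \<Omega> (of_real (x (Suc k)) * cis \<theta>) e) \<phi>
      = fps_expansion (branch k) (of_real (x (Suc k) - e) * cis \<theta>)"
proof -
  obtain r where r: "0 < r" "\<And>\<zeta>. \<zeta> \<in> S \<Longrightarrow> cmod \<zeta> < r \<Longrightarrow> branch 0 \<zeta> = eval_fps \<phi> \<zeta>"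
    using branch_0 by blast
  obtain r' where r': "0 < ereal r'" "ereal r' < fps_conv_radius \<phi>"
    using radius_pos ereal_dense2 by blast
  obtain R' where R': "0 < ereal R'" "ereal R' < R"
    using assms ereal_dense2 by blast
  have "\<forall>\<^sub>F e in at_right 0. e < min r (min r' R')"
    unfolding eventually_at_right_field using r r' R' by (intro exI[of _ "min r (min r' R')"]) auto
  with eventually_small[of "Suc k"] show ?thesis
  proof eventually_elim
    case (elim e)
    define g where "g = right_path \<Omega> (of_real (x (Suc k)) * cis \<theta>) e"
    have e0: "0 < e" using elim(1) unfolding small_def by simp
    have "path g" unfolding g_def path_def by (rule continuous_right_path) simp
    moreover have "path_image g \<subseteq> - \<Omega>"
      unfolding path_image_def g_def using right_path_in_slits(1)[of "Suc k" e] elim(1) slit_disjoint by blast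
    moreover have "pathstart g \<in> punctured_disc R"
    proof -
      have "ereal e < R" using elim(2) R'(2) less_trans[of "ereal e" "ereal R'"] by simp
      then show ?thesis
        unfolding g_def right_path_ends(1)[OF zero_less_Suc elim(1)] punctured_disc_def
        using e0 by (simp add: norm_mult)
    qed
    moreover have "ereal e < fps_conv_radius \<phi>"
      using elim(2) r'(2) less_trans[of "ereal e" "ereal r'"] by simp
    then have "cont g \<phi> = fps_expansion (branch k) (of_real (x (Suc k) - e) * cis \<theta>)"
      unfolding g_def using continuation_along_right_path[OF refl elim(1) _ r(2)] elim(2) by simp
    ultimately show ?case
      using elim(1) right_path_ends(2)[OF zero_less_Suc elim(1)] unfolding g_def by blast
  qed
qed

end

section \<open>Simple singularities on the ray\<close>

lemma holomorphic_on_shift: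
  fixes f :: "complex \<Rightarrow> complex"
  assumes "f holomorphic_on T" "\<And>\<zeta>. \<zeta> \<in> V \<Longrightarrow> \<omega> + \<zeta> \<in> T"
  shows "(\<lambda>\<zeta>. f (\<omega> + \<zeta>)) holomorphic_on V"
proof -
  have "(f \<circ> (\<lambda>\<zeta>. \<omega> + \<zeta>)) holomorphic_on V"
    by (rule holomorphic_on_compose_gen[OF _ assms(1)]) (use assms(2) in \<open>auto intro!: holomorphic_intros\<close>)
  then show ?thesis by (simp add: comp_def)
qed

context slit_sector
begin

text \<open>With \<open>\<sigma> = -1\<close> the disc is cut along the outgoing ray, which suits
  the branch of the gap before the singularity; with \<open>\<sigma> = 1\<close> along the incoming
  ray, for the gap after it. One formula lets connectedness be proved once.\<close>

definition half_slit_ball :: "real \<Rightarrow> real \<Rightarrow> complex set" where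
  "half_slit_ball \<sigma> \<delta> = {\<zeta> \<in> ball 0 \<delta>. Im (rot \<zeta>) = 0 \<longrightarrow> 0 < \<sigma> * Re (rot \<zeta>)}"

lemma open_half_slit_ball: "open (half_slit_ball \<sigma> \<delta>)"
proof -
  have "closed ({z. Im (rot z) = 0} \<inter> {z. \<sigma> * Re (rot z) \<le> 0})"
    by (intro closed_Int closed_Collect_eq closed_Collect_le continuous_intros)
  moreover have "half_slit_ball \<sigma> \<delta> = ball 0 \<delta> - ({z. Im (rot z) = 0} \<inter> {z. \<sigma> * Re (rot z) \<le> 0})"
    by (auto simp: half_slit_ball_def not_le)
  ultimately show ?thesis by (simp only: open_Diff open_ball)
qed

lemma half_slit_ball_subset: "half_slit_ball \<sigma> \<delta> \<subseteq> ball 0 \<delta>"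
  by (auto simp: half_slit_ball_def)

lemma zero_notin_half_slit_ball: "0 \<notin> half_slit_ball \<sigma> \<delta>"
  by (auto simp: half_slit_ball_def rot_def)

lemma connected_half_slit_ball:
  assumes "\<bar>\<sigma>\<bar> = 1" "0 < \<delta>"
  shows "connected (half_slit_ball \<sigma> \<delta>)"
proof (rule starlike_imp_connected)
  define c where "c = of_real (\<sigma> * (\<delta> / 2)) * cis \<theta>"
  have s2: "\<sigma> * \<sigma> = 1" using assms(1) by (auto simp: abs_if split: if_splits)
  have rc: "rot c = of_real (\<sigma> * (\<delta> / 2))" unfolding c_def by (rule rot_of_cis)
  have nc: "cmod c = \<delta> / 2" using assms by (simp add: c_def norm_mult abs_mult)
  have pos: "\<sigma> * Re (rot c) = \<delta> / 2" unfolding rc using s2 by (simp flip: mult.assoc)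
  have c: "\<sigma> * Re (rot c) > 0" "Im (rot c) = 0"
    unfolding pos using assms by (simp_all add: rc)
  then have c1: "c \<in> half_slit_ball \<sigma> \<delta>"
    using assms nc by (simp add: half_slit_ball_def)
  have "closed_segment c p \<subseteq> half_slit_ball \<sigma> \<delta>" if p: "p \<in> half_slit_ball \<sigma> \<delta>" for p
  proof
    fix z assume z: "z \<in> closed_segment c p"
    then obtain s where s: "0 \<le> s" "s \<le> 1" "z = (1 - s) *\<^sub>R c + s *\<^sub>R p"
      unfolding closed_segment_def by blast
    have "z \<in> ball 0 \<delta>"
      using z c1 p half_slit_ball_subset convex_contains_segment[of "ball 0 \<delta>"] convex_ball by blast
    moreover have rz: "rot z = (1 - s) *\<^sub>R rot c + s *\<^sub>R rot p"
      unfolding s(3) by (simp add: rot_add rot_scaleR)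
    have "0 < \<sigma> * Re (rot z)" if im: "Im (rot z) = 0"
    proof (cases "s = 0")
      case True then show ?thesis using c(1) rz by simp
    next
      case False
      have "s * Im (rot p) = 0" using im c(2) by (simp add: rz)
      then have "0 < \<sigma> * Re (rot p)" using p False by (simp add: half_slit_ball_def)
      then have "0 < s * (\<sigma> * Re (rot p))" "0 \<le> (1 - s) * (\<sigma> * Re (rot c))"
        using s False c(1) by simp_all
      moreover have "\<sigma> * Re (rot z) = (1 - s) * (\<sigma> * Re (rot c)) + s * (\<sigma> * Re (rot p))"
        unfolding rz by (simp add: algebra_simps)
      ultimately show ?thesis by linarith
    qed
    ultimately show "z \<in> half_slit_ball \<sigma> \<delta>" by (simp add: half_slit_ball_def)
  qed
  then show "starlike (half_slit_ball \<sigma> \<delta>)" using c1 unfolding starlike_def by blast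
qed

text \<open>Up to additive constants, these are the branches of the logarithm cut along the outgoing and
  along the incoming ray. They agree below the ray and differ by \<open>2 * pi * \<i>\<close> above it; this
  monodromy turns \<open>eval_fps \<psi>\<close> into the jump between consecutive branches.\<close>

definition log_right :: "complex \<Rightarrow> complex" where "log_right \<zeta> = Ln (- rot \<zeta>)"
definition log_left :: "complex \<Rightarrow> complex" where "log_left \<zeta> = Ln (rot \<zeta>) + \<i> * of_real pi"

lemma log_left_eq_below: "Im (rot \<zeta>) < 0 \<Longrightarrow> log_left \<zeta> = log_right \<zeta>"
  by (subst log_right_def, subst Ln_minus) (auto simp: log_left_def)

lemma log_left_eq_above: "0 < Im (rot \<zeta>) \<Longrightarrow> log_left \<zeta> = log_right \<zeta> + 2 * of_real pi * \<i>"
  by (subst log_right_def, subst Ln_minus) (auto simp: log_left_def)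

lemma rot_notin_nonpos:
  assumes "\<zeta> \<in> half_slit_ball \<sigma> \<delta>"
  shows "\<sigma> = -1 \<Longrightarrow> - rot \<zeta> \<notin> \<real>\<^sub>\<le>\<^sub>0" "\<sigma> = 1 \<Longrightarrow> rot \<zeta> \<notin> \<real>\<^sub>\<le>\<^sub>0"
  using assms by (auto simp: half_slit_ball_def complex_nonpos_Reals_iff)

lemma rot_has_field_derivative: "(rot has_field_derivative cis (- \<theta>)) (at \<zeta>)"
  unfolding rot_def[abs_def] by (auto intro!: derivative_eq_intros)

lemma log_right_derivative:
  assumes "- rot \<zeta> \<notin> \<real>\<^sub>\<le>\<^sub>0"
  shows "(log_right has_field_derivative 1 / \<zeta>) (at \<zeta>)"
proof -
  have "((\<lambda>\<zeta>. - rot \<zeta>) has_field_derivative - cis (- \<theta>)) (at \<zeta>)"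
    by (rule DERIV_minus[OF rot_has_field_derivative])
  from DERIV_chain2[OF has_field_derivative_Ln[OF assms] this]
  have "((\<lambda>\<zeta>. Ln (- rot \<zeta>)) has_field_derivative inverse (- rot \<zeta>) * - cis (- \<theta>)) (at \<zeta>)" .
  moreover have "inverse (- rot \<zeta>) * - cis (- \<theta>) = 1 / \<zeta>"
    by (simp add: rot_def field_simps)
  ultimately show ?thesis unfolding log_right_def[abs_def] by simp
qed

lemma log_left_derivative:
  assumes "rot \<zeta> \<notin> \<real>\<^sub>\<le>\<^sub>0"
  shows "(log_left has_field_derivative 1 / \<zeta>) (at \<zeta>)"
proof -
  from DERIV_chain2[OF has_field_derivative_Ln[OF assms] rot_has_field_derivative]
  have "((\<lambda>\<zeta>. Ln (rot \<zeta>)) has_field_derivative inverse (rot \<zeta>) * cis (- \<theta>)) (at \<zeta>)" .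
  moreover have "inverse (rot \<zeta>) * cis (- \<theta>) = 1 / \<zeta>"
    by (simp add: rot_def field_simps)
  ultimately have "((\<lambda>\<zeta>. Ln (rot \<zeta>) + \<i> * of_real pi) has_field_derivative 1 / \<zeta> + 0) (at \<zeta>)"
    by (intro DERIV_add DERIV_const) simp
  then show ?thesis unfolding log_left_def[abs_def] by simp
qed

text \<open>The definition allows any logarithm on the disc. Its difference from
  \<open>log_right\<close> has the constant exponential \<open>- cis \<theta>\<close>, hence is
  itself constant; multiplied by the minor it is absorbed into the regular part.\<close>

lemma simple_singularity_log_right:
  assumes "has_simple_singularity f (ball (- (of_real e * cis \<theta>)) e) (A, \<psi>)" "0 < e"
  obtains r where "0 < fps_conv_radius r"
    "\<forall>\<^sub>F \<zeta> in at 0 within ball (- (of_real e * cis \<theta>)) e.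
       f \<zeta> = A / (2 * of_real pi * \<i> * \<zeta>) + eval_fps \<psi> \<zeta> * log_right \<zeta> / (2 * of_real pi * \<i>) + eval_fps r \<zeta>"
proof -
  define D where "D = ball (- (of_real e * cis \<theta>)) e"
  obtain r l where rl: "0 < fps_conv_radius \<psi>" "0 < fps_conv_radius r" "l holomorphic_on D"
    "\<And>\<zeta>. \<zeta> \<in> D \<Longrightarrow> exp (l \<zeta>) = \<zeta>"
    and ev: "\<forall>\<^sub>F \<zeta> in at 0 within D. f \<zeta> = A / (2 * of_real pi * \<i> * \<zeta>)
               + eval_fps \<psi> \<zeta> * l \<zeta> / (2 * of_real pi * \<i>) + eval_fps r \<zeta>"
    using assms(1) unfolding has_simple_singularity_def D_def by auto
  have D: "- rot \<zeta> \<notin> \<real>\<^sub>\<le>\<^sub>0" "\<zeta> \<noteq> 0" if "\<zeta> \<in> D" for \<zeta>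
  proof -
    have "cmod (\<zeta> - - (of_real e * cis \<theta>)) < e" using that by (simp add: D_def dist_norm norm_minus_commute)
    moreover have "rot (\<zeta> - - (of_real e * cis \<theta>)) = rot \<zeta> - - of_real e"
      by (simp add: rot_add)
    ultimately have "cmod (rot \<zeta> - - of_real e) < e"
      by (metis cmod_rot)
    then have "\<bar>Re (rot \<zeta> - - of_real e)\<bar> < e" using abs_Re_le_cmod le_less_trans by blast
    then have "Re (rot \<zeta>) < 0" by simp
    then show "- rot \<zeta> \<notin> \<real>\<^sub>\<le>\<^sub>0" "\<zeta> \<noteq> 0" by (auto simp: complex_nonpos_Reals_iff rot_def)
  qed
  define h where "h \<zeta> = l \<zeta> - log_right \<zeta>" for \<zeta>
  have exph: "exp (h \<zeta>) = - cis \<theta>" if "\<zeta> \<in> D" for \<zeta>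
  proof -
    have "rot \<zeta> \<noteq> 0" using D(2)[OF that] by (simp add: rot_def)
    then have "exp (h \<zeta>) = \<zeta> / (- rot \<zeta>)"
      unfolding h_def log_right_def exp_diff using rl(4)[OF that] by simp
    also have "\<dots> = - cis \<theta>"
      using D(2)[OF that] by (simp add: rot_def field_simps cis_mult)
    finally show ?thesis .
  qed
  have "\<exists>c. \<forall>\<zeta>\<in>D. h \<zeta> = c"
  proof (rule has_field_derivative_zero_constant)
    show "convex D" by (simp add: D_def)
    fix \<zeta> assume \<zeta>: "\<zeta> \<in> D"
    have oD: "open D" by (simp add: D_def)
    obtain l' where l': "(l has_field_derivative l') (at \<zeta>)"
      using rl(3) \<zeta> oD holomorphic_on_open by blast
    have h': "(h has_field_derivative l' - 1 / \<zeta>) (at \<zeta>)"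
      unfolding h_def[abs_def] by (rule DERIV_diff[OF l' log_right_derivative[OF D(1)[OF \<zeta>]]])
    then have e1: "((\<lambda>\<zeta>. exp (h \<zeta>)) has_field_derivative exp (h \<zeta>) * (l' - 1 / \<zeta>)) (at \<zeta>)"
      by (rule DERIV_chain2[OF DERIV_exp])
    have "((\<lambda>\<zeta>. exp (h \<zeta>)) has_field_derivative 0) (at \<zeta>)"
    proof (rule has_field_derivative_transform_within_open[OF DERIV_const oD \<zeta>])
      show "- cis \<theta> = exp (h \<xi>)" if "\<xi> \<in> D" for \<xi> using exph[OF that] by simp
    qed
    from DERIV_unique[OF e1 this] have "l' - 1 / \<zeta> = 0" by simp
    then show "(h has_field_derivative 0) (at \<zeta> within D)"
      using h' has_field_derivative_at_within by force
  qed
  then obtain c where c: "\<And>\<zeta>. \<zeta> \<in> D \<Longrightarrow> l \<zeta> = log_right \<zeta> + c" by (force simp: h_def algebra_simps)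
  define r' where "r' = r + fps_const (c / (2 * of_real pi * \<i>)) * \<psi>"
  have cr: "fps_conv_radius \<psi> \<le> fps_conv_radius (fps_const (c / (2 * of_real pi * \<i>)) * \<psi>)"
    using fps_conv_radius_mult[of "fps_const (c / (2 * of_real pi * \<i>))" \<psi>] by simp
  have "min (fps_conv_radius r) (fps_conv_radius (fps_const (c / (2 * of_real pi * \<i>)) * \<psi>)) \<le> fps_conv_radius r'"
    unfolding r'_def by (rule fps_conv_radius_add)
  moreover have "0 < min (fps_conv_radius r) (fps_conv_radius (fps_const (c / (2 * of_real pi * \<i>)) * \<psi>))"
    using rl(1,2) cr by auto
  ultimately have r'0: "0 < fps_conv_radius r'" by order
  obtain d where d: "0 < ereal d" "ereal d < min (fps_conv_radius \<psi>) (fps_conv_radius r)"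
    using ereal_dense2[of 0 "min (fps_conv_radius \<psi>) (fps_conv_radius r)"] rl(1,2) by auto
  have "\<forall>\<^sub>F \<zeta> in at 0 within D. \<zeta> \<in> D \<and> cmod \<zeta> < d"
    unfolding eventually_at using d(1) by (intro exI[of _ d]) auto
  with ev have "\<forall>\<^sub>F \<zeta> in at 0 within D. f \<zeta> = A / (2 * of_real pi * \<i> * \<zeta>)
      + eval_fps \<psi> \<zeta> * log_right \<zeta> / (2 * of_real pi * \<i>) + eval_fps r' \<zeta>"
  proof eventually_elim
    case (elim \<zeta>)
    have n: "ereal (cmod \<zeta>) < fps_conv_radius \<psi>" "ereal (cmod \<zeta>) < fps_conv_radius r"
      using elim(2) d(2) less_trans[of "ereal (cmod \<zeta>)" "ereal d"] by auto
    have "eval_fps r' \<zeta> = eval_fps r \<zeta> + eval_fps (fps_const (c / (2 * of_real pi * \<i>)) * \<psi>) \<zeta>"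
      unfolding r'_def by (rule eval_fps_add) (use n cr in auto)
    also have "eval_fps (fps_const (c / (2 * of_real pi * \<i>)) * \<psi>) \<zeta> = c / (2 * of_real pi * \<i>) * eval_fps \<psi> \<zeta>"
      by (subst eval_fps_mult) (use n in auto)
    finally show ?case using elim c[of \<zeta>] by (simp add: field_simps)
  qed
  then show thesis using that[OF r'0] unfolding D_def by blast
qed

end

section \<open>Consecutive branches at the singularity between them\<close>

context resurgent_sector
begin

text \<open>The expansion, given on a disc touching the singularity, spreads over the disc cut along
  the outgoing ray. Below the ray both branches equal \<open>F\<close> and both logarithms agree, so
  the same coefficients describe the next branch on the disc cut along the incoming ray.\<close>

lemma singular_expansion:
  assumes sing: "has_simple_singularity (\<lambda>\<zeta>. branch k (of_real (x (Suc k)) * cis \<theta> + \<zeta>))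
      (ball (- (of_real e * cis \<theta>)) e) (A, \<psi>)" and e: "0 < e"
  obtains \<delta> r where "0 < \<delta>" "ereal \<delta> \<le> fps_conv_radius \<psi>" "r holomorphic_on ball 0 \<delta>"
    "ball (of_real (x (Suc k)) * cis \<theta>) \<delta> \<subseteq> S"
    "\<And>\<zeta>. \<zeta> \<in> half_slit_ball (-1) \<delta> \<Longrightarrow> of_real (x (Suc k)) * cis \<theta> + \<zeta> \<in> slit k \<and>
      branch k (of_real (x (Suc k)) * cis \<theta> + \<zeta>) =
      A / (2 * of_real pi * \<i> * \<zeta>) + eval_fps \<psi> \<zeta> * log_right \<zeta> / (2 * of_real pi * \<i>) + r \<zeta>"
    "\<And>\<zeta>. \<zeta> \<in> half_slit_ball 1 \<delta> \<Longrightarrow> of_real (x (Suc k)) * cis \<theta> + \<zeta> \<in> slit (Suc k) \<and>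
      branch (Suc k) (of_real (x (Suc k)) * cis \<theta> + \<zeta>) =
      A / (2 * of_real pi * \<i> * \<zeta>) + eval_fps \<psi> \<zeta> * log_left \<zeta> / (2 * of_real pi * \<i>) + r \<zeta>"
proof -
  define \<omega> where "\<omega> = of_real (x (Suc k)) * cis \<theta>"
  define c :: complex where "c = 2 * of_real pi * \<i>"
  define D where "D = ball (- (of_real e * cis \<theta>)) e"
  have rad\<psi>: "0 < fps_conv_radius \<psi>" using sing by (simp add: has_simple_singularity_def)
  obtain R where R: "0 < fps_conv_radius R"
    "\<forall>\<^sub>F \<zeta> in at 0 within D. branch k (\<omega> + \<zeta>) = A / (c * \<zeta>) + eval_fps \<psi> \<zeta> * log_right \<zeta> / c + eval_fps R \<zeta>"
    using simple_singularity_log_right[OF sing e] unfolding \<omega>_def c_def D_def by blast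
  obtain d0 where d0: "0 < ereal d0" "ereal d0 < min (fps_conv_radius \<psi>) (fps_conv_radius R)"
    using ereal_dense2[of 0 "min (fps_conv_radius \<psi>) (fps_conv_radius R)"] rad\<psi> R(1) by auto
  have "\<omega> \<in> S" unfolding \<omega>_def by (intro ray_mem_S x_pos) simp
  then obtain d1 where d1: "0 < d1" "ball \<omega> d1 \<subseteq> S" using open_S openE by blast
  \<comment> \<open>Small enough for both power series to converge, for the ball to stay in the
    sector, and for it to meet the ray only in the two adjacent gaps and the singularity.\<close>
  define \<delta> where "\<delta> = min (min d0 d1) (min (x (Suc k) - x k) (x (Suc (Suc k)) - x (Suc k)))"
  have \<delta>: "0 < \<delta>" "\<delta> \<le> d0" "\<delta> \<le> d1" "\<delta> \<le> x (Suc k) - x k" "\<delta> \<le> x (Suc (Suc k)) - x (Suc k)"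
    using d0 d1 x_less_Suc by (auto simp: \<delta>_def)
  have rad: "ereal \<delta> \<le> fps_conv_radius \<psi>" "ereal \<delta> \<le> fps_conv_radius R"
    using \<delta>(2) d0(2) by (auto intro: order_trans[of _ "ereal d0"] simp: less_imp_le)
  have inS: "\<omega> + \<zeta> \<in> S" if "\<zeta> \<in> ball 0 \<delta>" for \<zeta>
    using that d1 \<delta>(3) by (intro subsetD[OF d1(2)]) (simp add: dist_norm)
  have rot\<omega>: "rot (\<omega> + \<zeta>) = of_real (x (Suc k)) + rot \<zeta>" for \<zeta>
    by (simp add: rot_add \<omega>_def)
  have re: "\<bar>Re (rot \<zeta>)\<bar> < \<delta>" if "\<zeta> \<in> ball 0 \<delta>" for \<zeta>
    using that abs_Re_le_cmod[of "rot \<zeta>"] by simp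
  define V where "V = half_slit_ball (-1) \<delta>"
  define W where "W = half_slit_ball 1 \<delta>"
  have Vb: "V \<subseteq> ball 0 \<delta>" and Wb: "W \<subseteq> ball 0 \<delta>" and V0: "0 \<notin> V" and W0: "0 \<notin> W"
    unfolding V_def W_def using half_slit_ball_subset zero_notin_half_slit_ball by blast+
  have V: "open V" "connected V" and W: "open W" "connected W"
    unfolding V_def W_def using \<delta> by (auto intro!: open_half_slit_ball connected_half_slit_ball)
  have Vs: "\<omega> + \<zeta> \<in> slit k" if "\<zeta> \<in> V" for \<zeta>
    using that inS[of \<zeta>] re[of \<zeta>] \<delta>(4) unfolding slit_def V_def half_slit_ball_def
    by (auto simp: rot\<omega>)
  have Ws: "\<omega> + \<zeta> \<in> slit (Suc k)" if "\<zeta> \<in> W" for \<zeta>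
    using that inS[of \<zeta>] re[of \<zeta>] \<delta>(5) unfolding slit_def W_def half_slit_ball_def
    by (auto simp: rot\<omega>)
  have hV: "(\<lambda>\<zeta>. branch k (\<omega> + \<zeta>)) holomorphic_on V"
    using Vs by (rule holomorphic_on_shift[OF holomorphic_branch])
  have hW: "(\<lambda>\<zeta>. branch (Suc k) (\<omega> + \<zeta>)) holomorphic_on W"
    using Ws by (rule holomorphic_on_shift[OF holomorphic_branch])
  have h\<psi>: "eval_fps \<psi> holomorphic_on ball 0 \<delta>" and hR: "eval_fps R holomorphic_on ball 0 \<delta>"
    using rad holomorphic_on_eval_fps_ball by blast+
  have c0: "c \<noteq> 0" by (simp add: c_def)
  have logV: "log_right holomorphic_on V"
  proof (rule iffD2[OF holomorphic_on_open[OF V(1)]], rule ballI)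
    fix \<zeta> assume "\<zeta> \<in> V"
    then have "(log_right has_field_derivative 1 / \<zeta>) (at \<zeta>)"
      unfolding V_def by (intro log_right_derivative rot_notin_nonpos(1)[of \<zeta> "-1" \<delta>]) auto
    then show "\<exists>f'. (log_right has_field_derivative f') (at \<zeta>)" ..
  qed
  have logW: "log_left holomorphic_on W"
  proof (rule iffD2[OF holomorphic_on_open[OF W(1)]], rule ballI)
    fix \<zeta> assume "\<zeta> \<in> W"
    then have "(log_left has_field_derivative 1 / \<zeta>) (at \<zeta>)"
      unfolding W_def by (intro log_left_derivative rot_notin_nonpos(2)[of \<zeta> 1 \<delta>]) auto
    then show "\<exists>f'. (log_left has_field_derivative f') (at \<zeta>)" ..
  qed
  define s1 where "s1 \<zeta> = A / (c * \<zeta>) + eval_fps \<psi> \<zeta> * log_right \<zeta> / c + eval_fps R \<zeta>" for \<zeta>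
  define s2 where "s2 \<zeta> = A / (c * \<zeta>) + eval_fps \<psi> \<zeta> * log_left \<zeta> / c + eval_fps R \<zeta>" for \<zeta>
  have hs1: "s1 holomorphic_on V"
    unfolding s1_def[abs_def] using c0 V0
    by (intro holomorphic_intros logV holomorphic_on_subset[OF h\<psi> Vb] holomorphic_on_subset[OF hR Vb]) auto
  have hs2: "s2 holomorphic_on W"
    unfolding s2_def[abs_def] using c0 W0
    by (intro holomorphic_intros logW holomorphic_on_subset[OF h\<psi> Wb] holomorphic_on_subset[OF hR Wb]) auto
  have eq1: "branch k (\<omega> + \<zeta>) = s1 \<zeta>" if "\<zeta> \<in> V" for \<zeta>
  proof -
    obtain d where d: "0 < d" "\<And>\<zeta>. \<zeta> \<in> D \<Longrightarrow> \<zeta> \<noteq> 0 \<Longrightarrow> dist \<zeta> 0 < d \<Longrightarrow> branch k (\<omega> + \<zeta>) = s1 \<zeta>"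
      using R(2) unfolding s1_def eventually_at by blast
    define \<tau> where "\<tau> = min d (min e \<delta>) / 2"
    have \<tau>: "0 < \<tau>" "\<tau> < d" "\<tau> < e" "\<tau> < \<delta>" using d e \<delta> by (auto simp: \<tau>_def)
    define p where "p = of_real (- \<tau>) * cis \<theta>"
    have np: "cmod p = \<tau>" using \<tau> by (simp add: p_def norm_mult)
    have "p - - (of_real e * cis \<theta>) = of_real (e - \<tau>) * cis \<theta>" by (simp add: p_def algebra_simps)
    then have "cmod (p - - (of_real e * cis \<theta>)) = e - \<tau>" using \<tau> by (simp add: norm_mult del: of_real_diff)
    then have pD: "p \<in> D" using \<tau> by (simp add: D_def dist_norm norm_minus_commute)
    have rp: "rot p = of_real (- \<tau>)" unfolding p_def by (rule rot_of_cis)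
    have pV: "p \<in> V" using np \<tau> by (simp add: V_def half_slit_ball_def rp)
    have "p \<noteq> 0" using np \<tau> by auto
    then have "\<forall>\<^sub>F \<zeta> in nhds p. \<zeta> \<in> D \<inter> (ball 0 d - {0})"
      using pD np \<tau> by (intro eventually_nhds_in_open) (auto simp: D_def)
    then have "\<forall>\<^sub>F \<zeta> in nhds p. branch k (\<omega> + \<zeta>) = s1 \<zeta>"
      by eventually_elim (use d(2) in auto)
    from holomorphic_eq_on_connected[OF V hV hs1 this pV that] show ?thesis .
  qed
  have eq2: "branch (Suc k) (\<omega> + \<zeta>) = s2 \<zeta>" if "\<zeta> \<in> W" for \<zeta>
  proof -
    define p where "p = (- (\<i> * of_real (\<delta> / 2))) * cis \<theta>"
    have rp: "rot p = - (\<i> * of_real (\<delta> / 2))" unfolding p_def by (rule rot_of_cis)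
    have np: "cmod p = \<delta> / 2" using \<delta>(1) by (simp add: p_def norm_mult)
    have pW: "p \<in> W" using np \<delta>(1) by (simp add: W_def half_slit_ball_def rp)
    have op: "open {\<zeta> \<in> ball 0 \<delta>. Im (rot \<zeta>) < 0}"
    proof -
      have "{\<zeta> \<in> ball 0 \<delta>. Im (rot \<zeta>) < 0} = ball 0 \<delta> \<inter> {\<zeta>. Im (rot \<zeta>) < 0}" by auto
      also have "open \<dots>" by (intro open_Int open_ball open_Collect_less continuous_intros)
      finally show ?thesis .
    qed
    have "\<forall>\<^sub>F \<zeta> in nhds p. \<zeta> \<in> {\<zeta> \<in> ball 0 \<delta>. Im (rot \<zeta>) < 0}"
      using np \<delta>(1) by (intro eventually_nhds_in_open op) (simp add: rp)
    then have "\<forall>\<^sub>F \<zeta> in nhds p. branch (Suc k) (\<omega> + \<zeta>) = s2 \<zeta>"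
    proof eventually_elim
      case (elim \<zeta>)
      then have "\<omega> + \<zeta> \<in> Sr" using inS[of \<zeta>] by (simp add: mem_Sr_iff rot\<omega>)
      then have "branch (Suc k) (\<omega> + \<zeta>) = branch k (\<omega> + \<zeta>)" by (simp add: branch_eq)
      also have "\<dots> = s1 \<zeta>" using elim by (intro eq1) (auto simp: V_def half_slit_ball_def)
      also have "\<dots> = s2 \<zeta>" using elim log_left_eq_below by (simp add: s1_def s2_def)
      finally show ?case .
    qed
    from holomorphic_eq_on_connected[OF W hW hs2 this pW that] show ?thesis .
  qed
  show thesis
  proof (rule that[OF \<delta>(1) rad(1) hR])
    show "ball (of_real (x (Suc k)) * cis \<theta>) \<delta> \<subseteq> S"
      using d1(2) \<delta>(3) unfolding \<omega>_def by (meson order_trans subset_ball)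
  qed (use eq1 eq2 Vs Ws in \<open>auto simp: V_def W_def \<omega>_def s1_def s2_def c_def\<close>)
qed

lemma upper_half_ball_nonempty:
  assumes "0 < (\<delta>::real)"
  obtains p where "cmod p < \<delta>" "0 < Im (rot p)" "\<forall>\<^sub>F \<zeta> in nhds p. cmod \<zeta> < \<delta> \<and> 0 < Im (rot \<zeta>)"
proof -
  define p where "p = (\<i> * of_real (\<delta> / 2)) * cis \<theta>"
  have rp: "rot p = \<i> * of_real (\<delta> / 2)" unfolding p_def by (rule rot_of_cis)
  have np: "cmod p = \<delta> / 2" using assms by (simp add: p_def norm_mult)
  have "open (ball 0 \<delta> \<inter> {\<zeta>. 0 < Im (rot \<zeta>)})"
    by (intro open_Int open_ball open_Collect_less continuous_intros)
  then have "\<forall>\<^sub>F \<zeta> in nhds p. \<zeta> \<in> ball 0 \<delta> \<inter> {\<zeta>. 0 < Im (rot \<zeta>)}"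
    using np assms by (intro eventually_nhds_in_open) (auto simp: rp)
  then have "\<forall>\<^sub>F \<zeta> in nhds p. cmod \<zeta> < \<delta> \<and> 0 < Im (rot \<zeta>)"
    by eventually_elim auto
  then show thesis using that[of p] np rp assms by simp
qed

text \<open>The minor is recovered as the jump between two consecutive branches above the ray; then
  the polar coefficient is recovered as a limit at the singularity. Allowing different radii gives
  the independence of the radius asked for in \<open>Delta_plus\<close>.\<close>

lemma singularity_unique:
  assumes "has_simple_singularity (\<lambda>\<zeta>. branch k (of_real (x (Suc k)) * cis \<theta> + \<zeta>))
      (ball (- (of_real e * cis \<theta>)) e) T" "0 < e"
    and "has_simple_singularity (\<lambda>\<zeta>. branch k (of_real (x (Suc k)) * cis \<theta> + \<zeta>))
      (ball (- (of_real e' * cis \<theta>)) e') T'" "0 < e'"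
  shows "T = T'"
proof -
  obtain A \<psi> A' \<psi>' where T: "T = (A, \<psi>)" "T' = (A', \<psi>')" by (metis prod.exhaust)
  define \<omega> where "\<omega> = of_real (x (Suc k)) * cis \<theta>"
  define c :: complex where "c = 2 * of_real pi * \<i>"
  have c0: "c \<noteq> 0" by (simp add: c_def)
  obtain \<delta> r where 1: "0 < \<delta>" "ereal \<delta> \<le> fps_conv_radius \<psi>" "r holomorphic_on ball 0 \<delta>"
    "\<And>\<zeta>. \<zeta> \<in> half_slit_ball (-1) \<delta> \<Longrightarrow> branch k (\<omega> + \<zeta>) =
      A / (c * \<zeta>) + eval_fps \<psi> \<zeta> * log_right \<zeta> / c + r \<zeta>"
    "\<And>\<zeta>. \<zeta> \<in> half_slit_ball 1 \<delta> \<Longrightarrow> branch (Suc k) (\<omega> + \<zeta>) =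
      A / (c * \<zeta>) + eval_fps \<psi> \<zeta> * log_left \<zeta> / c + r \<zeta>"
    using singular_expansion[OF assms(1,2)[unfolded T]] unfolding \<omega>_def c_def by metis
  obtain \<delta>' r' where 2: "0 < \<delta>'" "ereal \<delta>' \<le> fps_conv_radius \<psi>'" "r' holomorphic_on ball 0 \<delta>'"
    "\<And>\<zeta>. \<zeta> \<in> half_slit_ball (-1) \<delta>' \<Longrightarrow> branch k (\<omega> + \<zeta>) =
      A' / (c * \<zeta>) + eval_fps \<psi>' \<zeta> * log_right \<zeta> / c + r' \<zeta>"
    "\<And>\<zeta>. \<zeta> \<in> half_slit_ball 1 \<delta>' \<Longrightarrow> branch (Suc k) (\<omega> + \<zeta>) =
      A' / (c * \<zeta>) + eval_fps \<psi>' \<zeta> * log_left \<zeta> / c + r' \<zeta>"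
    using singular_expansion[OF assms(3,4)[unfolded T]] unfolding \<omega>_def c_def by metis
  define d where "d = min \<delta> \<delta>'"
  have d: "0 < d" "d \<le> \<delta>" "d \<le> \<delta>'" using 1(1) 2(1) by (auto simp: d_def)
  have mem: "\<zeta> \<in> half_slit_ball \<sigma> \<delta>" "\<zeta> \<in> half_slit_ball \<sigma> \<delta>'"
    if "cmod \<zeta> < d" "Im (rot \<zeta>) = 0 \<Longrightarrow> 0 < \<sigma> * Re (rot \<zeta>)" for \<zeta> \<sigma>
    using that d by (auto simp: half_slit_ball_def)
  obtain p where p: "cmod p < d" "\<forall>\<^sub>F \<zeta> in nhds p. cmod \<zeta> < d \<and> 0 < Im (rot \<zeta>)"
    using upper_half_ball_nonempty[OF d(1)] by blast
  have "\<forall>\<^sub>F \<zeta> in nhds p. eval_fps \<psi> \<zeta> = eval_fps \<psi>' \<zeta>"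
    using p(2)
  proof eventually_elim
    case (elim \<zeta>)
    have "branch (Suc k) (\<omega> + \<zeta>) - branch k (\<omega> + \<zeta>) = eval_fps \<psi> \<zeta> * (log_left \<zeta> - log_right \<zeta>) / c"
      using 1(4)[OF mem(1)] 1(5)[OF mem(1)] elim by (simp add: diff_divide_distrib right_diff_distrib)
    moreover have "branch (Suc k) (\<omega> + \<zeta>) - branch k (\<omega> + \<zeta>) = eval_fps \<psi>' \<zeta> * (log_left \<zeta> - log_right \<zeta>) / c"
      using 2(4)[OF mem(2)] 2(5)[OF mem(2)] elim by (simp add: diff_divide_distrib right_diff_distrib)
    moreover have "log_left \<zeta> - log_right \<zeta> = c" using elim log_left_eq_above[of \<zeta>] by (simp add: c_def)
    ultimately show ?case using c0 by simp
  qed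
  moreover have "eval_fps \<psi> holomorphic_on ball 0 d" "eval_fps \<psi>' holomorphic_on ball 0 d"
    using 1(2) 2(2) d by (auto intro!: holomorphic_on_eval_fps_ball intro: order_trans[of _ "ereal \<delta>"] order_trans[of _ "ereal \<delta>'"])
  ultimately have eqb: "eval_fps \<psi> \<zeta> = eval_fps \<psi>' \<zeta>" if "cmod \<zeta> < d" for \<zeta>
    using holomorphic_eq_on_connected[of "ball 0 d" "eval_fps \<psi>" "eval_fps \<psi>'" p \<zeta>] p(1) that by simp
  have "\<psi> = \<psi>'"
  proof (rule eval_fps_eqD)
    show "0 < fps_conv_radius \<psi>" "0 < fps_conv_radius \<psi>'"
      using assms(1,3) by (auto simp: has_simple_singularity_def T)
    have "\<forall>\<^sub>F \<zeta> in nhds 0. \<zeta> \<in> ball 0 d" using d by (intro eventually_nhds_in_open) auto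
    then show "\<forall>\<^sub>F \<zeta> in nhds 0. eval_fps \<psi> \<zeta> = eval_fps \<psi>' \<zeta>"
      by eventually_elim (simp add: eqb)
  qed
  moreover have "A = A'"
  proof -
    \<comment> \<open>Once the minors agree, \<open>A - A'\<close> equals \<open>\<zeta>\<close>
      times a bounded function near 0 on the incoming ray.\<close>
    define B where "B \<zeta> = \<zeta> * (c * (r' \<zeta> - r \<zeta>))" for \<zeta>
    have "isCont r 0" "isCont r' 0"
      using 1(1,3) 2(1,3) continuous_on_interior[OF holomorphic_on_imp_continuous_on]
      by (metis centre_in_ball interior_ball)+
    then have "isCont B 0" unfolding B_def by (intro continuous_intros)
    then have "B \<midarrow>0\<rightarrow> 0" by (simp add: isCont_def B_def)
    moreover have "filterlim (\<lambda>t. of_real (- t) * cis \<theta>) (at 0) (at_right 0)"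
      unfolding filterlim_at
    proof
      show "\<forall>\<^sub>F t in at_right 0. complex_of_real (- t) * cis \<theta> \<in> UNIV \<and> complex_of_real (- t) * cis \<theta> \<noteq> 0"
        by (rule eventually_mono[OF eventually_at_right_less]) auto
      have "((\<lambda>t. of_real (- t) * cis \<theta>) \<longlongrightarrow> of_real (- 0) * cis \<theta>) (at_right 0)"
        by (intro tendsto_intros)
      then show "((\<lambda>t. of_real (- t) * cis \<theta>) \<longlongrightarrow> 0) (at_right 0)" by simp
    qed
    ultimately have "((\<lambda>t. B (of_real (- t) * cis \<theta>)) \<longlongrightarrow> 0) (at_right 0)"
      by (rule filterlim_compose)
    moreover have "\<forall>\<^sub>F t in at_right 0. B (of_real (- t) * cis \<theta>) = A - A'"
    proof -
      have "\<forall>\<^sub>F t in at_right 0. t < d" using d(1) by (auto simp: eventually_at_right_field)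
      moreover have "\<forall>\<^sub>F t in at_right (0::real). 0 < t" by (rule eventually_at_right_less)
      ultimately show ?thesis
      proof eventually_elim
        case (elim t)
        define \<zeta> where "\<zeta> = of_real (- t) * cis \<theta>"
        have \<zeta>: "cmod \<zeta> < d" "rot \<zeta> = of_real (- t)" "\<zeta> \<noteq> 0"
          using elim unfolding \<zeta>_def rot_of_cis by (auto simp: norm_mult)
        have "A / (c * \<zeta>) + r \<zeta> = A' / (c * \<zeta>) + r' \<zeta>"
          using 1(4)[of \<zeta>] 2(4)[of \<zeta>] mem[of \<zeta> "-1"] \<zeta> elim eqb[of \<zeta>] by simp
        then have "(A - A') / (c * \<zeta>) = r' \<zeta> - r \<zeta>" by (simp add: diff_divide_distrib algebra_simps)
        then have "A - A' = B \<zeta>" using \<zeta>(3) c0 by (simp add: B_def field_simps)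
        then show ?case by (simp add: \<zeta>_def)
      qed
    qed
    ultimately have "((\<lambda>t::real. A - A') \<longlongrightarrow> 0) (at_right 0)"
      using Lim_transform_eventually by fast
    then show ?thesis by (simp add: tendsto_const_iff)
  qed
  ultimately show ?thesis by (simp add: T)
qed

text \<open>Resolves both definite descriptions: the singular part is unique for each radius, which
  determines \<open>alien\<close>, and it is the same for all small radii, which determines
  \<open>Delta_plus\<close>.\<close>

lemma Delta_plus_singularity:
  assumes "(A0, \<phi>) \<in> simple_resurgent \<Omega>"
  obtains e where "0 < e" "has_simple_singularity (\<lambda>\<zeta>. branch k (of_real (x (Suc k)) * cis \<theta> + \<zeta>))
      (ball (- (of_real e * cis \<theta>)) e) (Delta_plus \<Omega> (of_real (x (Suc k)) * cis \<theta>) (A0, \<phi>))"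
proof -
  define \<omega> where "\<omega> = of_real (x (Suc k)) * cis \<theta>"
  define f where "f \<zeta> = branch k (\<omega> + \<zeta>)" for \<zeta>
  define D where "D e = ball (- (of_real e * cis \<theta>)) e" for e
  have xk: "0 < x (Suc k)" by (rule x_pos) simp
  have \<omega>: "\<omega> \<in> \<Omega>" unfolding \<omega>_def using ray_mem_\<Omega>_iff[OF xk] by auto
  \<comment> \<open>Simple resurgence is stated for paths starting in the disc of radius
    \<open>rho \<Omega>\<close>. The radius from continuability shows that arbitrarily short
    starting points are allowed.\<close>
  have rho: "0 < rho \<Omega>"
  proof -
    obtain R :: real where R: "0 < R" "punctured_disc R \<inter> \<Omega> = {}"
      using continuable unfolding continuable_def by blast
    have "ereal R \<le> rho \<Omega>"
      unfolding rho_def using R(2) by (intro INF_greatest) (force simp: punctured_disc_def)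
    then show ?thesis using R(1) by (meson ereal_less(2) less_le_trans)
  qed
  have key: "\<forall>\<^sub>F e in at_right 0. 0 < e \<and> (\<exists>T. has_simple_singularity f (D e) T \<and>
      (\<forall>T'. has_simple_singularity f (D e) T' \<longrightarrow> alien \<omega> (right_path \<Omega> \<omega> e) (A0, \<phi>) = T'))"
    using eventually_right_path[OF rho, of k]
  proof eventually_elim
    case (elim e)
    define g where "g = right_path \<Omega> \<omega> e"
    have e: "small (Suc k) e" "path g" "path_image g \<subseteq> - \<Omega>" "pathstart g \<in> punctured_disc (rho \<Omega>)"
      "pathfinish g = of_real (x (Suc k) - e) * cis \<theta>"
      "cont g \<phi> = fps_expansion (branch k) (pathfinish g)"
      using elim unfolding g_def \<omega>_def by auto
    have e0: "0 < e" using e(1) unfolding small_def by simp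
    have fin: "pathfinish g - \<omega> = - (of_real e * cis \<theta>)" unfolding e(5) \<omega>_def by (simp add: algebra_simps)
    have "dist \<omega> (pathfinish g) = cmod (pathfinish g - \<omega>)" by (simp add: dist_norm norm_minus_commute)
    then have dist: "dist \<omega> (pathfinish g) = e" unfolding fin using e0 by (simp add: norm_mult)
    have disc: "disc_at \<omega> g = D e" unfolding disc_at_def D_def fin dist ..
    have sub: "ball (pathfinish g) e \<subseteq> slit k" unfolding e(5) by (rule ball_subset_slit[OF e(1)])
    have val: "cont_at \<omega> g \<phi> \<zeta> = f \<zeta>" if "\<zeta> \<in> D e" for \<zeta>
    proof -
      have "\<omega> + \<zeta> \<in> ball (pathfinish g) e"
      proof -
        have eq: "pathfinish g - (\<omega> + \<zeta>) = - (of_real e * cis \<theta>) - \<zeta>"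
          unfolding fin[symmetric] by simp
        show ?thesis using that unfolding D_def mem_ball dist_norm eq .
      qed
      then show ?thesis
        unfolding cont_at_def e(6) f_def
        by (intro eval_fps_expansion_ball[OF holomorphic_on_subset[OF holomorphic_branch sub]])
    qed
    have cong: "has_simple_singularity (cont_at \<omega> g \<phi>) (D e) T \<longleftrightarrow> has_simple_singularity f (D e) T" for T
    proof -
      have ev: "\<forall>\<^sub>F \<zeta> in at 0 within D e. cont_at \<omega> g \<phi> \<zeta> = f \<zeta>"
        by (auto simp: eventually_at_filter val)
      have "cont_at \<omega> g \<phi> holomorphic_on D e \<longleftrightarrow> f holomorphic_on D e"
        by (rule holomorphic_cong) (simp_all add: val)
      moreover have "(\<forall>\<^sub>F \<zeta> in at 0 within D e. cont_at \<omega> g \<phi> \<zeta> = h \<zeta>) \<longleftrightarrow> (\<forall>\<^sub>F \<zeta> in at 0 within D e. f \<zeta> = h \<zeta>)" for h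
        by (rule eventually_subst, rule eventually_mono[OF ev]) simp
      ultimately show ?thesis unfolding has_simple_singularity_def by simp
    qed
    have "\<exists>T. has_simple_singularity (cont_at \<omega> g (snd (A0, \<phi>))) (disc_at \<omega> g) T"
      using assms e \<omega> sub slit_disjoint dist unfolding simple_resurgent_def by fastforce
    then obtain T where T: "has_simple_singularity f (D e) T"
      unfolding disc using cong by auto
    have "alien \<omega> g (A0, \<phi>) = T'" if T': "has_simple_singularity f (D e) T'" for T'
      unfolding alien_def sing0_def disc snd_conv cong
    proof (rule the_equality)
      show "has_simple_singularity f (D e) T'" by (rule T')
      show "T'' = T'" if "has_simple_singularity f (D e) T''" for T''
        using singularity_unique that T' e0 unfolding f_def D_def \<omega>_def by blast
    qed
    then show ?case using T e0 unfolding g_def by blast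
  qed
  have "\<exists>e. 0 < e \<and> (\<exists>T. has_simple_singularity f (D e) T)"
    using eventually_happens[OF key] by force
  then obtain e0 T0 where T0: "0 < e0" "has_simple_singularity f (D e0) T0" by blast
  have ev0: "\<forall>\<^sub>F e in at_right 0. T0 = alien \<omega> (right_path \<Omega> \<omega> e) (A0, \<phi>)"
    using key
  proof eventually_elim
    case (elim e)
    then obtain T where T: "0 < e" "has_simple_singularity f (D e) T" "alien \<omega> (right_path \<Omega> \<omega> e) (A0, \<phi>) = T"
      by blast
    have "T0 = T" using singularity_unique T(1,2) T0 unfolding f_def D_def \<omega>_def by blast
    then show ?case using T(3) by simp
  qed
  have "Delta_plus \<Omega> \<omega> (A0, \<phi>) = T0"
    unfolding Delta_plus_def
  proof (rule the_equality[where P = "\<lambda>T. \<forall>\<^sub>F e in at_right 0. T = alien \<omega> (right_path \<Omega> \<omega> e) (A0, \<phi>)", OF ev0])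
    fix T assume "\<forall>\<^sub>F e in at_right 0. T = alien \<omega> (right_path \<Omega> \<omega> e) (A0, \<phi>)"
    with ev0 have "\<forall>\<^sub>F e in at_right (0::real). T = T0" by eventually_elim simp
    then show "T = T0" by (simp add: eventually_const_iff)
  qed
  then show thesis using that[of e0] T0 unfolding f_def D_def \<omega>_def by simp
qed

end

section \<open>Primitives of the branches and their jumps\<close>

context resurgent_sector
begin

text \<open>Each slit domain is star-shaped, so each branch has a primitive; as the branches agree
  on the right sector, additive constants can be matched there. This leaves one common constant,
  fixed by the normalisation at the vertex.\<close>

lemma ex_branch_primitives:
  obtains P where
    "\<And>k \<zeta>. \<zeta> \<in> slit k \<Longrightarrow> (P k has_field_derivative branch k \<zeta> * exp (- (z * \<zeta>))) (at \<zeta>)"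
    "\<And>k \<zeta>. \<zeta> \<in> Sr \<Longrightarrow> P k \<zeta> = P 0 \<zeta>"
    "(P 0 \<longlongrightarrow> 0) (at 0 within S)"
proof -
  have "\<exists>Q. \<forall>\<zeta>\<in>slit k. (Q has_field_derivative branch k \<zeta> * exp (- (z * \<zeta>))) (at \<zeta>)" for k
  proof (rule holomorphic_starlike_primitive[where k = "{}"])
    have hol: "(\<lambda>\<zeta>. branch k \<zeta> * exp (- (z * \<zeta>))) holomorphic_on slit k"
      by (intro holomorphic_intros holomorphic_branch)
    then show "continuous_on (slit k) (\<lambda>\<zeta>. branch k \<zeta> * exp (- (z * \<zeta>)))"
      by (rule holomorphic_on_imp_continuous_on)
    show "starlike (slit k)"
      unfolding starlike_def using centre_mem_slit slit_starlike by blast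
    show "(\<lambda>\<zeta>. branch k \<zeta> * exp (- (z * \<zeta>))) field_differentiable at \<zeta>" if "\<zeta> \<in> slit k - {}" for \<zeta>
      using that holomorphic_on_imp_differentiable_at[OF hol open_slit] by simp
  qed (simp_all add: open_slit)
  then obtain Q where Q: "\<And>k \<zeta>. \<zeta> \<in> slit k \<Longrightarrow> (Q k has_field_derivative branch k \<zeta> * exp (- (z * \<zeta>))) (at \<zeta>)"
    by metis
  have "\<exists>c. \<forall>\<zeta>\<in>Sr. Q k \<zeta> - Q 0 \<zeta> = c" for k
  proof (rule has_field_derivative_zero_constant[OF convex_Sr])
    fix \<zeta> assume \<zeta>: "\<zeta> \<in> Sr"
    then have "\<zeta> \<in> slit k" "\<zeta> \<in> slit 0" using Sr_subset_slit by blast+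
    then have "((\<lambda>\<zeta>. Q k \<zeta> - Q 0 \<zeta>) has_field_derivative
        branch k \<zeta> * exp (- (z * \<zeta>)) - branch 0 \<zeta> * exp (- (z * \<zeta>))) (at \<zeta>)"
      by (intro DERIV_diff Q)
    then show "((\<lambda>\<zeta>. Q k \<zeta> - Q 0 \<zeta>) has_field_derivative 0) (at \<zeta> within Sr)"
      by (simp add: branch_eq[OF \<zeta>] has_field_derivative_at_within)
  qed
  then obtain c where c: "\<And>k \<zeta>. \<zeta> \<in> Sr \<Longrightarrow> Q k \<zeta> - Q 0 \<zeta> = c k" by metis
  obtain r0 where r0: "0 < r0" "\<And>\<zeta>. \<zeta> \<in> S \<Longrightarrow> cmod \<zeta> < r0 \<Longrightarrow> branch 0 \<zeta> = eval_fps \<phi> \<zeta>"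
    using branch_0 by blast
  obtain r' where r': "0 < ereal r'" "ereal r' < fps_conv_radius \<phi>"
    using radius_pos ereal_dense2 by blast
  define r where "r = min (min r0 r') (x 1)"
  have r: "0 < r" "r \<le> r0" "r \<le> x 1" and rr': "r \<le> r'"
    using r0(1) r' x_pos[of 1] by (auto simp: r_def)
  have r4: "ereal r \<le> fps_conv_radius \<phi>"
    using rr' r'(2) order_trans[of "ereal r" "ereal r'"] by simp
  have "(\<lambda>\<zeta>. eval_fps \<phi> \<zeta> * exp (- (z * \<zeta>))) holomorphic_on ball 0 r"
    by (intro holomorphic_intros holomorphic_on_eval_fps_ball r4)
  then obtain L where L: "\<And>\<zeta>. \<zeta> \<in> ball 0 r \<Longrightarrow> (L has_field_derivative eval_fps \<phi> \<zeta> * exp (- (z * \<zeta>))) (at \<zeta>)"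
    using holomorphic_convex_primitive_at[OF convex_ball open_ball] by blast
  have sub: "S \<inter> ball 0 r \<subseteq> slit 0"
  proof
    fix \<zeta> assume \<zeta>: "\<zeta> \<in> S \<inter> ball 0 r"
    then have "Re (rot \<zeta>) < x 1"
      using r(3) complex_Re_le_cmod[of "rot \<zeta>"] by simp
    then show "\<zeta> \<in> slit 0" using \<zeta> Re_rot_pos(1)[of \<zeta>] by (simp add: slit_def x(2))
  qed
  have "\<exists>d. \<forall>\<zeta>\<in>S \<inter> ball 0 r. Q 0 \<zeta> - L \<zeta> = d"
  proof (rule has_field_derivative_zero_constant)
    show "convex (S \<inter> ball 0 r)" by (intro convex_Int convex_S convex_ball)
    fix \<zeta> assume \<zeta>: "\<zeta> \<in> S \<inter> ball 0 r"
    then have "((\<lambda>\<zeta>. Q 0 \<zeta> - L \<zeta>) has_field_derivative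
        branch 0 \<zeta> * exp (- (z * \<zeta>)) - eval_fps \<phi> \<zeta> * exp (- (z * \<zeta>))) (at \<zeta>)"
      using sub by (intro DERIV_diff Q L) auto
    then show "((\<lambda>\<zeta>. Q 0 \<zeta> - L \<zeta>) has_field_derivative 0) (at \<zeta> within S \<inter> ball 0 r)"
      using r0(2)[of \<zeta>] \<zeta> r(2) by (simp add: has_field_derivative_at_within)
  qed
  then obtain d where d: "\<And>\<zeta>. \<zeta> \<in> S \<inter> ball 0 r \<Longrightarrow> Q 0 \<zeta> - L \<zeta> = d" by blast
  have c0: "c 0 = 0"
  proof -
    have "of_real 1 * cis ((a + \<theta>) / 2) \<in> Sr" using angles by (intro cis_mem_open_sector) auto
    from c[OF this, of 0] show ?thesis by simp
  qed
  \<comment> \<open>\<open>c k\<close> aligns the \<open>k\<close>-th primitive with the zeroth on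
    the right; \<open>d + L 0\<close> is the limit of the zeroth at the vertex.\<close>
  show thesis
  proof (rule that[of "\<lambda>k \<zeta>. Q k \<zeta> - (c k + d + L 0)"])
    show "((\<lambda>\<zeta>. Q k \<zeta> - (c k + d + L 0)) has_field_derivative branch k \<zeta> * exp (- (z * \<zeta>))) (at \<zeta>)"
      if "\<zeta> \<in> slit k" for k \<zeta>
      using DERIV_diff[OF Q[OF that] DERIV_const[of "c k + d + L 0"]] by simp
    show "Q k \<zeta> - (c k + d + L 0) = Q 0 \<zeta> - (c 0 + d + L 0)" if "\<zeta> \<in> Sr" for k \<zeta>
      using c[OF that, of k] c0 by (simp add: algebra_simps)
    have "isCont L 0" using L[of 0] r(1) by (intro DERIV_isCont) auto
    then have "(L \<longlongrightarrow> L 0) (at 0 within S)"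
      unfolding isCont_def by (rule tendsto_within_subset) simp
    then have "((\<lambda>\<zeta>. L \<zeta> - L 0) \<longlongrightarrow> 0) (at 0 within S)"
      by (simp add: LIM_zero)
    moreover have "\<forall>\<^sub>F \<zeta> in at 0 within S. L \<zeta> - L 0 = Q 0 \<zeta> - (c 0 + d + L 0)"
      unfolding eventually_at
    proof (intro exI[of _ r] conjI ballI impI r(1))
      fix \<zeta> assume "\<zeta> \<in> S" "\<zeta> \<noteq> 0 \<and> dist \<zeta> 0 < r"
      then have "Q 0 \<zeta> - L \<zeta> = d" by (intro d) simp
      then show "L \<zeta> - L 0 = Q 0 \<zeta> - (c 0 + d + L 0)" using c0 by (simp add: algebra_simps)
    qed
    ultimately show "((\<lambda>\<zeta>. Q 0 \<zeta> - (c 0 + d + L 0)) \<longlongrightarrow> 0) (at 0 within S)"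
      by (rule Lim_transform_eventually)
  qed
qed

text \<open>The pole \<open>A / (2 * of_real pi * \<i> * \<zeta>)\<close> is single-valued and
  cancels in the jump of the branches. Its primitive contains a logarithm, however, so
  \<open>A\<close> reappears as the boundary value of the jump of the primitives.\<close>

lemma singular_jump:
  assumes sing: "has_simple_singularity (\<lambda>\<zeta>. branch k (of_real (x (Suc k)) * cis \<theta> + \<zeta>))
      (ball (- (of_real e * cis \<theta>)) e) (A, \<psi>)" and e: "0 < e"
  shows "\<forall>\<^sub>F \<zeta> in at 0 within Sl. branch (Suc k) (of_real (x (Suc k)) * cis \<theta> + \<zeta>)
      - branch k (of_real (x (Suc k)) * cis \<theta> + \<zeta>) = eval_fps \<psi> \<zeta>"
    and "(\<And>k \<zeta>. \<zeta> \<in> slit k \<Longrightarrow> (P k has_field_derivative branch k \<zeta> * exp (- (z * \<zeta>))) (at \<zeta>)) \<Longrightarrow>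
      (\<And>k \<zeta>. \<zeta> \<in> Sr \<Longrightarrow> P k \<zeta> = P 0 \<zeta>) \<Longrightarrow>
      ((\<lambda>\<zeta>. P (Suc k) (of_real (x (Suc k)) * cis \<theta> + \<zeta>) - P k (of_real (x (Suc k)) * cis \<theta> + \<zeta>))
        \<longlongrightarrow> A * exp (- (z * (of_real (x (Suc k)) * cis \<theta>)))) (at 0 within Sl)"
proof -
  define \<omega> where "\<omega> = of_real (x (Suc k)) * cis \<theta>"
  define c :: complex where "c = 2 * of_real pi * \<i>"
  have c0: "c \<noteq> 0" by (simp add: c_def)
  obtain \<delta> r where \<delta>: "0 < \<delta>" "ereal \<delta> \<le> fps_conv_radius \<psi>" "r holomorphic_on ball 0 \<delta>"
    "ball \<omega> \<delta> \<subseteq> S"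
    and V: "\<And>\<zeta>. \<zeta> \<in> half_slit_ball (-1) \<delta> \<Longrightarrow> \<omega> + \<zeta> \<in> slit k"
    "\<And>\<zeta>. \<zeta> \<in> half_slit_ball (-1) \<delta> \<Longrightarrow> branch k (\<omega> + \<zeta>) =
      A / (c * \<zeta>) + eval_fps \<psi> \<zeta> * log_right \<zeta> / c + r \<zeta>"
    and W: "\<And>\<zeta>. \<zeta> \<in> half_slit_ball 1 \<delta> \<Longrightarrow> \<omega> + \<zeta> \<in> slit (Suc k)"
    "\<And>\<zeta>. \<zeta> \<in> half_slit_ball 1 \<delta> \<Longrightarrow> branch (Suc k) (\<omega> + \<zeta>) =
      A / (c * \<zeta>) + eval_fps \<psi> \<zeta> * log_left \<zeta> / c + r \<zeta>"
    using singular_expansion[OF sing e] unfolding \<omega>_def c_def by metis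
  have near: "\<forall>\<^sub>F \<zeta> in at 0 within Sl. \<zeta> \<in> half_slit_ball (-1) \<delta> \<and> \<zeta> \<in> half_slit_ball 1 \<delta> \<and> 0 < Im (rot \<zeta>)"
    unfolding eventually_at using \<delta>(1)
    by (intro exI[of _ \<delta>]) (auto simp: half_slit_ball_def mem_Sl_iff)
  have "\<forall>\<^sub>F \<zeta> in at 0 within Sl. branch (Suc k) (\<omega> + \<zeta>) - branch k (\<omega> + \<zeta>) = eval_fps \<psi> \<zeta>"
    using near
  proof eventually_elim
    case (elim \<zeta>)
    have "branch (Suc k) (\<omega> + \<zeta>) - branch k (\<omega> + \<zeta>) = eval_fps \<psi> \<zeta> * (log_left \<zeta> - log_right \<zeta>) / c"
      using V(2)[of \<zeta>] W(2)[of \<zeta>] elim by (simp add: diff_divide_distrib right_diff_distrib)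
    also have "log_left \<zeta> - log_right \<zeta> = c" using elim log_left_eq_above[of \<zeta>] by (simp add: c_def)
    finally show ?case using c0 by simp
  qed
  then show "\<forall>\<^sub>F \<zeta> in at 0 within Sl. branch (Suc k) (of_real (x (Suc k)) * cis \<theta> + \<zeta>)
      - branch k (of_real (x (Suc k)) * cis \<theta> + \<zeta>) = eval_fps \<psi> \<zeta>"
    unfolding \<omega>_def .
  assume P: "\<And>k \<zeta>. \<zeta> \<in> slit k \<Longrightarrow> (P k has_field_derivative branch k \<zeta> * exp (- (z * \<zeta>))) (at \<zeta>)"
    "\<And>k \<zeta>. \<zeta> \<in> Sr \<Longrightarrow> P k \<zeta> = P 0 \<zeta>"
  define E where "E \<zeta> = exp (- (z * (\<omega> + \<zeta>)))" for \<zeta>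
  have hE: "E holomorphic_on B" for B unfolding E_def[abs_def] by (intro holomorphic_intros)
  have h\<psi>: "eval_fps \<psi> holomorphic_on ball 0 \<delta>" by (rule holomorphic_on_eval_fps_ball[OF \<delta>(2)])
  have "(\<lambda>\<zeta>. eval_fps \<psi> \<zeta> * E \<zeta>) holomorphic_on ball 0 \<delta>" by (intro holomorphic_intros hE h\<psi>)
  then obtain \<Psi>' where \<Psi>': "\<And>\<zeta>. \<zeta> \<in> ball 0 \<delta> \<Longrightarrow> (\<Psi>' has_field_derivative eval_fps \<psi> \<zeta> * E \<zeta>) (at \<zeta>)"
    using holomorphic_convex_primitive_at[OF convex_ball open_ball] by blast
  define \<Psi> where "\<Psi> \<zeta> = \<Psi>' \<zeta> - \<Psi>' 0" for \<zeta>
  have \<Psi>: "(\<Psi> has_field_derivative eval_fps \<psi> \<zeta> * E \<zeta>) (at \<zeta>)" if "\<zeta> \<in> ball 0 \<delta>" for \<zeta>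
    unfolding \<Psi>_def[abs_def] using DERIV_diff[OF \<Psi>'[OF that] DERIV_const[of "\<Psi>' 0"]] by simp
  have \<Psi>0: "\<Psi> 0 = 0" by (simp add: \<Psi>_def)
  have h\<Psi>: "\<Psi> holomorphic_on ball 0 \<delta>"
    unfolding holomorphic_on_open[OF open_ball] using \<Psi> by blast
  \<comment> \<open>\<open>(A * E 0 + \<Psi>) * log / c\<close> is a primitive of the singular part up to a function with a
    removable singularity.\<close>
  define n where "n \<zeta> = A * E \<zeta> - \<Psi> \<zeta>" for \<zeta>
  define N where "N \<zeta> = (if \<zeta> = 0 then deriv n 0 else (n \<zeta> - n 0) / (\<zeta> - 0))" for \<zeta>
  have "n holomorphic_on ball 0 \<delta>" unfolding n_def[abs_def] by (intro holomorphic_intros hE h\<Psi>)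
  then have "N holomorphic_on ball 0 \<delta>" unfolding N_def[abs_def]
    by (rule pole_lemma) (use \<delta>(1) in simp)
  then have "(\<lambda>\<zeta>. N \<zeta> / c + r \<zeta> * E \<zeta>) holomorphic_on ball 0 \<delta>"
    using c0 by (intro holomorphic_intros hE \<delta>(3)) auto
  then obtain B where B: "\<And>\<zeta>. \<zeta> \<in> ball 0 \<delta> \<Longrightarrow> (B has_field_derivative N \<zeta> / c + r \<zeta> * E \<zeta>) (at \<zeta>)"
    using holomorphic_convex_primitive_at[OF convex_ball open_ball] by blast
  \<comment> \<open>An arbitrary \<open>log\<close> with derivative \<open>1 / \<zeta>\<close> lets
    this serve both cut discs. The product rule yields
    \<open>(A * E 0 + \<Psi> \<zeta>) / \<zeta>\<close> where \<open>A * E \<zeta> / \<zeta>\<close>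
    is wanted, and \<open>N \<zeta>\<close> is the difference.\<close>
  have M: "((\<lambda>\<zeta>. (A * E 0 + \<Psi> \<zeta>) * log \<zeta> / c + B \<zeta>) has_field_derivative
      (A / (c * \<zeta>) + eval_fps \<psi> \<zeta> * log \<zeta> / c + r \<zeta>) * E \<zeta>) (at \<zeta>)"
    if "(log has_field_derivative 1 / \<zeta>) (at \<zeta>)" "\<zeta> \<in> ball 0 \<delta>" "\<zeta> \<noteq> 0" for log \<zeta>
  proof -
    have "((\<lambda>\<zeta>. (A * E 0 + \<Psi> \<zeta>) * log \<zeta> / c + B \<zeta>) has_field_derivative
        ((A * E 0 + \<Psi> \<zeta>) * (1 / \<zeta>) + (0 + eval_fps \<psi> \<zeta> * E \<zeta>) * log \<zeta>) / c
        + (N \<zeta> / c + r \<zeta> * E \<zeta>)) (at \<zeta>)"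
      by (intro DERIV_add DERIV_cdivide DERIV_mult' DERIV_const \<Psi> B that)
    moreover have N: "N \<zeta> = (A * E \<zeta> - \<Psi> \<zeta> - A * E 0) / \<zeta>"
      using that(3) \<Psi>0 by (simp add: N_def n_def)
    have "((A * E 0 + \<Psi> \<zeta>) * (1 / \<zeta>) + (0 + eval_fps \<psi> \<zeta> * E \<zeta>) * log \<zeta>) / c
        + (N \<zeta> / c + r \<zeta> * E \<zeta>) = (A / (c * \<zeta>) + eval_fps \<psi> \<zeta> * log \<zeta> / c + r \<zeta>) * E \<zeta>"
      unfolding N using c0 that(3) by (simp add: field_simps)
    ultimately show ?thesis by simp
  qed
  have const: "\<exists>d. \<forall>\<zeta>\<in>half_slit_ball \<sigma> \<delta>. P i (\<omega> + \<zeta>) - ((A * E 0 + \<Psi> \<zeta>) * log \<zeta> / c + B \<zeta>) = d"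
    if \<sigma>: "\<bar>\<sigma>\<bar> = 1"
      and br: "\<And>\<zeta>. \<zeta> \<in> half_slit_ball \<sigma> \<delta> \<Longrightarrow> \<omega> + \<zeta> \<in> slit i"
       "\<And>\<zeta>. \<zeta> \<in> half_slit_ball \<sigma> \<delta> \<Longrightarrow> branch i (\<omega> + \<zeta>) = A / (c * \<zeta>) + eval_fps \<psi> \<zeta> * log \<zeta> / c + r \<zeta>"
       "\<And>\<zeta>. \<zeta> \<in> half_slit_ball \<sigma> \<delta> \<Longrightarrow> (log has_field_derivative 1 / \<zeta>) (at \<zeta>)"
    for \<sigma> i log
  proof -
    define g where "g \<zeta> = P i (\<omega> + \<zeta>) - ((A * E 0 + \<Psi> \<zeta>) * log \<zeta> / c + B \<zeta>)" for \<zeta>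
    have g: "(g has_field_derivative 0) (at \<zeta>)" if \<zeta>: "\<zeta> \<in> half_slit_ball \<sigma> \<delta>" for \<zeta>
    proof -
      have "\<zeta> \<in> ball 0 \<delta>" "\<zeta> \<noteq> 0" using \<zeta> half_slit_ball_subset zero_notin_half_slit_ball by blast+
      note m = M[OF br(3)[OF \<zeta>] this]
      have "((\<lambda>\<zeta>. P i (\<omega> + \<zeta>)) has_field_derivative branch i (\<omega> + \<zeta>) * exp (- (z * (\<omega> + \<zeta>))) * 1) (at \<zeta>)"
        by (rule DERIV_chain2[where f = "P i" and g = "\<lambda>\<zeta>. \<omega> + \<zeta>", OF P(1)[OF br(1)[OF \<zeta>]]]) (auto intro!: derivative_eq_intros)
      from DERIV_diff[OF this m] show ?thesis
        unfolding g_def[abs_def] by (simp add: br(2)[OF \<zeta>] E_def)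
    qed
    have "continuous_on (half_slit_ball \<sigma> \<delta>) g"
      using g DERIV_isCont by (intro continuous_at_imp_continuous_on) blast
    then obtain d where "\<And>\<zeta>. \<zeta> \<in> half_slit_ball \<sigma> \<delta> \<Longrightarrow> g \<zeta> = d"
      using DERIV_zero_connected_constant[OF connected_half_slit_ball[OF \<sigma> \<delta>(1)] open_half_slit_ball finite.emptyI]
        g by (metis Diff_empty)
    then show ?thesis unfolding g_def by blast
  qed
  have lr: "(log_right has_field_derivative 1 / \<zeta>) (at \<zeta>)" if "\<zeta> \<in> half_slit_ball (-1) \<delta>" for \<zeta>
    by (rule log_right_derivative[OF rot_notin_nonpos(1)[OF that refl]])
  have ll: "(log_left has_field_derivative 1 / \<zeta>) (at \<zeta>)" if "\<zeta> \<in> half_slit_ball 1 \<delta>" for \<zeta>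
    by (rule log_left_derivative[OF rot_notin_nonpos(2)[OF that refl]])
  obtain d1 where d1: "\<And>\<zeta>. \<zeta> \<in> half_slit_ball (-1) \<delta> \<Longrightarrow> P k (\<omega> + \<zeta>) - ((A * E 0 + \<Psi> \<zeta>) * log_right \<zeta> / c + B \<zeta>) = d1"
    using const[of "-1" k log_right, OF _ V lr] by auto
  obtain d2 where d2: "\<And>\<zeta>. \<zeta> \<in> half_slit_ball 1 \<delta> \<Longrightarrow> P (Suc k) (\<omega> + \<zeta>) - ((A * E 0 + \<Psi> \<zeta>) * log_left \<zeta> / c + B \<zeta>) = d2"
    using const[of 1 "Suc k" log_left, OF _ W ll] by auto
  \<comment> \<open>Compared at a point below the ray, where the primitives agree and so do the
    logarithms.\<close>
  have "d1 = d2"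
  proof -
    define p where "p = (- (\<i> * of_real (\<delta> / 2))) * cis \<theta>"
    have rp: "rot p = - (\<i> * of_real (\<delta> / 2))" unfolding p_def by (rule rot_of_cis)
    have np: "cmod p < \<delta>" using \<delta>(1) by (simp add: p_def norm_mult)
    have p: "p \<in> half_slit_ball \<sigma> \<delta>" for \<sigma> using np \<delta>(1) by (simp add: half_slit_ball_def rp)
    have "\<omega> + p \<in> S" using \<delta>(4) np by (intro subsetD[OF \<delta>(4)]) (simp add: dist_norm)
    then have "\<omega> + p \<in> Sr" using \<delta>(1) by (simp add: mem_Sr_iff rot_add rp \<omega>_def)
    then have "P k (\<omega> + p) = P (Suc k) (\<omega> + p)" using P(2)[of "\<omega> + p" k] P(2)[of "\<omega> + p" "Suc k"] by simp
    moreover have "log_left p = log_right p" using \<delta>(1) by (intro log_left_eq_below) (simp add: rp)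
    ultimately show ?thesis using d1[OF p] d2[OF p] by simp
  qed
  have "\<forall>\<^sub>F \<zeta> in at 0 within Sl. A * E 0 + \<Psi> \<zeta> = P (Suc k) (\<omega> + \<zeta>) - P k (\<omega> + \<zeta>)"
    using near
  proof eventually_elim
    case (elim \<zeta>)
    have "P (Suc k) (\<omega> + \<zeta>) - P k (\<omega> + \<zeta>) = (A * E 0 + \<Psi> \<zeta>) * (log_left \<zeta> - log_right \<zeta>) / c"
    proof -
      have "P k (\<omega> + \<zeta>) = d2 + ((A * E 0 + \<Psi> \<zeta>) * log_right \<zeta> / c + B \<zeta>)"
        using d1[of \<zeta>] elim \<open>d1 = d2\<close> by (simp only: diff_eq_eq)
      moreover have "P (Suc k) (\<omega> + \<zeta>) = d2 + ((A * E 0 + \<Psi> \<zeta>) * log_left \<zeta> / c + B \<zeta>)"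
        using d2[of \<zeta>] elim by (simp only: diff_eq_eq)
      ultimately show ?thesis by (simp only: right_diff_distrib diff_divide_distrib) simp
    qed
    also have "log_left \<zeta> - log_right \<zeta> = c" using elim log_left_eq_above[of \<zeta>] by (simp add: c_def)
    finally show ?case using c0 by simp
  qed
  moreover have "((\<lambda>\<zeta>. A * E 0 + \<Psi> \<zeta>) \<longlongrightarrow> A * E 0 + 0) (at 0 within Sl)"
  proof -
    have "isCont \<Psi> 0" using \<Psi>[of 0] \<delta>(1) by (intro DERIV_isCont) auto
    then have "(\<Psi> \<longlongrightarrow> \<Psi> 0) (at 0 within Sl)"
      unfolding isCont_def by (rule tendsto_within_subset) simp
    then show ?thesis unfolding \<Psi>0 by (intro tendsto_intros)
  qed
  ultimately have "((\<lambda>\<zeta>. P (Suc k) (\<omega> + \<zeta>) - P k (\<omega> + \<zeta>)) \<longlongrightarrow> A * E 0 + 0) (at 0 within Sl)"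
    by (rule Lim_transform_eventually[rotated])
  then show "((\<lambda>\<zeta>. P (Suc k) (of_real (x (Suc k)) * cis \<theta> + \<zeta>) - P k (of_real (x (Suc k)) * cis \<theta> + \<zeta>))
        \<longlongrightarrow> A * exp (- (z * (of_real (x (Suc k)) * cis \<theta>)))) (at 0 within Sl)"
    by (simp add: \<omega>_def E_def)
qed

end

context resurgent_sector
begin

text \<open>Numbered by the gap that ends there: it separates gap \<open>k\<close> from gap
  \<open>Suc k\<close>.\<close>

definition singular_point :: "nat \<Rightarrow> complex" where
  "singular_point k = of_real (x (Suc k)) * cis \<theta>"

text \<open>The interface to the Stokes argument: paths and expansions no longer appear, only
  branches, their primitives, and the two components of \<open>Delta_plus\<close> as their
  jumps.\<close>

lemma simple_resurgent_branches:
  assumes "(A0, \<phi>) \<in> simple_resurgent \<Omega>"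
  defines "\<Delta> \<equiv> \<lambda>k. Delta_plus \<Omega> (singular_point k) (A0, \<phi>)"
  shows "\<forall>\<^sub>F \<zeta> in at 0 within Sl. branch 0 \<zeta> = eval_fps \<phi> \<zeta>"
    and "0 < fps_conv_radius (snd (\<Delta> k))"
    and "\<forall>\<^sub>F \<zeta> in at 0 within Sl.
      branch (Suc k) (singular_point k + \<zeta>) - branch k (singular_point k + \<zeta>) = eval_fps (snd (\<Delta> k)) \<zeta>"
    and "\<exists>P. (\<forall>k. \<forall>\<zeta>\<in>slit k. (P k has_field_derivative branch k \<zeta> * exp (- (z * \<zeta>))) (at \<zeta>)) \<and>
      (\<forall>k. \<forall>\<zeta>\<in>Sr. P k \<zeta> = P 0 \<zeta>) \<and> (P 0 \<longlongrightarrow> 0) (at 0 within S) \<and>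
      (\<forall>k. ((\<lambda>\<zeta>. P (Suc k) (singular_point k + \<zeta>) - P k (singular_point k + \<zeta>))
        \<longlongrightarrow> fst (\<Delta> k) * exp (- (z * singular_point k))) (at 0 within Sl))"
proof -
  obtain r where r: "0 < r" "\<And>\<zeta>. \<zeta> \<in> S \<Longrightarrow> cmod \<zeta> < r \<Longrightarrow> branch 0 \<zeta> = eval_fps \<phi> \<zeta>"
    using branch_0 by blast
  show "\<forall>\<^sub>F \<zeta> in at 0 within Sl. branch 0 \<zeta> = eval_fps \<phi> \<zeta>"
    unfolding eventually_at using r Sl_subset by (intro exI[of _ r]) auto
  have ex: "\<exists>e>0. has_simple_singularity (\<lambda>\<zeta>. branch k (of_real (x (Suc k)) * cis \<theta> + \<zeta>))
      (ball (- (of_real e * cis \<theta>)) e) (fst (\<Delta> k), snd (\<Delta> k))" for k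
    using Delta_plus_singularity[OF assms(1), of k] unfolding \<Delta>_def singular_point_def by auto
  show "0 < fps_conv_radius (snd (\<Delta> k))"
    using ex[of k] unfolding has_simple_singularity_def by auto
  show "\<forall>\<^sub>F \<zeta> in at 0 within Sl.
      branch (Suc k) (singular_point k + \<zeta>) - branch k (singular_point k + \<zeta>) = eval_fps (snd (\<Delta> k)) \<zeta>"
    using ex[of k] singular_jump(1) unfolding singular_point_def by blast
  obtain P where P: "\<And>k \<zeta>. \<zeta> \<in> slit k \<Longrightarrow> (P k has_field_derivative branch k \<zeta> * exp (- (z * \<zeta>))) (at \<zeta>)"
    "\<And>k \<zeta>. \<zeta> \<in> Sr \<Longrightarrow> P k \<zeta> = P 0 \<zeta>" "(P 0 \<longlongrightarrow> 0) (at 0 within S)"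
    using ex_branch_primitives[of z] by blast
  have "((\<lambda>\<zeta>. P (Suc k) (singular_point k + \<zeta>) - P k (singular_point k + \<zeta>))
        \<longlongrightarrow> fst (\<Delta> k) * exp (- (z * singular_point k))) (at 0 within Sl)" for k
  proof -
    obtain e where e: "0 < e" "has_simple_singularity (\<lambda>\<zeta>. branch k (of_real (x (Suc k)) * cis \<theta> + \<zeta>))
      (ball (- (of_real e * cis \<theta>)) e) (fst (\<Delta> k), snd (\<Delta> k))" using ex[of k] by blast
    show ?thesis
      unfolding singular_point_def by (rule singular_jump(2)[OF e(2,1) P(1,2)])
  qed
  then show "\<exists>P. (\<forall>k. \<forall>\<zeta>\<in>slit k. (P k has_field_derivative branch k \<zeta> * exp (- (z * \<zeta>))) (at \<zeta>)) \<and>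
      (\<forall>k. \<forall>\<zeta>\<in>Sr. P k \<zeta> = P 0 \<zeta>) \<and> (P 0 \<longlongrightarrow> 0) (at 0 within S) \<and>
      (\<forall>k. ((\<lambda>\<zeta>. P (Suc k) (singular_point k + \<zeta>) - P k (singular_point k + \<zeta>))
        \<longlongrightarrow> fst (\<Delta> k) * exp (- (z * singular_point k))) (at 0 within Sl))"
    using P by blast
qed

end

section \<open>Admissible directions\<close>

lemma Re_mult_cis_Lipschitz:
  "\<bar>Re (z * cis s) - Re (z * cis t)\<bar> \<le> cmod z * \<bar>s - t\<bar>"
proof -
  have "norm ((\<lambda>s. Re (z * cis s)) s - (\<lambda>s. Re (z * cis s)) t) \<le> cmod z * norm (s - t)"
  proof (rule field_differentiable_bound[of UNIV _ "\<lambda>s. - Im (z * cis s)"])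
    fix u :: real
    show "((\<lambda>s. Re (z * cis s)) has_field_derivative - Im (z * cis u)) (at u within UNIV)"
      by (auto intro!: derivative_eq_intros simp: algebra_simps)
    show "norm (- Im (z * cis u)) \<le> cmod z"
      using abs_Im_le_cmod[of "z * cis u"] by (simp add: norm_mult)
  qed auto
  then show ?thesis by simp
qed

text \<open>As \<open>\<gamma>\<close> is uncontrolled near the end of the interval, \<open>t0\<close> is taken to nearly minimise it
  there; the loss is absorbed by \<open>\<epsilon>\<close>.\<close>

lemma admissible_direction_right:
  fixes \<gamma> :: "real \<Rightarrow> real"
  assumes "a < \<tau>" "0 < \<epsilon>" and bdd: "bdd_below (\<gamma> ` {a<..<\<tau>})"
  obtains t0 where "a < t0" "t0 < \<tau>" "\<And>z t. cmod z \<le> N \<Longrightarrow> a < t \<Longrightarrow> t < \<tau> \<Longrightarrow> \<gamma> t + \<epsilon> < Re (z * cis t) \<Longrightarrow>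
    \<exists>t'. t0 \<le> t' \<and> t' < \<tau> \<and> \<gamma> t' + \<epsilon> / 2 < Re (z * cis t')"
proof -
  define n where "n = \<bar>N\<bar> + 1"
  \<comment> \<open>With \<open>cmod z \<le> n\<close>, turning the direction by less than
    \<open>\<eta>\<close> changes the real part by at most \<open>\<epsilon> / 8\<close>. Together
    with a loss of \<open>\<epsilon> / 8\<close> in the near-infimum this leaves more than
    \<open>\<epsilon> / 2\<close>.\<close>
  define \<eta> where "\<eta> = min (\<tau> - a) (\<epsilon> / (8 * n))"
  have n: "0 < n" by (simp add: n_def)
  have \<eta>: "0 < \<eta>" "\<eta> \<le> \<tau> - a" "\<eta> \<le> \<epsilon> / (8 * n)" using assms n by (auto simp: \<eta>_def)
  have n\<eta>: "n * \<eta> \<le> \<epsilon> / 8" using mult_left_mono[OF \<eta>(3), of n] n by simp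
  define G where "G = \<gamma> ` {a<..<a + \<eta>}"
  have G: "G \<noteq> {}" "bdd_below G"
    using \<eta> bdd_below_mono[OF bdd] unfolding G_def by (auto intro: bdd_below_mono[OF bdd])
  have "Inf G < Inf G + \<epsilon> / 8" using assms by simp
  then obtain g where "g \<in> G" "g < Inf G + \<epsilon> / 8" using cInf_lessD[OF G(1)] by blast
  then obtain t0 where t0: "a < t0" "t0 < a + \<eta>" "\<gamma> t0 < Inf G + \<epsilon> / 8"
    unfolding G_def by auto
  show thesis
  proof (rule that[of t0])
    fix z t assume z: "cmod z \<le> N" and t: "a < t" "t < \<tau>" "\<gamma> t + \<epsilon> < Re (z * cis t)"
    show "\<exists>t'. t0 \<le> t' \<and> t' < \<tau> \<and> \<gamma> t' + \<epsilon> / 2 < Re (z * cis t')"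
    proof (cases "t0 \<le> t")
      case True
      then show ?thesis using t assms(2) by (intro exI[of _ t]) auto
    next
      case False
      then have "\<gamma> t \<in> G" unfolding G_def using t t0 by auto
      then have "Inf G \<le> \<gamma> t" using G(2) by (rule cInf_lower)
      moreover have "\<bar>Re (z * cis t) - Re (z * cis t0)\<bar> \<le> \<epsilon> / 8"
      proof -
        have "\<bar>Re (z * cis t) - Re (z * cis t0)\<bar> \<le> cmod z * \<bar>t - t0\<bar>" by (rule Re_mult_cis_Lipschitz)
        also have "\<dots> \<le> n * \<eta>" using z t t0 False by (intro mult_mono) (auto simp: n_def)
        finally show ?thesis using n\<eta> by simp
      qed
      ultimately have "\<gamma> t0 + \<epsilon> / 2 < Re (z * cis t0)" using t(3) t0(3) assms(2) by linarith
      then show ?thesis using t0 \<eta> by (intro exI[of _ t0]) auto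
    qed
  qed (use t0 \<eta> in auto)
qed

lemma Re_cnj_cis: "Re (cnj z * cis (- t)) = Re (z * cis t)"
  by simp

text \<open>Reflection in the real axis, \<open>z\<close> to \<open>cnj z\<close> and
  \<open>t\<close> to \<open>- t\<close>, exchanges the two ends of the interval.\<close>

lemma admissible_direction_left:
  fixes \<gamma> :: "real \<Rightarrow> real"
  assumes "\<tau> < b" "0 < \<epsilon>" and bdd: "bdd_below (\<gamma> ` {\<tau><..<b})"
  obtains t0 where "\<tau> < t0" "t0 < b" "\<And>z t. cmod z \<le> N \<Longrightarrow> \<tau> < t \<Longrightarrow> t < b \<Longrightarrow> \<gamma> t + \<epsilon> < Re (z * cis t) \<Longrightarrow>
    \<exists>t'. \<tau> < t' \<and> t' \<le> t0 \<and> \<gamma> t' + \<epsilon> / 2 < Re (z * cis t')"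
proof -
  have "(\<lambda>t. \<gamma> (- t)) ` {- b<..<- \<tau>} = \<gamma> ` {\<tau><..<b}"
    by (simp add: image_image[of \<gamma> uminus, symmetric])
  then have "bdd_below ((\<lambda>t. \<gamma> (- t)) ` {- b<..<- \<tau>})" using bdd by simp
  then obtain t0 where t0: "- b < t0" "t0 < - \<tau>" "\<And>z t. cmod z \<le> N \<Longrightarrow> - b < t \<Longrightarrow> t < - \<tau> \<Longrightarrow>
      \<gamma> (- t) + \<epsilon> < Re (z * cis t) \<Longrightarrow> \<exists>t'. t0 \<le> t' \<and> t' < - \<tau> \<and> \<gamma> (- t') + \<epsilon> / 2 < Re (z * cis t')"
    using admissible_direction_right[of "- b" "- \<tau>" \<epsilon> "\<lambda>t. \<gamma> (- t)" N] assms by auto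
  show thesis
  proof (rule that[of "- t0"])
    fix z t assume z: "cmod z \<le> N" and t: "\<tau> < t" "t < b" "\<gamma> t + \<epsilon> < Re (z * cis t)"
    have "\<exists>t'. t0 \<le> t' \<and> t' < - \<tau> \<and> \<gamma> (- t') + \<epsilon> / 2 < Re (cnj z * cis t')"
    proof (rule t0(3))
      show "\<gamma> (- (- t)) + \<epsilon> < Re (cnj z * cis (- t))" using t(3) unfolding Re_cnj_cis by simp
    qed (use z t in auto)
    then obtain t' where t': "t0 \<le> t'" "t' < - \<tau>" "\<gamma> (- t') + \<epsilon> / 2 < Re (cnj z * cis t')" by blast
    have "Re (cnj z * cis t') = Re (z * cis (- t'))" using Re_cnj_cis[of z "- t'"] by simp
    then show "\<exists>t'. \<tau> < t' \<and> t' \<le> - t0 \<and> \<gamma> t' + \<epsilon> / 2 < Re (z * cis t')"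
      using t' by (intro exI[of _ "- t'"]) auto
  qed (use t0 in auto)
qed

lemma sin_ge_min:
  assumes "0 < u" "u \<le> s" "s \<le> v" "v < pi"
  shows "min (sin u) (sin v) \<le> sin s"
proof (cases "s \<le> pi / 2")
  case True
  have "sin u \<le> sin s" using assms True by (intro sin_monotone_2pi_le) auto
  then show ?thesis by simp
next
  case False
  have "sin (pi - v) \<le> sin (pi - s)" using assms False by (intro sin_monotone_2pi_le) auto
  then show ?thesis by simp
qed

text \<open>As a function of \<open>s\<close> the real part is a sinusoid of frequency 1, determined
  by two values; this is the interpolation formula for it.\<close>

lemma Re_mult_cis_interpolate:
  "sin (t' - t) * Re (z * cis s) = sin (t' - s) * Re (z * cis t) + sin (s - t) * Re (z * cis t')"
proof -
  have c: "sin (t' - t) * cos s = sin (t' - s) * cos t + sin (s - t) * cos t'"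
  proof -
    have "t' - t = (t' - s) + (s - t)" by simp
    then have 1: "sin (t' - t) = sin (t' - s) * cos (s - t) + cos (t' - s) * sin (s - t)" by (metis sin_add)
    have 2: "cos t = cos (s - t) * cos s + sin (s - t) * sin s" using cos_diff[of s "s - t"] by simp
    have 3: "cos t' = cos (t' - s) * cos s - sin (t' - s) * sin s" using cos_add[of "t' - s" s] by simp
    show ?thesis unfolding 1 2 3 by (simp add: algebra_simps)
  qed
  have s: "sin (t' - t) * sin s = sin (t' - s) * sin t + sin (s - t) * sin t'"
  proof -
    have "t' - t = (t' - s) + (s - t)" by simp
    then have 1: "sin (t' - t) = sin (t' - s) * cos (s - t) + cos (t' - s) * sin (s - t)" by (metis sin_add)
    have 2: "sin t = cos (s - t) * sin s - sin (s - t) * cos s" using sin_diff[of s "s - t"] by simp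
    have 3: "sin t' = sin (t' - s) * cos s + cos (t' - s) * sin s" using sin_add[of "t' - s" s] by simp
    show ?thesis unfolding 1 2 3 by (simp add: algebra_simps)
  qed
  have "sin (t' - t) * Re (z * cis s) = Re z * (sin (t' - t) * cos s) - Im z * (sin (t' - t) * sin s)"
    by (simp add: algebra_simps)
  also have "\<dots> = sin (t' - s) * Re (z * cis t) + sin (s - t) * Re (z * cis t')"
    unfolding c s by (simp add: algebra_simps)
  finally show ?thesis .
qed

text \<open>Lower bounds on both sides of the ray interpolate to a lower bound on all directions
  between. A sinusoid of large amplitude \<open>cmod z\<close> that stays above a fixed bound on an
  interval must be large well inside it. In the application \<open>B\<close> is a lower bound of
  \<open>\<gamma>\<close>.\<close>

lemma far_directions_admissible:
  fixes a b \<theta> \<epsilon> B K :: real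
  assumes \<epsilon>: "0 < \<epsilon>" and ab: "b - a < pi"
  obtains N where "\<And>z t t'. a < t \<Longrightarrow> t < \<theta> - \<epsilon> \<Longrightarrow> \<theta> + \<epsilon> < t' \<Longrightarrow> t' < b \<Longrightarrow>
      B \<le> Re (z * cis t) \<Longrightarrow> B \<le> Re (z * cis t') \<Longrightarrow> N < cmod z \<Longrightarrow>
      K \<le> Re (z * cis (\<theta> - \<epsilon> / 2)) \<and> K \<le> Re (z * cis (\<theta> + \<epsilon> / 2))"
proof -
  define \<sigma> where "\<sigma> = min (sin (2 * \<epsilon>)) (sin (b - a))"
  define C where "C = 2 * \<bar>B\<bar> / \<sigma>"
  define \<eta> where "\<eta> = \<epsilon> / 2"
  define k where "k = \<bar>K\<bar>"
  define N where "N = k + C / cos \<eta> + (C + k) / sin \<eta>"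
  show thesis
  proof (rule that[of N])
    fix z t t'
    assume t: "a < t" "t < \<theta> - \<epsilon>" "\<theta> + \<epsilon> < t'" "t' < b"
      and B: "B \<le> Re (z * cis t)" "B \<le> Re (z * cis t')" and N: "N < cmod z"
    have small: "2 * \<epsilon> < b - a" using t by linarith
    have "0 < sin (2 * \<epsilon>)" "0 < sin (b - a)" using \<epsilon> small ab by (auto intro!: sin_gt_zero)
    then have \<sigma>: "0 < \<sigma>" by (simp add: \<sigma>_def)
    have C: "0 \<le> C" using \<sigma> by (simp add: C_def)
    have \<eta>: "0 < \<eta>" "\<eta> < pi / 2" using \<epsilon> small ab by (auto simp: \<eta>_def)
    then have sc: "0 < sin \<eta>" "0 < cos \<eta>" by (auto intro!: sin_gt_zero cos_gt_zero)
    \<comment> \<open>The interpolating sines are at most 1, and \<open>sin (t' - t)\<close> is at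
      least \<open>\<sigma>\<close> because \<open>t' - t\<close> lies between
      \<open>2 * \<epsilon>\<close> and \<open>b - a\<close>.\<close>
    have low: "- C \<le> Re (z * cis s)" if s: "\<theta> - \<epsilon> \<le> s" "s \<le> \<theta> + \<epsilon>" for s
    proof -
      have sg: "\<sigma> \<le> sin (t' - t)" unfolding \<sigma>_def using t \<epsilon> ab by (intro sin_ge_min) auto
      have "0 < sin (t' - s)" "0 < sin (s - t)" using s t ab \<epsilon> by (auto intro!: sin_gt_zero)
      moreover have "- \<bar>B\<bar> \<le> Re (z * cis t)" "- \<bar>B\<bar> \<le> Re (z * cis t')" using B by auto
      ultimately have "sin (t' - s) * - \<bar>B\<bar> + sin (s - t) * - \<bar>B\<bar> \<le> sin (t' - t) * Re (z * cis s)"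
        unfolding Re_mult_cis_interpolate[of t' t z s] by (intro add_mono mult_left_mono) auto
      moreover have "sin (t' - s) * - \<bar>B\<bar> \<ge> 1 * - \<bar>B\<bar>" "sin (s - t) * - \<bar>B\<bar> \<ge> 1 * - \<bar>B\<bar>"
        by (intro mult_right_mono_neg; simp)+
      ultimately have "- (2 * \<bar>B\<bar>) \<le> sin (t' - t) * Re (z * cis s)" by linarith
      moreover have "0 < sin (t' - t)" using sg \<sigma> by linarith
      ultimately have "- (2 * \<bar>B\<bar>) / sin (t' - t) \<le> Re (z * cis s)"
        by (simp only: pos_divide_le_eq mult.commute[of "Re (z * cis s)"])
      moreover have "2 * \<bar>B\<bar> / sin (t' - t) \<le> C" unfolding C_def using sg \<sigma> by (intro divide_left_mono) auto
      ultimately show ?thesis by simp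
    qed
    \<comment> \<open>If the real part at \<open>s\<close> were below \<open>K\<close>, the lower
      bounds at \<open>s + \<eta>\<close> and \<open>s - \<eta>\<close> would bound both components
      of \<open>z * cis s\<close>; \<open>N\<close> is the resulting bound for
      \<open>cmod z\<close>.\<close>
    have main: "K \<le> Re (z * cis s)" if s: "\<theta> - \<epsilon> \<le> s - \<eta>" "s + \<eta> \<le> \<theta> + \<epsilon>" for s
    proof (rule ccontr)
      define X Y where "X = Re (z * cis s)" and "Y = Im (z * cis s)"
      assume "\<not> K \<le> Re (z * cis s)"
      then have XK: "X < k" by (simp add: X_def k_def)
      have "- C \<le> Re (z * cis (s + \<eta>))" "- C \<le> Re (z * cis (s + - \<eta>))" by (rule low; use s \<eta> in linarith)+
      then have XY: "- C \<le> X * cos \<eta> - Y * sin \<eta>" "- C \<le> X * cos \<eta> + Y * sin \<eta>"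
        unfolding Re_mult_cis_add X_def Y_def by simp_all
      have k0: "0 \<le> k" by (simp add: k_def)
      have "X * cos \<eta> \<le> k * 1" using XK k0 sc by (intro mult_mono) auto
      then have "\<bar>Y\<bar> * sin \<eta> \<le> C + k" using XY sc by (cases "0 \<le> Y") auto
      then have Y: "\<bar>Y\<bar> \<le> (C + k) / sin \<eta>" using sc by (simp add: pos_le_divide_eq)
      have "- C \<le> X * cos \<eta>" using XY by linarith
      then have "- X \<le> C / cos \<eta>" using sc by (simp add: pos_le_divide_eq)
      moreover have "0 \<le> C / cos \<eta>" using C sc by simp
      ultimately have X: "\<bar>X\<bar> \<le> k + C / cos \<eta>" using XK k0 by linarith
      have "cmod z = cmod (z * cis s)" by (simp add: norm_mult)
      also have "\<dots> \<le> \<bar>X\<bar> + \<bar>Y\<bar>" unfolding X_def Y_def by (rule cmod_le)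
      also have "\<dots> \<le> N" unfolding N_def using X Y by linarith
      finally show False using N by simp
    qed
    show "K \<le> Re (z * cis (\<theta> - \<epsilon> / 2)) \<and> K \<le> Re (z * cis (\<theta> + \<epsilon> / 2))"
      by (intro conjI main; use \<epsilon> in \<open>simp add: \<eta>_def\<close>)
  qed
qed

section \<open>The Stokes identity and the estimate\<close>

text \<open>Used for the unit segment by which a contour leaves the ray: along it the exponential
  does not increase, and \<open>M\<close> bounds \<open>f\<close> on a compact set, independently of
  \<open>z\<close> and of the primitive.\<close>

lemma primitive_segment_bound:
  assumes f: "continuous_on T f" and T: "closed_segment c (c + cis t) \<subseteq> T"
  obtains M where "\<And>z P. (\<And>\<zeta>. \<zeta> \<in> T \<Longrightarrow> (P has_field_derivative f \<zeta> * exp (- (z * \<zeta>))) (at \<zeta>)) \<Longrightarrow>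
    0 \<le> Re (z * cis t) \<Longrightarrow> cmod (P (c + cis t) - P c) \<le> M * exp (- Re (z * c))"
proof -
  define I where "I = closed_segment c (c + cis t)"
  have "compact (f ` I)"
    unfolding I_def using continuous_on_subset[OF f T] by (intro compact_continuous_image) auto
  then have "bounded (f ` I)" by (rule compact_imp_bounded)
  then obtain M where M': "\<forall>y\<in>f ` I. cmod y \<le> M" unfolding bounded_iff ..
  have M: "cmod (f \<zeta>) \<le> M" if "\<zeta> \<in> I" for \<zeta> using M' that by simp
  have M0: "0 \<le> M" using order_trans[OF norm_ge_zero M[of c]] by (simp add: I_def)
  show thesis
  proof (rule that[of M])
    fix z P assume P: "\<And>\<zeta>. \<zeta> \<in> T \<Longrightarrow> (P has_field_derivative f \<zeta> * exp (- (z * \<zeta>))) (at \<zeta>)"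
      and z: "0 \<le> Re (z * cis t)"
    have "cmod (P (c + cis t) - P c) \<le> M * exp (- Re (z * c)) * cmod (c + cis t - c)"
    proof (rule field_differentiable_bound[of I])
      fix \<zeta> assume \<zeta>: "\<zeta> \<in> I"
      then show "(P has_field_derivative f \<zeta> * exp (- (z * \<zeta>))) (at \<zeta> within I)"
        by (intro has_field_derivative_at_within[OF P] subsetD[OF T]) (simp add: I_def)
      obtain s where s: "0 \<le> s" "s \<le> 1" "\<zeta> = (1 - s) *\<^sub>R c + s *\<^sub>R (c + cis t)"
        using \<zeta> unfolding I_def closed_segment_def by blast
      have "\<zeta> = c + of_real s * cis t" unfolding s(3) by (simp add: algebra_simps scaleR_conv_of_real)
      then have "Re (z * \<zeta>) = Re (z * c) + s * Re (z * cis t)" by (simp add: algebra_simps)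
      moreover have "0 \<le> s * Re (z * cis t)" using s(1) z by (rule mult_nonneg_nonneg)
      ultimately have "Re (z * c) \<le> Re (z * \<zeta>)" by linarith
      then have "cmod (exp (- (z * \<zeta>))) \<le> exp (- Re (z * c))" by (simp only: norm_exp_eq_Re uminus_complex.sel exp_le_cancel_iff neg_le_iff_le)
      then show "cmod (f \<zeta> * exp (- (z * \<zeta>))) \<le> M * exp (- Re (z * c))"
        unfolding norm_mult using M[OF \<zeta>] M0 by (intro mult_mono) auto
    qed (auto simp: I_def)
    then show "cmod (P (c + cis t) - P c) \<le> M * exp (- Re (z * c))" by simp
  qed
qed

text \<open>Here \<open>h j k\<close> stands for the contribution of component \<open>j\<close>
  through the gap after \<open>w k\<close>. Summed over \<open>k\<close>, the differences belonging
  to a fixed \<open>j\<close> telescope onto the last gap \<open>m\<close>.\<close>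

lemma sum_telescope_triangle:
  fixes h :: "nat \<Rightarrow> nat \<Rightarrow> 'a :: ab_group_add"
  shows "(\<Sum>k\<le>m. h k k + (\<Sum>j<k. h j k - h j (k - 1))) = (\<Sum>j\<le>m. h j m)"
proof (induction m)
  case (Suc m)
  have "(\<Sum>j<Suc m. h j (Suc m) - h j m) = (\<Sum>j\<le>m. h j (Suc m)) - (\<Sum>j\<le>m. h j m)"
    by (simp add: sum_subtractf lessThan_Suc_atMost)
  then show ?case using Suc by simp
qed simp

lemma eventually_eval_fps_sum:
  fixes f :: "'i \<Rightarrow> complex fps"
  assumes "\<And>i. i \<in> A \<Longrightarrow> 0 < fps_conv_radius (f i)"
  shows "\<forall>\<^sub>F z in nhds 0. eval_fps (\<Sum>i\<in>A. f i) z = (\<Sum>i\<in>A. eval_fps (f i) z)"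
proof -
  have "(\<lambda>z. \<Sum>i\<in>A. eval_fps (f i) z) has_fps_expansion (\<Sum>i\<in>A. f i)"
    using assms by (intro has_fps_expansion_sum eval_fps_has_fps_expansion) auto
  then show ?thesis unfolding has_fps_expansion_def by blast
qed

text \<open>Contains nothing about \<open>\<epsilon>\<close>, which enters only when directions of
  integration are chosen at the end.\<close>

locale stokes_setting =
  fixes \<theta> a b \<rho> :: real and \<Omega> :: "complex set"
    and w :: "nat \<Rightarrow> complex" and \<gamma> :: "real \<Rightarrow> real" and m :: nat and \<Phi> :: symbols
  assumes angles: "a < \<theta>" "\<theta> < b" "b - a < pi"
    and w: "\<Omega> \<inter> {of_real \<xi> * cis t | \<xi> t. 0 \<le> \<xi> \<and> t \<in> {a<..<b}} = range w"
      "range w \<subseteq> half_line \<theta>" "w 0 = 0" "strict_mono (\<lambda>n. cmod (w n))"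
    and gamma: "locally_bounded_on ({a<..<\<theta>} \<union> {\<theta><..<b}) \<gamma>"
    and rho: "cmod (w m) < \<rho>" "\<rho> < cmod (w (Suc m))"
    and Phi: "\<Phi> \<in> summable_symbols {a<..<b} \<theta> \<gamma> \<Omega> w m"
    and Stokes_Phi: "trunc w m (Stokes \<Omega> (half_line \<theta>) \<Phi>) \<in> summable_symbols {a<..<b} \<theta> \<gamma> \<Omega> w m"
begin

abbreviation "RS \<equiv> open_sector {a<..<\<theta>}"
abbreviation "LS \<equiv> open_sector {\<theta><..<b}"
abbreviation "\<Phi>' \<equiv> trunc w m (Stokes \<Omega> (half_line \<theta>) \<Phi>)"
abbreviation "\<Omega>\<^sub>w j \<equiv> translated \<Omega> (w j)"
abbreviation "gap j i \<equiv> cmod (w (j + i)) - cmod (w j)"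

lemma right_of_eq: "right_of {a<..<b} \<theta> = {a<..<\<theta>}" and left_of_eq: "left_of {a<..<b} \<theta> = {\<theta><..<b}"
  using angles by (auto simp: right_of_def left_of_def)

lemma w_eq: "w j = of_real (cmod (w j)) * cis \<theta>"
proof -
  have "w j \<in> half_line \<theta>" using w(2) by blast
  then show ?thesis by (auto simp: half_line_def norm_mult)
qed

lemma w_diff_eq: "j \<le> k \<Longrightarrow> w k - w j = of_real (gap j (k - j)) * cis \<theta>"
  by (subst (1 2) w_eq) (simp add: algebra_simps)

lemma cmod_w_less_iff: "cmod (w i) < cmod (w j) \<longleftrightarrow> i < j"
  using strict_mono_less[OF w(4)] by simp

lemma inj_w: "inj w"
proof (rule injI)
  fix i j assume "w i = w j"
  then have "cmod (w i) = cmod (w j)" by simp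
  then show "i = j" using strict_mono_eq[OF w(4)] by simp
qed

text \<open>The sector is stable under adding \<open>w j\<close>, so a singularity of the translated
  set in the sector is some \<open>w n\<close> seen from \<open>w j\<close>; lying in the open
  sector forces \<open>j < n\<close>.\<close>

lemma slit_sector: "slit_sector a b \<theta> (\<Omega>\<^sub>w j) (gap j)"
proof
  show "strict_mono (gap j)" by (auto simp: strict_mono_def cmod_w_less_iff)
  have mem: "\<zeta> \<in> \<Omega>\<^sub>w j \<longleftrightarrow> w j + \<zeta> \<in> \<Omega>" for \<zeta>
    unfolding translated_def by (force intro: image_eqI[of _ _ "w j + \<zeta>"])
  have cone: "w j + \<zeta> \<in> open_sector {a<..<b}" if "\<zeta> \<in> open_sector {a<..<b}" for \<zeta>
  proof (cases "w j = 0")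
    case False
    then have "w j \<in> open_sector {a<..<b}"
      using angles by (subst w_eq, intro cis_mem_open_sector) auto
    then show ?thesis using that angles by (intro open_sector_add) auto
  qed (use that in simp)
  show "\<Omega>\<^sub>w j \<inter> open_sector {a<..<b} = {of_real (gap j i) * cis \<theta> | i. 1 \<le> i}"
  proof (intro equalityI subsetI)
    fix \<zeta> assume \<zeta>: "\<zeta> \<in> \<Omega>\<^sub>w j \<inter> open_sector {a<..<b}"
    then have "w j + \<zeta> \<in> \<Omega>" "w j + \<zeta> \<in> open_sector {a<..<b}" using mem cone by auto
    then have "w j + \<zeta> \<in> range w"
      unfolding w(1)[symmetric] by (auto simp: open_sector_def intro: less_imp_le)
    then obtain n where n: "w j + \<zeta> = w n" by blast
    then have z: "\<zeta> = of_real (cmod (w n) - cmod (w j)) * cis \<theta>"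
      using w_eq[of n] w_eq[of j] by (simp add: algebra_simps)
    have "0 < Im (\<zeta> * cis (- a))"
      using \<zeta> mem_open_sector_iff[of a b \<zeta>] angles by auto
    then have "0 < (cmod (w n) - cmod (w j)) * sin (\<theta> - a)"
      unfolding z Im_of_real_cis_mult .
    moreover have "0 < sin (\<theta> - a)" using angles by (intro sin_gt_zero) auto
    ultimately have "cmod (w j) < cmod (w n)" using zero_less_mult_pos2 by fastforce
    then have "j < n" by (simp add: cmod_w_less_iff)
    then show "\<zeta> \<in> {of_real (gap j i) * cis \<theta> | i. 1 \<le> i}"
      using z by (intro CollectI exI[of _ "n - j"]) auto
  next
    fix \<zeta> assume "\<zeta> \<in> {of_real (gap j i) * cis \<theta> | i. 1 \<le> i}"
    then obtain i where i: "1 \<le> i" "\<zeta> = of_real (gap j i) * cis \<theta>" by blast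
    then have "\<zeta> = w (j + i) - w j" using w_diff_eq[of j "j + i"] by simp
    then have "w j + \<zeta> \<in> \<Omega>" using w(1) by auto
    moreover have "0 < gap j i" using i(1) cmod_w_less_iff[of j "j + i"] by simp
    then have "\<zeta> \<in> open_sector {a<..<b}"
      unfolding i(2) using angles by (intro cis_mem_open_sector) auto
    ultimately show "\<zeta> \<in> \<Omega>\<^sub>w j \<inter> open_sector {a<..<b}" using mem by blast
  qed
qed (use angles in auto)

lemma w_mem: "w j \<in> \<Omega> \<inter> half_line \<theta>"
  using w(1,2) by blast

lemma \<Omega>_half_line: "\<Omega> \<inter> half_line \<theta> = range w"
proof
  show "range w \<subseteq> \<Omega> \<inter> half_line \<theta>" using w_mem by blast
  have "half_line \<theta> \<subseteq> {of_real \<xi> * cis t | \<xi> t. 0 \<le> \<xi> \<and> t \<in> {a<..<b}}"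
    using angles unfolding half_line_def by fastforce
  then show "\<Omega> \<inter> half_line \<theta> \<subseteq> range w" using w(1) by blast
qed

lemma simple: "\<Phi> (w j) \<in> simple_resurgent (\<Omega>\<^sub>w j)"
  using Phi w_mem unfolding summable_symbols_def resurgent_symbols_def by blast

lemma exp_growth_sector_function:
  assumes "\<phi> \<in> exp_growth_germs {\<alpha><..<\<beta>} \<gamma>" "\<alpha> < \<beta>" "\<beta> - \<alpha> < pi" "{\<alpha><..<\<beta>} \<subseteq> {a<..<\<theta>} \<union> {\<theta><..<b}"
  shows "\<exists>F A. sector_function \<alpha> \<beta> \<gamma> A \<phi> F"
proof -
  obtain F A where "0 < fps_conv_radius \<phi>" "sector_extension {\<alpha><..<\<beta>} \<phi> F" "locally_bounded_on {\<alpha><..<\<beta>} A"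
    "\<forall>t\<in>{\<alpha><..<\<beta>}. 0 \<le> A t \<and> (\<forall>\<xi>>0. cmod (F (of_real \<xi> * cis t)) \<le> A t * exp (\<gamma> t * \<xi>))"
    using assms(1) unfolding exp_growth_germs_def by blast
  then have "sector_function \<alpha> \<beta> \<gamma> A \<phi> F"
    using assms(2,3) locally_bounded_on_subset[OF gamma assms(4)] by unfold_locales auto
  then show ?thesis by blast
qed

text \<open>Fixed once per component, for all \<open>z\<close> and all directions. On the left the
  analogous choice is made for the components of the truncated Stokes image, since only these have
  controlled growth there.\<close>

definition right_ext :: "nat \<Rightarrow> complex \<Rightarrow> complex" where
  "right_ext j = (SOME F. \<exists>A. sector_function a \<theta> \<gamma> A (snd (\<Phi> (w j))) F)"

definition left_ext :: "nat \<Rightarrow> complex \<Rightarrow> complex" where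
  "left_ext j = (SOME F. \<exists>A. sector_function \<theta> b \<gamma> A (snd (\<Phi>' (w j))) F)"

lemma right_function:
  assumes "j \<le> m"
  shows "\<exists>A. sector_function a \<theta> \<gamma> A (snd (\<Phi> (w j))) (right_ext j)"
  unfolding right_ext_def
proof (rule someI_ex[where P = "\<lambda>F. \<exists>A. sector_function a \<theta> \<gamma> A (snd (\<Phi> (w j))) F"], rule exp_growth_sector_function)
  show "snd (\<Phi> (w j)) \<in> exp_growth_germs {a<..<\<theta>} \<gamma>"
    using Phi assms unfolding summable_symbols_def right_of_eq by blast
qed (use angles in auto)

lemma left_function:
  assumes "j \<le> m"
  shows "\<exists>A. sector_function \<theta> b \<gamma> A (snd (\<Phi>' (w j))) (left_ext j)"
  unfolding left_ext_def
proof (rule someI_ex[where P = "\<lambda>F. \<exists>A. sector_function \<theta> b \<gamma> A (snd (\<Phi>' (w j))) F"], rule exp_growth_sector_function)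
  show "snd (\<Phi>' (w j)) \<in> exp_growth_germs {\<theta><..<b} \<gamma>"
    using Stokes_Phi assms unfolding summable_symbols_def left_of_eq by blast
qed (use angles in auto)

lemma resurgent_sector:
  assumes "j \<le> m"
  shows "resurgent_sector a b \<theta> (\<Omega>\<^sub>w j) (gap j) (snd (\<Phi> (w j))) (right_ext j)"
proof -
  interpret slit_sector a b \<theta> "\<Omega>\<^sub>w j" "gap j" by (rule slit_sector)
  obtain A where "sector_function a \<theta> \<gamma> A (snd (\<Phi> (w j))) (right_ext j)"
    using right_function[OF assms] by blast
  then interpret R: sector_function a \<theta> \<gamma> A "snd (\<Phi> (w j))" "right_ext j" .
  show ?thesis
  proof
    show "continuable (\<Omega>\<^sub>w j) (snd (\<Phi> (w j)))" using simple[of j] by (simp add: simple_resurgent_def)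
    show "sector_extension {a<..<\<theta>} (snd (\<Phi> (w j))) (right_ext j)" by (rule R.ext)
  qed
qed

abbreviation "br j \<equiv> resurgent_sector.branch a b \<theta> (gap j) (right_ext j)"
abbreviation "sl j \<equiv> slit_sector.slit a b \<theta> (gap j)"

definition jump :: "nat \<Rightarrow> nat \<Rightarrow> delta_germ" where
  "jump j k = Delta_plus (\<Omega>\<^sub>w j) (w k - w j) (\<Phi> (w j))"

lemma Stokes_component:
  assumes "k \<le> m"
  shows "\<Phi>' (w k) = \<Phi> (w k) + (\<Sum>j<k. jump j k)"
proof -
  have set: "{\<omega>. \<omega> \<in> \<Omega> \<inter> half_line \<theta> \<and> cmod \<omega> \<le> cmod (w k)} = w ` {..k}"
    unfolding \<Omega>_half_line using cmod_w_less_iff by (auto simp: not_less[symmetric])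
  have "\<Phi>' (w k) = (\<Sum>\<omega>\<in>w ` {..k}. Stokes_single \<Omega> (half_line \<theta>) \<omega> (\<Phi> \<omega>) (w k))"
    using assms by (simp add: trunc_def Stokes_def flip: set)
  also have "\<dots> = (\<Sum>j\<le>k. Stokes_single \<Omega> (half_line \<theta>) (w j) (\<Phi> (w j)) (w k))"
    by (rule sum.reindex_cong[of w]) (use inj_w in \<open>auto intro: inj_on_subset\<close>)
  also have "\<dots> = Stokes_single \<Omega> (half_line \<theta>) (w k) (\<Phi> (w k)) (w k) +
      (\<Sum>j<k. Stokes_single \<Omega> (half_line \<theta>) (w j) (\<Phi> (w j)) (w k))"
    by (simp add: lessThan_Suc_atMost[symmetric] add.commute)
  also have "(\<Sum>j<k. Stokes_single \<Omega> (half_line \<theta>) (w j) (\<Phi> (w j)) (w k)) = (\<Sum>j<k. jump j k)"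
  proof (rule sum.cong)
    fix j assume "j \<in> {..<k}"
    then have "w k \<noteq> w j" "cmod (w j) < cmod (w k)" using inj_w cmod_w_less_iff by (auto simp: inj_def)
    then show "Stokes_single \<Omega> (half_line \<theta>) (w j) (\<Phi> (w j)) (w k) = jump j k"
      using w_mem[of k] by (simp add: Stokes_single_def jump_def)
  qed simp
  finally show ?thesis by (simp add: Stokes_single_def)
qed

text \<open>\<open>P k\<close> is a primitive of the branch across the \<open>k\<close>-th gap beyond \<open>w j\<close>, in the coordinate
  centred at \<open>w j\<close>.\<close>

definition is_prim :: "complex \<Rightarrow> nat \<Rightarrow> (nat \<Rightarrow> complex \<Rightarrow> complex) \<Rightarrow> bool" where
  "is_prim z j P \<longleftrightarrow> (\<forall>k. \<forall>\<zeta>\<in>sl j k. (P k has_field_derivative br j k \<zeta> * exp (- (z * \<zeta>))) (at \<zeta>)) \<and>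
      (\<forall>k. \<forall>\<zeta>\<in>RS. P k \<zeta> = P 0 \<zeta>) \<and> (P 0 \<longlongrightarrow> 0) (at 0 within open_sector {a<..<b}) \<and>
      (\<forall>k>j. ((\<lambda>\<zeta>. P (k - j) (w k - w j + \<zeta>) - P (k - 1 - j) (w k - w j + \<zeta>))
        \<longlongrightarrow> fst (jump j k) * exp (- (z * (w k - w j)))) (at 0 within LS))"

text \<open>Renumbers from gaps to singular points: seen from \<open>w j\<close>, the point
  \<open>w k\<close> is singular point number \<open>k - 1 - j\<close>, between the gaps
  \<open>k - 1 - j\<close> and \<open>k - j\<close>.\<close>

lemma branch_facts:
  assumes j: "j \<le> m"
  shows "br j k holomorphic_on sl j k"
    "\<zeta> \<in> RS \<Longrightarrow> br j k \<zeta> = right_ext j \<zeta>"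
    "\<forall>\<^sub>F \<zeta> in at 0 within LS. br j 0 \<zeta> = eval_fps (snd (\<Phi> (w j))) \<zeta>"
    "j < k \<Longrightarrow> 0 < fps_conv_radius (snd (jump j k))"
    "j < k \<Longrightarrow> \<forall>\<^sub>F \<zeta> in at 0 within LS.
      br j (k - j) (w k - w j + \<zeta>) - br j (k - 1 - j) (w k - w j + \<zeta>) = eval_fps (snd (jump j k)) \<zeta>"
    "\<exists>P. is_prim z j P"
proof -
  interpret R: resurgent_sector a b \<theta> "\<Omega>\<^sub>w j" "gap j" "snd (\<Phi> (w j))" "right_ext j"
    by (rule resurgent_sector[OF j])
  have simp': "(fst (\<Phi> (w j)), snd (\<Phi> (w j))) \<in> simple_resurgent (\<Omega>\<^sub>w j)" using simple by simp
  have sp: "R.singular_point (k - 1 - j) = w k - w j" if "j < k" for k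
    using w_diff_eq[of j k] that unfolding R.singular_point_def by (simp add: Suc_diff_Suc)
  have Sk: "Suc (k - 1 - j) = k - j" if "j < k" for k using that by simp
  show "br j k holomorphic_on sl j k" by (rule R.holomorphic_branch)
  show "\<zeta> \<in> RS \<Longrightarrow> br j k \<zeta> = right_ext j \<zeta>" by (rule R.branch_eq)
  show "\<forall>\<^sub>F \<zeta> in at 0 within LS. br j 0 \<zeta> = eval_fps (snd (\<Phi> (w j))) \<zeta>"
    by (rule R.simple_resurgent_branches(1)[OF simp'])
  show "0 < fps_conv_radius (snd (jump j k))" if "j < k"
    using R.simple_resurgent_branches(2)[OF simp', of "k - 1 - j"] unfolding jump_def sp[OF that] by simp
  show "\<forall>\<^sub>F \<zeta> in at 0 within LS.
      br j (k - j) (w k - w j + \<zeta>) - br j (k - 1 - j) (w k - w j + \<zeta>) = eval_fps (snd (jump j k)) \<zeta>"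
    if "j < k"
    using R.simple_resurgent_branches(3)[OF simp', of "k - 1 - j"] unfolding jump_def sp[OF that] Sk[OF that] by simp
  obtain P where P: "\<forall>k. \<forall>\<zeta>\<in>sl j k. (P k has_field_derivative br j k \<zeta> * exp (- (z * \<zeta>))) (at \<zeta>)"
      "\<forall>k. \<forall>\<zeta>\<in>RS. P k \<zeta> = P 0 \<zeta>" "(P 0 \<longlongrightarrow> 0) (at 0 within open_sector {a<..<b})"
      "\<And>k. ((\<lambda>\<zeta>. P (Suc k) (R.singular_point k + \<zeta>) - P k (R.singular_point k + \<zeta>))
        \<longlongrightarrow> fst (Delta_plus (\<Omega>\<^sub>w j) (R.singular_point k) (fst (\<Phi> (w j)), snd (\<Phi> (w j)))) *
          exp (- (z * R.singular_point k))) (at 0 within LS)"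
    using R.simple_resurgent_branches(4)[OF simp', of z] by blast
  have "((\<lambda>\<zeta>. P (k - j) (w k - w j + \<zeta>) - P (k - 1 - j) (w k - w j + \<zeta>))
        \<longlongrightarrow> fst (jump j k) * exp (- (z * (w k - w j)))) (at 0 within LS)" if "j < k" for k
    using P(4)[of "k - 1 - j"] unfolding jump_def sp[OF that] Sk[OF that] prod.collapse .
  then show "\<exists>P. is_prim z j P" unfolding is_prim_def using P(1-3) by blast
qed

definition prim :: "complex \<Rightarrow> nat \<Rightarrow> nat \<Rightarrow> complex \<Rightarrow> complex" where
  "prim z j = (SOME P. is_prim z j P)"

lemma prim:
  assumes "j \<le> m"
  shows "\<zeta> \<in> sl j k \<Longrightarrow> (prim z j k has_field_derivative br j k \<zeta> * exp (- (z * \<zeta>))) (at \<zeta>)"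
    "\<zeta> \<in> RS \<Longrightarrow> prim z j k \<zeta> = prim z j 0 \<zeta>"
    "(prim z j 0 \<longlongrightarrow> 0) (at 0 within open_sector {a<..<b})"
    "j < k \<Longrightarrow> ((\<lambda>\<zeta>. prim z j (k - j) (w k - w j + \<zeta>) - prim z j (k - 1 - j) (w k - w j + \<zeta>))
        \<longlongrightarrow> fst (jump j k) * exp (- (z * (w k - w j)))) (at 0 within LS)"
proof -
  have P: "is_prim z j (prim z j)"
    unfolding prim_def by (rule someI_ex[OF branch_facts(6)[OF assms]])
  show "\<zeta> \<in> sl j k \<Longrightarrow> (prim z j k has_field_derivative br j k \<zeta> * exp (- (z * \<zeta>))) (at \<zeta>)"
    using P unfolding is_prim_def by blast
  show "\<zeta> \<in> RS \<Longrightarrow> prim z j k \<zeta> = prim z j 0 \<zeta>"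
    using P unfolding is_prim_def by blast
  show "(prim z j 0 \<longlongrightarrow> 0) (at 0 within open_sector {a<..<b})"
    using P unfolding is_prim_def by blast
  have "\<forall>k>j. ((\<lambda>\<zeta>. prim z j (k - j) (w k - w j + \<zeta>) - prim z j (k - 1 - j) (w k - w j + \<zeta>))
        \<longlongrightarrow> fst (jump j k) * exp (- (z * (w k - w j)))) (at 0 within LS)"
    using P unfolding is_prim_def by (elim conjE)
  then show "j < k \<Longrightarrow> ((\<lambda>\<zeta>. prim z j (k - j) (w k - w j + \<zeta>) - prim z j (k - 1 - j) (w k - w j + \<zeta>))
        \<longlongrightarrow> fst (jump j k) * exp (- (z * (w k - w j)))) (at 0 within LS)"
    by (elim allE[of _ k] impE)
qed

definition left_prim :: "complex \<Rightarrow> nat \<Rightarrow> complex \<Rightarrow> complex" where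
  "left_prim z k = (SOME Q. sector_function.is_primitive \<theta> b (left_ext k) z Q)"

lemma left_prim:
  assumes "k \<le> m"
  shows "sector_function.is_primitive \<theta> b (left_ext k) z (left_prim z k)"
proof -
  obtain A where "sector_function \<theta> b \<gamma> A (snd (\<Phi>' (w k))) (left_ext k)"
    using left_function[OF assms] by blast
  then interpret R: sector_function \<theta> b \<gamma> A "snd (\<Phi>' (w k))" "left_ext k" .
  show ?thesis unfolding left_prim_def by (rule someI_ex[OF R.ex_primitive])
qed

lemma open_Sl: "open LS" and convex_Sl: "convex LS" and Sl_limit: "0 islimpt LS" "at 0 within LS \<noteq> bot"
  using open_open_sector[of \<theta> b] convex_open_sector[of \<theta> b] angles zero_islimpt_open_sector[of "(\<theta> + b) / 2" "{\<theta><..<b}"]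
  by (auto simp: trivial_limit_within)

lemma Sl_subset: "LS \<subseteq> sl j k" and Sr_subset: "RS \<subseteq> sl j k"
proof -
  interpret slit_sector a b \<theta> "\<Omega>\<^sub>w j" "gap j" by (rule slit_sector)
  show "LS \<subseteq> sl j k" "RS \<subseteq> sl j k" by (rule Sl_subset_slit, rule Sr_subset_slit)
qed

text \<open>A shift along the ray only relaxes the two half-plane inequalities. It lets functions
  based at \<open>w j\<close> be evaluated in coordinates based at a later
  \<open>w k\<close>.\<close>

lemma ray_add_Sl:
  assumes "0 \<le> r" "\<zeta> \<in> LS" shows "of_real r * cis \<theta> + \<zeta> \<in> LS"
proof -
  have "0 \<le> Im (of_real r * cis \<theta> * cis (- \<theta>))" "Im (of_real r * cis \<theta> * cis (- b)) \<le> 0"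
  proof -
    have "sin (\<theta> - b) \<le> 0"
      using sin_gt_zero[of "b - \<theta>"] sin_minus[of "b - \<theta>"] angles by simp
    then show "0 \<le> Im (of_real r * cis \<theta> * cis (- \<theta>))" "Im (of_real r * cis \<theta> * cis (- b)) \<le> 0"
      unfolding Im_of_real_cis_mult using assms(1) by (simp_all add: mult_nonneg_nonpos)
  qed
  moreover have "0 < Im (\<zeta> * cis (- \<theta>))" "Im (\<zeta> * cis (- b)) < 0"
    using assms(2) mem_open_sector_iff[of \<theta> b \<zeta>] angles by auto
  ultimately show ?thesis
    using mem_open_sector_iff[of \<theta> b "of_real r * cis \<theta> + \<zeta>"] angles
    by (simp only: distrib_right plus_complex.sel) linarith
qed

lemma ray_add_Sr:
  assumes "0 \<le> r" "\<zeta> \<in> RS" shows "of_real r * cis \<theta> + \<zeta> \<in> RS"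
proof -
  have "0 \<le> Im (of_real r * cis \<theta> * cis (- a))" "Im (of_real r * cis \<theta> * cis (- \<theta>)) \<le> 0"
  proof -
    have "0 \<le> sin (\<theta> - a)" using sin_gt_zero[of "\<theta> - a"] angles by simp
    then show "0 \<le> Im (of_real r * cis \<theta> * cis (- a))" "Im (of_real r * cis \<theta> * cis (- \<theta>)) \<le> 0"
      unfolding Im_of_real_cis_mult using assms(1) by simp_all
  qed
  moreover have "0 < Im (\<zeta> * cis (- a))" "Im (\<zeta> * cis (- \<theta>)) < 0"
    using assms(2) mem_open_sector_iff[of a \<theta> \<zeta>] angles by auto
  ultimately show ?thesis
    using mem_open_sector_iff[of a \<theta> "of_real r * cis \<theta> + \<zeta>"] angles
    by (simp only: distrib_right plus_complex.sel) linarith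
qed

lemma w_diff_add_Sl: "j \<le> k \<Longrightarrow> \<zeta> \<in> LS \<Longrightarrow> w k - w j + \<zeta> \<in> LS"
  unfolding w_diff_eq using cmod_w_less_iff[of k j] by (intro ray_add_Sl) (auto simp: not_less[symmetric])

abbreviation "e z j \<equiv> exp (- (w j * z))"

text \<open>Near 0 both sides sum the same germs: the minor of \<open>\<Phi> (w k)\<close> and the
  minors of the jumps of all earlier components. The identity theorem extends this to the left
  sector, although the single terms carry no growth bound there.\<close>

lemma left_ext_eq:
  assumes k: "k \<le> m" and \<zeta>: "\<zeta> \<in> LS"
  shows "left_ext k \<zeta> = br k 0 \<zeta> + (\<Sum>j<k. br j (k - j) (w k - w j + \<zeta>) - br j (k - 1 - j) (w k - w j + \<zeta>))"
proof -
  obtain A where "sector_function \<theta> b \<gamma> A (snd (\<Phi>' (w k))) (left_ext k)"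
    using left_function[OF k] by blast
  then interpret R: sector_function \<theta> b \<gamma> A "snd (\<Phi>' (w k))" "left_ext k" .
  have rad: "0 < fps_conv_radius (snd (\<Phi> (w k)))"
  proof -
    obtain A where "sector_function a \<theta> \<gamma> A (snd (\<Phi> (w k))) (right_ext k)"
      using right_function[OF k] by blast
    then show ?thesis by (rule sector_function.radius)
  qed
  define f where "f j = (if j = k then snd (\<Phi> (w k)) else snd (jump j k))" for j
  have f: "snd (\<Phi>' (w k)) = (\<Sum>j\<le>k. f j)"
    unfolding Stokes_component[OF k] lessThan_Suc_atMost[symmetric] by (simp add: f_def snd_sum add.commute)
  have fr: "0 < fps_conv_radius (f j)" if "j \<le> k" for j
    using that rad branch_facts(4)[of j k] k by (auto simp: f_def)
  show ?thesis
  proof (rule eventually_eq_at_boundary_imp_eq[OF open_Sl convex_Sl, where a = 0 and f = "left_ext k"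
        and g = "\<lambda>\<zeta>. br k 0 \<zeta> + (\<Sum>j<k. br j (k - j) (w k - w j + \<zeta>) - br j (k - 1 - j) (w k - w j + \<zeta>))"])
    show "left_ext k holomorphic_on LS" by (rule R.holomorphic_F)
    have "br j i holomorphic_on LS" if "j \<le> m" for j i
      using branch_facts(1)[OF that] Sl_subset holomorphic_on_subset by blast
    then show "(\<lambda>\<zeta>. br k 0 \<zeta> + (\<Sum>j<k. br j (k - j) (w k - w j + \<zeta>) - br j (k - 1 - j) (w k - w j + \<zeta>))) holomorphic_on LS"
      using k w_diff_add_Sl by (intro holomorphic_intros holomorphic_on_shift[where T = LS]) auto
    have 1: "\<forall>\<^sub>F \<zeta> in at 0 within LS. left_ext k \<zeta> = eval_fps (\<Sum>j\<le>k. f j) \<zeta>"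
      using R.ext unfolding sector_extension_def f by blast
    have "\<forall>\<^sub>F \<zeta> in nhds 0. eval_fps (\<Sum>j\<le>k. f j) \<zeta> = (\<Sum>j\<le>k. eval_fps (f j) \<zeta>)"
      using fr by (intro eventually_eval_fps_sum) auto
    then have 2: "\<forall>\<^sub>F \<zeta> in at 0 within LS. eval_fps (\<Sum>j\<le>k. f j) \<zeta> = (\<Sum>j\<le>k. eval_fps (f j) \<zeta>)"
      by (rule filter_leD[OF at_within_le_nhds])
    have 3: "\<forall>\<^sub>F \<zeta> in at 0 within LS. br k 0 \<zeta> = eval_fps (snd (\<Phi> (w k))) \<zeta>"
      by (rule branch_facts(3)[OF k])
    have "\<forall>\<^sub>F \<zeta> in at 0 within LS. \<forall>j\<in>{..<k}.
        br j (k - j) (w k - w j + \<zeta>) - br j (k - 1 - j) (w k - w j + \<zeta>) = eval_fps (snd (jump j k)) \<zeta>"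
      using k by (intro eventually_ball_finite ballI branch_facts(5)) auto
    with 1 2 3 show "\<forall>\<^sub>F \<zeta> in at 0 within LS. left_ext k \<zeta> =
        br k 0 \<zeta> + (\<Sum>j<k. br j (k - j) (w k - w j + \<zeta>) - br j (k - 1 - j) (w k - w j + \<zeta>))"
    proof eventually_elim
      case (elim \<zeta>)
      have "(\<Sum>j\<le>k. eval_fps (f j) \<zeta>) = eval_fps (snd (\<Phi> (w k))) \<zeta> + (\<Sum>j<k. eval_fps (snd (jump j k)) \<zeta>)"
        unfolding lessThan_Suc_atMost[symmetric] by (simp add: f_def add.commute)
      also have "(\<Sum>j<k. eval_fps (snd (jump j k)) \<zeta>) =
          (\<Sum>j<k. br j (k - j) (w k - w j + \<zeta>) - br j (k - 1 - j) (w k - w j + \<zeta>))"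
        using elim(4) by (intro sum.cong) auto
      finally show ?case using elim(1-3) by simp
    qed
  qed (use Sl_limit \<zeta> in auto)
qed

text \<open>Integrated form of \<open>left_ext_eq\<close>. The derivatives agree by that lemma, and
  the integration constant is found at the vertex.\<close>

lemma left_prim_eq:
  assumes k: "k \<le> m" and \<zeta>: "\<zeta> \<in> LS"
  shows "e z k * (fst (\<Phi>' (w k)) + left_prim z k \<zeta>) = e z k * fst (\<Phi> (w k)) + e z k * prim z k 0 \<zeta> +
    (\<Sum>j<k. e z j * prim z j (k - j) (w k - w j + \<zeta>) - e z j * prim z j (k - 1 - j) (w k - w j + \<zeta>))"
proof -
  obtain A where "sector_function \<theta> b \<gamma> A (snd (\<Phi>' (w k))) (left_ext k)"
    using left_function[OF k] by blast
  then interpret R: sector_function \<theta> b \<gamma> A "snd (\<Phi>' (w k))" "left_ext k" .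
  have lp: "(left_prim z k has_field_derivative left_ext k \<zeta> * exp (- (z * \<zeta>))) (at \<zeta>)" if "\<zeta> \<in> LS" for \<zeta>
    using left_prim[OF k] that unfolding R.is_primitive_def by blast
  have lp0: "(left_prim z k \<longlongrightarrow> 0) (at 0 within LS)"
    using left_prim[OF k] unfolding R.is_primitive_def by blast
  define T where "T \<zeta> = e z k * (fst (\<Phi>' (w k)) + left_prim z k \<zeta>) - (e z k * fst (\<Phi> (w k)) + e z k * prim z k 0 \<zeta> +
    (\<Sum>j<k. e z j * (prim z j (k - j) (w k - w j + \<zeta>) - prim z j (k - 1 - j) (w k - w j + \<zeta>))))" for \<zeta>
  have "\<exists>c. \<forall>\<zeta>\<in>LS. T \<zeta> = c"
  proof (rule has_field_derivative_zero_constant[OF convex_Sl])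
    fix \<zeta> assume \<zeta>: "\<zeta> \<in> LS"
    have in_sl: "\<zeta> \<in> sl j i" and in_sl': "j < k \<Longrightarrow> w k - w j + \<zeta> \<in> sl j i" for j i
      using Sl_subset \<zeta> w_diff_add_Sl[of j k \<zeta>] by auto
    have shift: "((\<lambda>\<zeta>. prim z j i (w k - w j + \<zeta>)) has_field_derivative
        br j i (w k - w j + \<zeta>) * exp (- (z * (w k - w j + \<zeta>)))) (at \<zeta>)" if "j < k" for j i
    proof -
      have "(prim z j i has_field_derivative br j i (w k - w j + \<zeta>) * exp (- (z * (w k - w j + \<zeta>)))) (at (w k - w j + \<zeta>))"
        using prim(1)[OF _ in_sl'[OF that]] that k by simp
      moreover have "((\<lambda>\<zeta>. w k - w j + \<zeta>) has_field_derivative 1) (at \<zeta>)"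
        by (auto intro!: derivative_eq_intros)
      ultimately show ?thesis using DERIV_chain2 by fastforce
    qed
    have "(T has_field_derivative e z k * (0 + left_ext k \<zeta> * exp (- (z * \<zeta>))) -
        (0 + e z k * (br k 0 \<zeta> * exp (- (z * \<zeta>))) + (\<Sum>j<k. e z j *
          (br j (k - j) (w k - w j + \<zeta>) * exp (- (z * (w k - w j + \<zeta>)))
          - br j (k - 1 - j) (w k - w j + \<zeta>) * exp (- (z * (w k - w j + \<zeta>))))))) (at \<zeta>)"
      unfolding T_def[abs_def]
      by (intro DERIV_diff DERIV_add DERIV_const DERIV_cmult DERIV_sum lp \<zeta> prim(1)[OF k] in_sl shift) simp_all
    moreover have "e z k * (0 + left_ext k \<zeta> * exp (- (z * \<zeta>))) -
        (0 + e z k * (br k 0 \<zeta> * exp (- (z * \<zeta>))) + (\<Sum>j<k. e z j *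
          (br j (k - j) (w k - w j + \<zeta>) * exp (- (z * (w k - w j + \<zeta>)))
          - br j (k - 1 - j) (w k - w j + \<zeta>) * exp (- (z * (w k - w j + \<zeta>)))))) = 0"
    proof -
      \<comment> \<open>The prefactors turn exponentials centred at \<open>w j\<close> into those
        centred at \<open>w k\<close>, so all terms share one factor.\<close>
      have E: "e z j * exp (- (z * (w k - w j + \<zeta>))) = e z k * exp (- (z * \<zeta>))" for j
        unfolding exp_add[symmetric] by (simp add: algebra_simps)
      have "(\<Sum>j<k. e z j * (br j (k - j) (w k - w j + \<zeta>) * exp (- (z * (w k - w j + \<zeta>)))
          - br j (k - 1 - j) (w k - w j + \<zeta>) * exp (- (z * (w k - w j + \<zeta>))))) =
        (\<Sum>j<k. (e z k * exp (- (z * \<zeta>))) * (br j (k - j) (w k - w j + \<zeta>) - br j (k - 1 - j) (w k - w j + \<zeta>)))"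
      proof -
        have "u * (p * v - q * v) = (u * v) * (p - q)" for u p q v :: complex
          by (simp add: algebra_simps)
        then show ?thesis by (simp only: E)
      qed
      also have "\<dots> = (e z k * exp (- (z * \<zeta>))) * (\<Sum>j<k. br j (k - j) (w k - w j + \<zeta>) - br j (k - 1 - j) (w k - w j + \<zeta>))"
        by (rule sum_distrib_left[symmetric])
      finally show ?thesis unfolding left_ext_eq[OF k \<zeta>] by (simp add: algebra_simps)
    qed
    ultimately show "(T has_field_derivative 0) (at \<zeta> within LS)"
      by (simp add: has_field_derivative_at_within)
  qed
  then obtain c where c: "\<And>\<zeta>. \<zeta> \<in> LS \<Longrightarrow> T \<zeta> = c" by blast
  have sub: "LS \<subseteq> open_sector {a<..<b}" using angles by (intro open_sector_mono) auto
  \<comment> \<open>The primitives normalised at \<open>w k\<close> vanish in the limit, and each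
    jump leaves its polar coefficient; these sum to the constant term gained under the Stokes
    operator.\<close>
  have "(T \<longlongrightarrow> e z k * (fst (\<Phi>' (w k)) + 0) - (e z k * fst (\<Phi> (w k)) + e z k * 0 +
      (\<Sum>j<k. e z j * (fst (jump j k) * exp (- (z * (w k - w j))))))) (at 0 within LS)"
    unfolding T_def[abs_def]
    by (intro tendsto_diff tendsto_add tendsto_const tendsto_mult_left tendsto_sum lp0 prim(4)
        tendsto_within_subset[OF prim(3)[OF k] sub]) (use k in auto)
  moreover have "e z k * (fst (\<Phi>' (w k)) + 0) - (e z k * fst (\<Phi> (w k)) + e z k * 0 +
      (\<Sum>j<k. e z j * (fst (jump j k) * exp (- (z * (w k - w j)))))) = 0"
  proof -
    have E: "e z j * exp (- (z * (w k - w j))) = e z k" for j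
      unfolding exp_add[symmetric] by (simp add: algebra_simps)
    have "(\<Sum>j<k. e z j * (fst (jump j k) * exp (- (z * (w k - w j))))) = (\<Sum>j<k. e z k * fst (jump j k))"
      using E by (intro sum.cong) (auto simp: mult_ac)
    also have "\<dots> = e z k * (\<Sum>j<k. fst (jump j k))" by (rule sum_distrib_left[symmetric])
    finally show ?thesis unfolding Stokes_component[OF k] by (simp add: fst_sum algebra_simps)
  qed
  ultimately have "(T \<longlongrightarrow> 0) (at 0 within LS)" by simp
  moreover have "(T \<longlongrightarrow> c) (at 0 within LS)"
    by (rule Lim_transform_eventually[OF tendsto_const]) (auto simp: eventually_at_filter c)
  ultimately have "c = 0" using tendsto_unique[OF Sl_limit(2)] by blast
  then have "T \<zeta> = 0" using c[OF \<zeta>] by simp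
  then show ?thesis unfolding T_def right_diff_distrib by simp
qed

text \<open>Applied at a common end point \<open>q\<close>, the sum over \<open>k\<close> telescopes
  to the branches through the single gap after \<open>w m\<close>, based at every
  \<open>w j\<close>.\<close>

lemma stokes_identity:
  assumes q: "\<And>k. k \<le> m \<Longrightarrow> q - w k \<in> LS"
  shows "(\<Sum>k\<le>m. e z k * (fst (\<Phi>' (w k)) + left_prim z k (q - w k))) =
    (\<Sum>k\<le>m. e z k * fst (\<Phi> (w k))) + (\<Sum>j\<le>m. e z j * prim z j (m - j) (q - w j))"
proof -
  define h where "h j k = e z j * prim z j (k - j) (q - w j)" for j k
  have "e z k * (fst (\<Phi>' (w k)) + left_prim z k (q - w k)) =
      e z k * fst (\<Phi> (w k)) + (h k k + (\<Sum>j<k. h j k - h j (k - 1)))" if k: "k \<le> m" for k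
    using left_prim_eq[OF k q[OF k], of z] unfolding h_def by simp
  then have "(\<Sum>k\<le>m. e z k * (fst (\<Phi>' (w k)) + left_prim z k (q - w k))) =
      (\<Sum>k\<le>m. e z k * fst (\<Phi> (w k)) + (h k k + (\<Sum>j<k. h j k - h j (k - 1))))"
    by (intro sum.cong) auto
  also have "\<dots> = (\<Sum>k\<le>m. e z k * fst (\<Phi> (w k))) + (\<Sum>j\<le>m. h j m)"
    by (simp only: sum.distrib[of "\<lambda>k. e z k * fst (\<Phi> (w k))"] sum_telescope_triangle)
  finally show ?thesis unfolding h_def .
qed

end

section \<open>Bounds for the difference of the two transforms\<close>

context stokes_setting
begin

lemma laplace_right_eq:
  assumes "j \<le> m" "t \<in> {a<..<\<theta>}" "\<gamma> t < Re (z * cis t)"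
  shows "laplace {a<..<\<theta>} \<gamma> (\<Phi> (w j)) z = fst (\<Phi> (w j)) + ray_laplace (right_ext j) t z"
proof -
  obtain A where "sector_function a \<theta> \<gamma> A (snd (\<Phi> (w j))) (right_ext j)"
    using right_function[OF assms(1)] by blast
  then interpret R: sector_function a \<theta> \<gamma> A "snd (\<Phi> (w j))" "right_ext j" .
  show ?thesis using R.laplace_eq[OF assms(2,3), of "fst (\<Phi> (w j))"] by simp
qed

lemma laplace_left_eq:
  assumes "j \<le> m" "t \<in> {\<theta><..<b}" "\<gamma> t < Re (z * cis t)"
  shows "laplace {\<theta><..<b} \<gamma> (\<Phi>' (w j)) z = fst (\<Phi>' (w j)) + ray_laplace (left_ext j) t z"
proof -
  obtain A where "sector_function \<theta> b \<gamma> A (snd (\<Phi>' (w j))) (left_ext j)"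
    using left_function[OF assms(1)] by blast
  then interpret R: sector_function \<theta> b \<gamma> A "snd (\<Phi>' (w j))" "left_ext j" .
  show ?thesis using R.laplace_eq[OF assms(2,3), of "fst (\<Phi>' (w j))"] by simp
qed

text \<open>Big-O along \<open>principal Z\<close> is a bound uniform on all of \<open>Z\<close>.
  The exponential prefactors are harmless since \<open>Z\<close> is bounded.\<close>

lemma laplace_symbols_bounded:
  assumes "\<And>j. j \<le> m \<Longrightarrow> \<exists>C. \<forall>z\<in>Z. cmod (laplace J \<gamma> (\<Psi> (w j)) z) \<le> C"
    and Z: "\<And>z. z \<in> Z \<Longrightarrow> cmod z \<le> N"
  shows "laplace_symbols J \<gamma> w m \<Psi> \<in> O[principal Z](\<lambda>_. 1)"
  unfolding laplace_symbols_def
proof (rule big_sum_in_bigo)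
  fix j assume "j \<in> {..m}"
  then obtain C where C: "\<And>z. z \<in> Z \<Longrightarrow> cmod (laplace J \<gamma> (\<Psi> (w j)) z) \<le> C" using assms(1) by blast
  show "(\<lambda>z. e z j * laplace J \<gamma> (\<Psi> (w j)) z) \<in> O[principal Z](\<lambda>_. 1)"
  proof (rule bigoI[where c = "exp (cmod (w j) * N) * C"], unfold eventually_principal, rule ballI)
    fix z assume z: "z \<in> Z"
    have "cmod (e z j) \<le> exp (cmod (- (w j * z)))" by (rule norm_exp)
    also have "\<dots> \<le> exp (cmod (w j) * N)" using Z[OF z] by (simp add: norm_mult mult_left_mono)
    finally show "cmod (e z j * laplace J \<gamma> (\<Psi> (w j)) z) \<le> exp (cmod (w j) * N) * C * cmod 1"
      using C[OF z] by (simp add: norm_mult mult_mono)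
  qed
qed

text \<open>For bounded \<open>z\<close> no cancellation is used: each transform is bounded
  separately.\<close>

lemma difference_bounded:
  assumes lo: "lo \<in> {a<..<\<theta>}" "hi \<in> {a<..<\<theta>}" and lo': "lo' \<in> {\<theta><..<b}" "hi' \<in> {\<theta><..<b}" and \<kappa>: "0 < \<kappa>"
    and Z: "\<And>z. z \<in> Z \<Longrightarrow> cmod z \<le> N"
      "\<And>z. z \<in> Z \<Longrightarrow> \<exists>t. lo \<le> t \<and> t \<le> hi \<and> \<gamma> t + \<kappa> < Re (z * cis t)"
      "\<And>z. z \<in> Z \<Longrightarrow> \<exists>t. lo' \<le> t \<and> t \<le> hi' \<and> \<gamma> t + \<kappa> < Re (z * cis t)"
  shows "(\<lambda>z. laplace_symbols {a<..<\<theta>} \<gamma> w m \<Phi> z - laplace_symbols {\<theta><..<b} \<gamma> w m \<Phi>' z)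
    \<in> O[principal Z](\<lambda>_. 1)"
proof (rule sum_in_bigo(2); rule laplace_symbols_bounded[OF _ Z(1)])
  fix j assume j: "j \<le> m"
  obtain A where "sector_function a \<theta> \<gamma> A (snd (\<Phi> (w j))) (right_ext j)"
    using right_function[OF j] by blast
  then interpret R: sector_function a \<theta> \<gamma> A "snd (\<Phi> (w j))" "right_ext j" .
  obtain C where C: "\<And>t z. lo \<le> t \<Longrightarrow> t \<le> hi \<Longrightarrow> \<gamma> t + \<kappa> < Re (z * cis t) \<Longrightarrow>
      cmod (laplace {a<..<\<theta>} \<gamma> (fst (\<Phi> (w j)), snd (\<Phi> (w j))) z) \<le> C"
    using R.laplace_bounded[OF lo \<kappa>] by blast
  show "\<exists>C. \<forall>z\<in>Z. cmod (laplace {a<..<\<theta>} \<gamma> (\<Phi> (w j)) z) \<le> C"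
  proof (intro exI[of _ C] ballI)
    fix z assume "z \<in> Z"
    then obtain t where "lo \<le> t" "t \<le> hi" "\<gamma> t + \<kappa> < Re (z * cis t)" using Z(2) by blast
    from C[OF this] show "cmod (laplace {a<..<\<theta>} \<gamma> (\<Phi> (w j)) z) \<le> C" by simp
  qed
next
  fix j assume j: "j \<le> m"
  obtain A where "sector_function \<theta> b \<gamma> A (snd (\<Phi>' (w j))) (left_ext j)"
    using left_function[OF j] by blast
  then interpret R: sector_function \<theta> b \<gamma> A "snd (\<Phi>' (w j))" "left_ext j" .
  obtain C where C: "\<And>t z. lo' \<le> t \<Longrightarrow> t \<le> hi' \<Longrightarrow> \<gamma> t + \<kappa> < Re (z * cis t) \<Longrightarrow>
      cmod (laplace {\<theta><..<b} \<gamma> (fst (\<Phi>' (w j)), snd (\<Phi>' (w j))) z) \<le> C"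
    using R.laplace_bounded[OF lo' \<kappa>] by blast
  show "\<exists>C. \<forall>z\<in>Z. cmod (laplace {\<theta><..<b} \<gamma> (\<Phi>' (w j)) z) \<le> C"
  proof (intro exI[of _ C] ballI)
    fix z assume "z \<in> Z"
    then obtain t where "lo' \<le> t" "t \<le> hi'" "\<gamma> t + \<kappa> < Re (z * cis t)" using Z(3) by blast
    from C[OF this] show "cmod (laplace {\<theta><..<b} \<gamma> (\<Phi>' (w j)) z) \<le> C" by simp
  qed
qed

definition point :: complex where "point = of_real \<rho> * cis \<theta>"

lemma point_diff: "point - w j = of_real (\<rho> - cmod (w j)) * cis \<theta>"
  by (subst w_eq) (simp add: point_def algebra_simps)

lemma cmod_w_less_rho: "j \<le> m \<Longrightarrow> cmod (w j) < \<rho>"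
  using rho(1) cmod_w_less_iff[of m j] by (auto simp: not_less[symmetric])

lemma point_right: "j \<le> m \<Longrightarrow> t \<in> {a<..<\<theta>} \<Longrightarrow> 0 < s \<Longrightarrow> point - w j + of_real s * cis t \<in> RS"
  unfolding point_diff using cmod_w_less_rho[of j] by (intro ray_add_Sr cis_mem_open_sector) auto

lemma point_left: "j \<le> m \<Longrightarrow> t \<in> {\<theta><..<b} \<Longrightarrow> 0 < s \<Longrightarrow> point - w j + of_real s * cis t \<in> LS"
  unfolding point_diff using cmod_w_less_rho[of j] by (intro ray_add_Sl cis_mem_open_sector) auto

lemma point_mem_slit:
  assumes "j \<le> m"
  shows "point - w j \<in> sl j (m - j)"
proof -
  interpret slit_sector a b \<theta> "\<Omega>\<^sub>w j" "gap j" by (rule slit_sector)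
  have "0 < \<rho> - cmod (w j)" using cmod_w_less_rho[OF assms] by simp
  moreover have "gap j (m - j) < \<rho> - cmod (w j)" "\<rho> - cmod (w j) < gap j (Suc (m - j))"
    using rho assms by simp_all
  ultimately show ?thesis
    unfolding point_diff using ray_mem_slit_iff by blast
qed

lemma segment_subset_slit:
  assumes j: "j \<le> m" and t: "t \<in> {a<..<\<theta>} \<or> t \<in> {\<theta><..<b}"
  shows "closed_segment (point - w j) (point - w j + cis t) \<subseteq> sl j (m - j)"
proof
  fix \<zeta> assume "\<zeta> \<in> closed_segment (point - w j) (point - w j + cis t)"
  then obtain s where s: "0 \<le> s" "\<zeta> = (1 - s) *\<^sub>R (point - w j) + s *\<^sub>R (point - w j + cis t)"
    unfolding closed_segment_def by blast
  have \<zeta>: "\<zeta> = point - w j + of_real s * cis t"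
    unfolding s(2) by (simp add: algebra_simps scaleR_conv_of_real)
  show "\<zeta> \<in> sl j (m - j)"
  proof (cases "s = 0")
    case True
    then show ?thesis using point_mem_slit[OF j] by (simp add: \<zeta>)
  next
    case False
    then have "\<zeta> \<in> RS \<union> LS" unfolding \<zeta> using t s(1) j point_right point_left by auto
    then show ?thesis using Sl_subset Sr_subset by blast
  qed
qed

section \<open>Remainders along two fixed directions\<close>

context
  fixes t t' :: real
  assumes t: "t \<in> {a<..<\<theta>}" and t': "t' \<in> {\<theta><..<b}"
begin

text \<open>Both real parts tend to infinity, with no other restriction on \<open>z\<close>. Big-O
  along this filter therefore amounts to uniform constants \<open>C\<close> and \<open>K\<close>,
  while finite sums of remainders are handled by the calculus of big-O.\<close>

definition far :: "complex filter" where
  "far = filtercomap (\<lambda>z. min (Re (z * cis t)) (Re (z * cis t'))) at_top"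

lemma eventually_far: "\<forall>\<^sub>F z in far. K \<le> Re (z * cis t) \<and> K \<le> Re (z * cis t')"
  unfolding far_def using eventually_filtercomapI[OF eventually_ge_at_top[of K]]
  by (rule eventually_mono) auto

lemma cmod_e_mult: "cmod (e z j) * exp (- Re (z * (q - w j))) = exp (- Re (z * q))"
proof -
  have "cmod (e z j) = exp (- Re (w j * z))" by simp
  moreover have "Re (w j * z) + Re (z * (q - w j)) = Re (z * q)"
    by (simp add: algebra_simps)
  ultimately show ?thesis by (simp only: exp_add[symmetric]) (simp only: add.inverse_distrib_swap[symmetric] add.commute)
qed

text \<open>The prefactor moves an estimate relative to \<open>w j\<close> back to absolute
  position, and the extra displacement by \<open>u\<close> in direction \<open>s\<close> only helps
  once \<open>Re (z * cis s)\<close> is non-negative.\<close>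

lemma bigo_farI:
  assumes "\<And>z. K \<le> Re (z * cis t) \<Longrightarrow> K \<le> Re (z * cis t') \<Longrightarrow> 0 \<le> Re (z * cis s) \<Longrightarrow>
      cmod (g z) \<le> C * exp (- Re (z * (point + of_real u * cis s - w j)))"
    and "s = t \<or> s = t'" "0 \<le> C" "0 \<le> u"
  shows "(\<lambda>z. e z j * g z) \<in> O[far](\<lambda>z. exp (- (z * point)))"
proof (rule bigoI[where c = C], rule eventually_mono[OF eventually_far[of "max K 0"]])
  fix z assume z: "max K 0 \<le> Re (z * cis t) \<and> max K 0 \<le> Re (z * cis t')"
  then have s0: "0 \<le> Re (z * cis s)" using assms(2) by auto
  have "cmod (e z j * g z) \<le> cmod (e z j) * (C * exp (- Re (z * (point + of_real u * cis s - w j))))"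
    unfolding norm_mult using z s0 by (intro mult_left_mono assms(1)) auto
  also have "\<dots> = C * (cmod (e z j) * exp (- Re (z * (point + of_real u * cis s - w j))))"
    by (simp only: mult.left_commute)
  also have "\<dots> = C * exp (- Re (z * (point + of_real u * cis s)))" by (simp only: cmod_e_mult)
  also have "Re (z * (point + of_real u * cis s)) = Re (z * point) + u * Re (z * cis s)"
    by (simp add: algebra_simps)
  also have "C * exp (- (Re (z * point) + u * Re (z * cis s))) \<le> C * exp (- Re (z * point))"
  proof -
    have "- (Re (z * point) + u * Re (z * cis s)) \<le> - Re (z * point)"
      using mult_nonneg_nonneg[OF assms(4) s0] by linarith
    then show ?thesis by (intro mult_left_mono assms(3)) (simp only: exp_le_cancel_iff)
  qed
  also have "\<dots> = C * cmod (exp (- (z * point)))" by (simp only: norm_exp_eq_Re uminus_complex.sel)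
  finally show "cmod (e z j * g z) \<le> C * cmod (exp (- (z * point)))" .
qed

text \<open>\<open>prim z j 0\<close> is a normalised primitive for the right extension too, so the
  tail estimate applies with its value one unit off the ray. There it also equals the primitive
  through the last gap.\<close>

lemma right_tail:
  assumes j: "j \<le> m"
  shows "(\<lambda>z. e z j * (ray_laplace (right_ext j) t z - prim z j 0 (point - w j + cis t)))
    \<in> O[far](\<lambda>z. exp (- (z * point)))"
proof -
  obtain A where "sector_function a \<theta> \<gamma> A (snd (\<Phi> (w j))) (right_ext j)"
    using right_function[OF j] by blast
  then interpret R: sector_function a \<theta> \<gamma> A "snd (\<Phi> (w j))" "right_ext j" .
  have RS_sub: "RS \<subseteq> open_sector {a<..<b}" using angles by (intro open_sector_mono) auto
  have P: "R.is_primitive z (prim z j 0)" for z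
    unfolding R.is_primitive_def
  proof
    show "\<forall>\<zeta>\<in>RS. (prim z j 0 has_field_derivative right_ext j \<zeta> * exp (- (z * \<zeta>))) (at \<zeta>)"
    proof
      fix \<zeta> assume \<zeta>: "\<zeta> \<in> RS"
      have "\<zeta> \<in> sl j 0" using \<zeta> Sr_subset by blast
      from prim(1)[OF j this, of z]
      show "(prim z j 0 has_field_derivative right_ext j \<zeta> * exp (- (z * \<zeta>))) (at \<zeta>)"
        unfolding branch_facts(2)[OF j \<zeta>] .
    qed
    show "(prim z j 0 \<longlongrightarrow> 0) (at 0 within RS)"
      by (rule tendsto_within_subset[OF prim(3)[OF j] RS_sub])
  qed
  have q: "point - w j + cis t \<in> RS" using point_right[OF j t, of 1] by simp
  show ?thesis
  proof (rule R.ray_laplace_tail[OF q t])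
    fix C K
    assume C: "0 \<le> C" and bound: "\<And>z P. R.is_primitive z P \<Longrightarrow> K \<le> Re (z * cis t) \<Longrightarrow>
      cmod (ray_laplace (right_ext j) t z - P (point - w j + cis t)) \<le> C * exp (- Re (z * (point - w j + cis t)))"
    show ?thesis
    proof (rule bigo_farI[where K = K and C = C and u = 1 and s = t])
      fix z assume "K \<le> Re (z * cis t)"
      from bound[OF P this]
      show "cmod (ray_laplace (right_ext j) t z - prim z j 0 (point - w j + cis t))
          \<le> C * exp (- Re (z * (point + of_real 1 * cis t - w j)))"
        by (simp only: of_real_1 mult_1 add_diff_eq diff_add_eq)
    qed (use C in simp_all)
  qed
qed

lemma left_tail:
  assumes j: "j \<le> m"
  shows "(\<lambda>z. e z j * (ray_laplace (left_ext j) t' z - left_prim z j (point - w j + cis t')))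
    \<in> O[far](\<lambda>z. exp (- (z * point)))"
proof -
  obtain A where "sector_function \<theta> b \<gamma> A (snd (\<Phi>' (w j))) (left_ext j)"
    using left_function[OF j] by blast
  then interpret R: sector_function \<theta> b \<gamma> A "snd (\<Phi>' (w j))" "left_ext j" .
  have q: "point - w j + cis t' \<in> LS" using point_left[OF j t', of 1] by simp
  show ?thesis
  proof (rule R.ray_laplace_tail[OF q t'])
    fix C K
    assume C: "0 \<le> C" and bound: "\<And>z P. R.is_primitive z P \<Longrightarrow> K \<le> Re (z * cis t') \<Longrightarrow>
      cmod (ray_laplace (left_ext j) t' z - P (point - w j + cis t')) \<le> C * exp (- Re (z * (point - w j + cis t')))"
    show ?thesis
    proof (rule bigo_farI[where K = K and C = C and u = 1 and s = t'])
      fix z assume "K \<le> Re (z * cis t')"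
      from bound[OF left_prim[OF j] this]
      show "cmod (ray_laplace (left_ext j) t' z - left_prim z j (point - w j + cis t'))
          \<le> C * exp (- Re (z * (point + of_real 1 * cis t' - w j)))"
        by (simp only: of_real_1 mult_1 add_diff_eq diff_add_eq)
    qed (use C in simp_all)
  qed
qed

text \<open>Brings both contours back to \<open>point\<close>, inside the slit domain of gap
  \<open>m - j\<close>, which contains it because \<open>\<rho>\<close> lies between the moduli of
  \<open>w m\<close> and \<open>w (Suc m)\<close>. The value at \<open>point\<close> need not be
  estimated: it occurs on both sides.\<close>

lemma segment_bound:
  assumes j: "j \<le> m" and s: "s = t \<or> s = t'"
  shows "(\<lambda>z. e z j * (prim z j (m - j) (point - w j + cis s) - prim z j (m - j) (point - w j)))
    \<in> O[far](\<lambda>z. exp (- (z * point)))"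
proof -
  have cont: "continuous_on (sl j (m - j)) (br j (m - j))"
    by (rule holomorphic_on_imp_continuous_on[OF branch_facts(1)[OF j]])
  have sub: "closed_segment (point - w j) (point - w j + cis s) \<subseteq> sl j (m - j)"
    using s t t' by (intro segment_subset_slit[OF j]) auto
  show ?thesis
  proof (rule primitive_segment_bound[OF cont sub])
    fix M assume M: "\<And>z P. (\<And>\<zeta>. \<zeta> \<in> sl j (m - j) \<Longrightarrow> (P has_field_derivative br j (m - j) \<zeta> * exp (- (z * \<zeta>))) (at \<zeta>)) \<Longrightarrow>
      0 \<le> Re (z * cis s) \<Longrightarrow> cmod (P (point - w j + cis s) - P (point - w j)) \<le> M * exp (- Re (z * (point - w j)))"
    show ?thesis
    proof (rule bigo_farI[where K = 0 and C = "\<bar>M\<bar>" and u = 0 and s = s])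
      fix z assume "0 \<le> Re (z * cis s)"
      with prim(1)[OF j] have "cmod (prim z j (m - j) (point - w j + cis s) - prim z j (m - j) (point - w j))
          \<le> M * exp (- Re (z * (point - w j)))"
        by (rule M[where P = "prim z j (m - j)"])
      also have "\<dots> \<le> \<bar>M\<bar> * exp (- Re (z * (point - w j)))" by (rule mult_right_mono) auto
      finally show "cmod (prim z j (m - j) (point - w j + cis s) - prim z j (m - j) (point - w j))
          \<le> \<bar>M\<bar> * exp (- Re (z * (point + of_real 0 * cis s - w j)))"
        by (simp only: of_real_0 mult_zero_left add_0_right)
    qed (use s in simp_all)
  qed
qed

lemma difference_far:
  "(\<lambda>z. laplace_symbols {a<..<\<theta>} \<gamma> w m \<Phi> z - laplace_symbols {\<theta><..<b} \<gamma> w m \<Phi>' z)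
    \<in> O[far](\<lambda>z. exp (- (z * point)))"
proof -
  define gR where "gR j z = e z j * (ray_laplace (right_ext j) t z - prim z j 0 (point - w j + cis t))" for j z
  define gL where "gL j z = e z j * (ray_laplace (left_ext j) t' z - left_prim z j (point - w j + cis t'))" for j z
  define sg where "sg s j z = e z j * (prim z j (m - j) (point - w j + cis s) - prim z j (m - j) (point - w j))" for s j z
  \<comment> \<open>The tail to infinity and the unit segment on the right, minus their counterparts
    on the left: once the Stokes identity is applied, this is the exact difference of the
    transforms.\<close>
  have "(\<lambda>z. ((\<Sum>j\<le>m. gR j z) + (\<Sum>j\<le>m. sg t j z)) - ((\<Sum>j\<le>m. sg t' j z) + (\<Sum>j\<le>m. gL j z)))
      \<in> O[far](\<lambda>z. exp (- (z * point)))"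
    unfolding gR_def gL_def sg_def
    by (intro sum_in_bigo big_sum_in_bigo right_tail left_tail segment_bound) auto
  moreover have "\<forall>\<^sub>F z in far. ((\<Sum>j\<le>m. gR j z) + (\<Sum>j\<le>m. sg t j z)) - ((\<Sum>j\<le>m. sg t' j z) + (\<Sum>j\<le>m. gL j z)) =
      laplace_symbols {a<..<\<theta>} \<gamma> w m \<Phi> z - laplace_symbols {\<theta><..<b} \<gamma> w m \<Phi>' z"
  proof (rule eventually_mono[OF eventually_far[of "max (\<gamma> t) (\<gamma> t') + 1"]])
    fix z assume "max (\<gamma> t) (\<gamma> t') + 1 \<le> Re (z * cis t) \<and> max (\<gamma> t) (\<gamma> t') + 1 \<le> Re (z * cis t')"
    then have adm: "\<gamma> t < Re (z * cis t)" "\<gamma> t' < Re (z * cis t')" by linarith+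
    define c where "c = (\<Sum>j\<le>m. e z j * fst (\<Phi> (w j)))"
    have R: "laplace_symbols {a<..<\<theta>} \<gamma> w m \<Phi> z = c + (\<Sum>j\<le>m. gR j z) + (\<Sum>j\<le>m. e z j * prim z j (m - j) (point - w j + cis t))"
    proof -
      have "e z j * laplace {a<..<\<theta>} \<gamma> (\<Phi> (w j)) z =
          e z j * fst (\<Phi> (w j)) + gR j z + e z j * prim z j (m - j) (point - w j + cis t)" if j: "j \<le> m" for j
      proof -
        have "point - w j + cis t \<in> RS" using point_right[OF j t, of 1] by simp
        from prim(2)[OF j this, of z "m - j"] show ?thesis
          unfolding laplace_right_eq[OF j t adm(1)] gR_def by (simp add: algebra_simps)
      qed
      then show ?thesis
        unfolding laplace_symbols_def c_def by (simp add: sum.distrib)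
    qed
    have L: "laplace_symbols {\<theta><..<b} \<gamma> w m \<Phi>' z = c + (\<Sum>j\<le>m. gL j z) + (\<Sum>j\<le>m. e z j * prim z j (m - j) (point - w j + cis t'))"
    proof -
      have q: "point + cis t' - w j = point - w j + cis t'" for j by simp
      have "e z j * laplace {\<theta><..<b} \<gamma> (\<Phi>' (w j)) z =
          e z j * (fst (\<Phi>' (w j)) + left_prim z j (point - w j + cis t')) + gL j z" if j: "j \<le> m" for j
        unfolding laplace_left_eq[OF j t' adm(2)] gL_def by (simp add: algebra_simps)
      then have "laplace_symbols {\<theta><..<b} \<gamma> w m \<Phi>' z =
          (\<Sum>j\<le>m. e z j * (fst (\<Phi>' (w j)) + left_prim z j (point - w j + cis t'))) + (\<Sum>j\<le>m. gL j z)"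
        unfolding laplace_symbols_def by (simp add: sum.distrib)
      also have "(\<Sum>j\<le>m. e z j * (fst (\<Phi>' (w j)) + left_prim z j (point - w j + cis t'))) =
          c + (\<Sum>j\<le>m. e z j * prim z j (m - j) (point - w j + cis t'))"
      proof -
        have "point + cis t' - w k \<in> LS" if "k \<le> m" for k
          using point_left[OF that t', of 1] unfolding q by simp
        from stokes_identity[OF this, of z] show ?thesis unfolding q c_def .
      qed
      finally show ?thesis by simp
    qed
    have sg: "(\<Sum>j\<le>m. sg s j z) = (\<Sum>j\<le>m. e z j * prim z j (m - j) (point - w j + cis s)) -
        (\<Sum>j\<le>m. e z j * prim z j (m - j) (point - w j))" for s
      unfolding sg_def right_diff_distrib by (rule sum_subtractf)
    show "((\<Sum>j\<le>m. gR j z) + (\<Sum>j\<le>m. sg t j z)) - ((\<Sum>j\<le>m. sg t' j z) + (\<Sum>j\<le>m. gL j z)) =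
      laplace_symbols {a<..<\<theta>} \<gamma> w m \<Phi> z - laplace_symbols {\<theta><..<b} \<gamma> w m \<Phi>' z"
      unfolding R L sg by simp
  qed
  ultimately show ?thesis
    by (subst (asm) landau_o.big.in_cong) auto
qed

lemma difference_far_bound:
  obtains C K where "\<And>z. K \<le> Re (z * cis t) \<Longrightarrow> K \<le> Re (z * cis t') \<Longrightarrow>
    cmod (laplace_symbols {a<..<\<theta>} \<gamma> w m \<Phi> z - laplace_symbols {\<theta><..<b} \<gamma> w m \<Phi>' z)
      \<le> C * exp (- \<rho> * Re (cis \<theta> * z))"
proof -
  obtain C where "\<forall>\<^sub>F z in far. cmod (laplace_symbols {a<..<\<theta>} \<gamma> w m \<Phi> z - laplace_symbols {\<theta><..<b} \<gamma> w m \<Phi>' z)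
      \<le> C * cmod (exp (- (z * point)))"
    using difference_far unfolding bigo_def by blast
  then obtain K where K: "\<And>z. K \<le> min (Re (z * cis t)) (Re (z * cis t')) \<Longrightarrow>
      cmod (laplace_symbols {a<..<\<theta>} \<gamma> w m \<Phi> z - laplace_symbols {\<theta><..<b} \<gamma> w m \<Phi>' z)
      \<le> C * cmod (exp (- (z * point)))"
    unfolding far_def eventually_filtercomap_at_top_linorder by blast
  have E: "cmod (exp (- (z * point))) = exp (- \<rho> * Re (cis \<theta> * z))" for z
    by (simp add: point_def algebra_simps)
  show thesis by (rule that[of K C], unfold E[symmetric], rule K) simp
qed

end

end

theorem theorem29p5:
  fixes \<theta> a b \<rho> \<epsilon> :: real and I :: "real set" and \<Omega> :: "complex set"
    and w :: "nat \<Rightarrow> complex" and \<gamma> :: "real \<Rightarrow> real" and m :: nat and \<Phi> :: symbols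
  assumes Omega: "\<Omega> \<noteq> {}" "closed \<Omega>" "discrete \<Omega>"
    and I: "I = {a<..<b}" "b - a < pi" "\<theta> \<in> I"
    and w: "\<Omega> \<inter> {of_real \<xi> * cis t | \<xi> t. 0 \<le> \<xi> \<and> t \<in> I} = range w"
      "range w \<subseteq> half_line \<theta>" "w 0 = 0" "strict_mono (\<lambda>n. cmod (w n))"
    and gamma: "locally_bounded_on (right_of I \<theta> \<union> left_of I \<theta>) \<gamma>"
    and rho: "cmod (w m) < \<rho>" "\<rho> < cmod (w (Suc m))"
    and eps: "0 < \<epsilon>" "\<epsilon> < min (pi / 2) (infdist \<theta> (frontier I))"
    and gamma_below: "bdd_below (\<gamma> ` (right_of I (\<theta> - \<epsilon>) \<union> left_of I (\<theta> + \<epsilon>)))"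
    and Phi: "\<Phi> \<in> summable_symbols I \<theta> \<gamma> \<Omega> w m"
    and Stokes_Phi: "trunc w m (Stokes \<Omega> (half_line \<theta>) \<Phi>) \<in> summable_symbols I \<theta> \<gamma> \<Omega> w m"
  shows "\<exists>C. \<forall>z \<in> laplace_domain (right_of I (\<theta> - \<epsilon>)) (\<lambda>t. \<gamma> t + \<epsilon>)
                 \<inter> laplace_domain (left_of I (\<theta> + \<epsilon>)) (\<lambda>t. \<gamma> t + \<epsilon>).
           cmod (laplace_symbols (right_of I \<theta>) \<gamma> w m \<Phi> z
                 - laplace_symbols (left_of I \<theta>) \<gamma> w m (trunc w m (Stokes \<Omega> (half_line \<theta>) \<Phi>)) z)
             \<le> C * exp (- \<rho> * Re (cis \<theta> * z))"
proof -
  have angles: "a < \<theta>" "\<theta> < b" using I by auto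
  have eqs: "right_of I \<theta> = {a<..<\<theta>}" "left_of I \<theta> = {\<theta><..<b}"
    using angles by (auto simp: right_of_def left_of_def I)
  interpret stokes_setting \<theta> a b \<rho> \<Omega> w \<gamma> m \<Phi>
    by unfold_locales (use angles I w gamma[unfolded eqs] rho Phi Stokes_Phi in simp_all)
  have "frontier I = {a, b}"
    using angles unfolding I(1) frontier_def by simp
  then have "infdist \<theta> (frontier I) \<le> dist \<theta> a" "infdist \<theta> (frontier I) \<le> dist \<theta> b"
    by (auto intro: infdist_le)
  then have \<epsilon>: "0 < \<epsilon>" "a < \<theta> - \<epsilon>" "\<theta> + \<epsilon> < b"
    using eps angles by (auto simp: dist_real_def)
  have eqs': "right_of I (\<theta> - \<epsilon>) = {a<..<\<theta> - \<epsilon>}" "left_of I (\<theta> + \<epsilon>) = {\<theta> + \<epsilon><..<b}"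
    using angles \<epsilon> by (auto simp: right_of_def left_of_def I)
  have bdd: "bdd_below (\<gamma> ` {a<..<\<theta> - \<epsilon>})" "bdd_below (\<gamma> ` {\<theta> + \<epsilon><..<b})"
    using gamma_below unfolding eqs' image_Un by (auto intro: bdd_below_mono)
  \<comment> \<open>For \<open>z\<close> in the domain some admissible direction on each side has
    real part above \<open>\<gamma>\<close>, hence above \<open>B\<close>; this is the input for
    large \<open>cmod z\<close>.\<close>
  obtain B where B: "\<And>t. t \<in> {a<..<\<theta> - \<epsilon>} \<union> {\<theta> + \<epsilon><..<b} \<Longrightarrow> B \<le> \<gamma> t"
    using gamma_below unfolding eqs' bdd_below_def by blast
  define \<Delta> where "\<Delta> z = laplace_symbols {a<..<\<theta>} \<gamma> w m \<Phi> z - laplace_symbols {\<theta><..<b} \<gamma> w m \<Phi>' z" for z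
  define X where "X z = exp (- \<rho> * Re (cis \<theta> * z))" for z
  have half: "\<theta> - \<epsilon> / 2 \<in> {a<..<\<theta>}" "\<theta> + \<epsilon> / 2 \<in> {\<theta><..<b}" using \<epsilon> by auto
  obtain C1 K where C1: "\<And>z. K \<le> Re (z * cis (\<theta> - \<epsilon> / 2)) \<Longrightarrow> K \<le> Re (z * cis (\<theta> + \<epsilon> / 2)) \<Longrightarrow> cmod (\<Delta> z) \<le> C1 * X z"
    using difference_far_bound[OF half] unfolding \<Delta>_def X_def by blast
  obtain N where N: "\<And>z t t'. a < t \<Longrightarrow> t < \<theta> - \<epsilon> \<Longrightarrow> \<theta> + \<epsilon> < t' \<Longrightarrow> t' < b \<Longrightarrow>
      B \<le> Re (z * cis t) \<Longrightarrow> B \<le> Re (z * cis t') \<Longrightarrow> N < cmod z \<Longrightarrow>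
      K \<le> Re (z * cis (\<theta> - \<epsilon> / 2)) \<and> K \<le> Re (z * cis (\<theta> + \<epsilon> / 2))"
    using far_directions_admissible[OF \<epsilon>(1) I(2), of \<theta> B K] by blast
  \<comment> \<open>For \<open>cmod z \<le> N\<close> admissible directions are moved into
    \<open>[lo, \<theta> - \<epsilon>]\<close> and \<open>[\<theta> + \<epsilon>, hi]\<close>,
    compact in the open intervals, at the cost of half the margin.\<close>
  obtain lo where lo: "a < lo" "lo < \<theta> - \<epsilon>" "\<And>z t. cmod z \<le> N \<Longrightarrow> a < t \<Longrightarrow> t < \<theta> - \<epsilon> \<Longrightarrow> \<gamma> t + \<epsilon> < Re (z * cis t) \<Longrightarrow>
    \<exists>t'. lo \<le> t' \<and> t' < \<theta> - \<epsilon> \<and> \<gamma> t' + \<epsilon> / 2 < Re (z * cis t')"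
    using admissible_direction_right[OF \<epsilon>(2,1) bdd(1), of N] by blast
  obtain hi where hi: "\<theta> + \<epsilon> < hi" "hi < b" "\<And>z t. cmod z \<le> N \<Longrightarrow> \<theta> + \<epsilon> < t \<Longrightarrow> t < b \<Longrightarrow> \<gamma> t + \<epsilon> < Re (z * cis t) \<Longrightarrow>
    \<exists>t'. \<theta> + \<epsilon> < t' \<and> t' \<le> hi \<and> \<gamma> t' + \<epsilon> / 2 < Re (z * cis t')"
    using admissible_direction_left[OF \<epsilon>(3,1) bdd(2), of N] by blast
  define D where "D = laplace_domain {a<..<\<theta> - \<epsilon>} (\<lambda>t. \<gamma> t + \<epsilon>) \<inter> laplace_domain {\<theta> + \<epsilon><..<b} (\<lambda>t. \<gamma> t + \<epsilon>)"
  have D: "\<exists>t t'. a < t \<and> t < \<theta> - \<epsilon> \<and> \<gamma> t + \<epsilon> < Re (z * cis t) \<and> \<theta> + \<epsilon> < t' \<and> t' < b \<and> \<gamma> t' + \<epsilon> < Re (z * cis t')"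
    if "z \<in> D" for z
    using that unfolding D_def laplace_domain_def Int_iff UN_iff mem_Collect_eq Bex_def greaterThanLessThan_iff by blast
  have "\<Delta> \<in> O[principal (D \<inter> cball 0 N)](\<lambda>_. 1)"
    unfolding \<Delta>_def[abs_def]
  proof (rule difference_bounded[where lo = lo and hi = "\<theta> - \<epsilon>" and lo' = "\<theta> + \<epsilon>" and hi' = hi and \<kappa> = "\<epsilon> / 2" and N = N])
    fix z assume z: "z \<in> D \<inter> cball 0 N"
    then have zN: "cmod z \<le> N" by simp
    obtain t t' where tt: "a < t" "t < \<theta> - \<epsilon>" "\<gamma> t + \<epsilon> < Re (z * cis t)" "\<theta> + \<epsilon> < t'" "t' < b" "\<gamma> t' + \<epsilon> < Re (z * cis t')"
      using D z by blast
    show "\<exists>t. lo \<le> t \<and> t \<le> \<theta> - \<epsilon> \<and> \<gamma> t + \<epsilon> / 2 < Re (z * cis t)"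
      using lo(3)[OF zN tt(1-3)] less_imp_le by blast
    show "\<exists>t. \<theta> + \<epsilon> \<le> t \<and> t \<le> hi \<and> \<gamma> t + \<epsilon> / 2 < Re (z * cis t)"
      using hi(3)[OF zN tt(4-6)] less_imp_le by blast
    show "cmod z \<le> N" by (rule zN)
  qed (use lo hi \<epsilon> in auto)
  then obtain C2 where "\<forall>z\<in>D \<inter> cball 0 N. cmod (\<Delta> z) \<le> C2 * cmod 1"
    unfolding bigo_def eventually_principal by blast
  then have C2: "cmod (\<Delta> z) \<le> C2" if "z \<in> D" "cmod z \<le> N" for z
    using that by simp
  have \<rho>: "0 < \<rho>" using rho(1) norm_ge_zero[of "w m"] by linarith
  \<comment> \<open>On bounded \<open>z\<close> the comparison function is at least
    \<open>exp (- \<rho> * N)\<close>, so the factor \<open>exp (\<rho> * N)\<close> turns a plain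
    bound into the required one.\<close>
  define C where "C = max C1 (\<bar>C2\<bar> * exp (\<rho> * N))"
  have "cmod (\<Delta> z) \<le> C * X z" if z: "z \<in> D" for z
  proof (cases "cmod z \<le> N")
    case True
    have "Re (cis \<theta> * z) \<le> cmod z" using complex_Re_le_cmod[of "cis \<theta> * z"] by (simp add: norm_mult)
    then have "\<rho> * Re (cis \<theta> * z) \<le> \<rho> * N" using True \<rho> by (intro mult_left_mono) auto
    then have "1 \<le> exp (\<rho> * N) * X z" unfolding X_def exp_add[symmetric] by (simp only: one_le_exp_iff)
    then have "\<bar>C2\<bar> * 1 \<le> \<bar>C2\<bar> * (exp (\<rho> * N) * X z)" by (intro mult_left_mono) auto
    moreover have "\<bar>C2\<bar> * exp (\<rho> * N) * X z \<le> C * X z"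
      unfolding C_def by (intro mult_right_mono) (auto simp: X_def)
    ultimately show ?thesis using C2[OF z True] by (simp only: mult.assoc)
  next
    case False
    obtain t t' where tt: "a < t" "t < \<theta> - \<epsilon>" "\<gamma> t + \<epsilon> < Re (z * cis t)" "\<theta> + \<epsilon> < t'" "t' < b" "\<gamma> t' + \<epsilon> < Re (z * cis t')"
      using D z by blast
    have "B \<le> \<gamma> t" "B \<le> \<gamma> t'" using tt by (auto intro!: B)
    then have "B \<le> Re (z * cis t)" "B \<le> Re (z * cis t')" using tt(3,6) \<epsilon>(1) by linarith+
    then have "cmod (\<Delta> z) \<le> C1 * X z" using N[OF tt(1,2,4,5)] False by (intro C1) auto
    also have "\<dots> \<le> C * X z" unfolding C_def by (intro mult_right_mono) (auto simp: X_def)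
    finally show ?thesis .
  qed
  then show ?thesis unfolding eqs eqs' D_def \<Delta>_def X_def by blast
qed

end
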